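(* Let $G=\mathrm{SL}(3,\mathbb{R})$, and let $H$ be a closed, connected subgroup of $AN$, with Lie algebra $\mathfrak h$, that is compatible with $A$. The subgroup $H$ fails to be a Cartan-decomposition subgroup of $G$ if and only if at least one of the following holds: (1) $\dim H\le 1$; (2) $\mathfrak h=\mathfrak u_\alpha+\mathfrak u_{\alpha+\beta}$ or $\mathfrak h=\mathfrak u_\beta+\mathfrak u_{\alpha+\beta}$; (3) $\mathfrak h=\ker(\alpha-\beta)+\mathfrak u$ for some one-dimensional subspace $\mathfrak u$ of $\mathfrak u_\alpha+\mathfrak u_\beta$ with $\mathfrak u\notin\{\mathfrak u_\alpha,\mathfrak u_\beta\}$ (here $\ker(\alpha-\beta)\subset\mathfrak a$, regarding $\alpha,\beta$ as linear functionals on $\mathfrak a$); (4) $\dim H=2$ and $H\ne(H\cap A)\ltimes(H\cap N)$; (5) $H=T\ltimes U_\omega$ for some (one-dimensional) one-parameter subgroup $T$ of $A$, with Lie algebra $\mathfrak t$, and some positive root $\omega$, and $\mathfrak t^+\smallsetminus\{0\}$ is contained in the region $\mathcal C$ associated (as in the context) to $\omega$ and $\mathfrak t$.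
   Context: A closed subgroup $H$ of $G$ is a Cartan-decomposition subgroup of $G$ if $H$ is connected and there is a compact subset $C$ of $G$ with $CHC=G$. $A$ is the group of diagonal matrices in $\mathrm{SL}(3,\mathbb{R})$ with positive entries and $N$ is the group of upper-triangular matrices with $1$'s on the diagonal; $\mathfrak a,\mathfrak n$ are their Lie algebras. The positive roots are $\alpha(a)=a_1/a_2$, $\beta(a)=a_2/a_3$ (for $a=\mathrm{diag}(a_1,a_2,a_3)\in A$) and $\alpha+\beta$; the root spaces $\mathfrak u_\alpha,\mathfrak u_\beta,\mathfrak u_{\alpha+\beta}$ consist of the matrices whose only possibly nonzero entry is the $(1,2)$, $(2,3)$, $(1,3)$ entry respectively, and $U_\omega=\exp\mathfrak u_\omega$. A subgroup $H$ of $AN$ is compatible with $A$ if $H\subset T\,U\,C_N(T)$, where $T=A\cap(HN)$, $U=H\cap N$, and $C_N(T)$ is the centralizer of $T$ in $N$. Region $\mathcal C$: for a positive root $\omega$ and a one-dimensional subspace $\mathfrak t\subset\mathfrak a$, let $\mathfrak a_\omega=[\mathfrak u_\omega,\mathfrak u_{-\omega}]\cap\mathfrak a$ (a one-dimensional subspace). Choose rays (from $0$) $\mathfrak t^+\subset\mathfrak t$ and $\mathfrak a_\omega^+\subset\mathfrak a_\omega$ such that $\langle t\mid a\rangle\ge 0$ for all $t\in\mathfrak t^+$, $a\in\mathfrak a_\omega^+$, where $\langle\cdot\mid\cdot\rangle$ is the inner product on $\mathfrak a$ given by the Killing form. If $\mathfrak a_\omega^+$ (minus $0$) is contained in the interior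 of a Weyl chamber of $\mathfrak a$, then $\mathcal C$ is the interior of that Weyl chamber; if $\mathfrak a_\omega^+$ is the wall between two Weyl chambers $\mathcal C_1,\mathcal C_2$, then $\mathcal C$ is the interior of $\mathcal C_1\cup\mathfrak a_\omega^+\cup\mathcal C_2$. *)

theory Defs
  imports "HOL-Analysis.Analysis" "HOL-Algebra.Coset"
begin

type_synonym mat3 = "real^3^3"

subsection \<open>The group and its subgroups\<close>

definition SL3 :: "mat3 monoid" where
  "SL3 = \<lparr>carrier = {M. det M = 1}, mult = (**), one = mat 1\<rparr>"

lemma group_SL3: "group SL3"
proof (rule groupI)
  fix M assume "M \<in> carrier SL3"
  then have M: "det M = 1" by (simp add: SL3_def)
  then obtain K where K: "K ** M = mat 1"
    by (metis invertible_def invertible_det_nz zero_neq_one)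
  with M have "det K = 1"
    by (metis det_I det_mul mult.right_neutral)
  with K show "\<exists>K\<in>carrier SL3. K \<otimes>\<^bsub>SL3\<^esub> M = \<one>\<^bsub>SL3\<^esub>"
    by (auto simp: SL3_def)
qed (auto simp: SL3_def det_mul matrix_mul_assoc [symmetric])

definition A_grp :: "mat3 set" where
  "A_grp = {M \<in> carrier SL3. (\<forall>i j. i \<noteq> j \<longrightarrow> M$i$j = 0) \<and> (\<forall>i. M$i$i > 0)}"

text \<open>The index type \<^typ>\<open>3\<close> is ordered with \<open>3 = 0\<close> as its least element, so
  ``upper triangular'' is spelled out entry by entry.\<close>

definition N_grp :: "mat3 set" where
  "N_grp = {M. (\<forall>i. M$i$i = 1) \<and> M$2$1 = 0 \<and> M$3$1 = 0 \<and> M$3$2 = 0}"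

definition closed_subgroup :: "mat3 set \<Rightarrow> bool" where
  "closed_subgroup H \<longleftrightarrow> subgroup H SL3 \<and> closedin (top_of_set (carrier SL3)) H"

definition cartan_decomposition_subgroup :: "mat3 set \<Rightarrow> bool" where
  "cartan_decomposition_subgroup H \<longleftrightarrow>
     closed_subgroup H \<and> connected H \<and>
     (\<exists>C \<subseteq> carrier SL3. compact C \<and> C <#>\<^bsub>SL3\<^esub> H <#>\<^bsub>SL3\<^esub> C = carrier SL3)"

definition centralizer_N :: "mat3 set \<Rightarrow> mat3 set" where
  "centralizer_N T = {n \<in> N_grp. \<forall>t\<in>T. n ** t = t ** n}"

definition compatible_with_A :: "mat3 set \<Rightarrow> bool" where
  "compatible_with_A H \<longleftrightarrow>
     (let T = A_grp \<inter> (H <#>\<^bsub>SL3\<^esub> N_grp); U = H \<inter> N_grp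
      in H \<subseteq> T <#>\<^bsub>SL3\<^esub> U <#>\<^bsub>SL3\<^esub> centralizer_N T)"

definition internal_semidirect :: "mat3 set \<Rightarrow> mat3 set \<Rightarrow> mat3 set \<Rightarrow> bool" where
  "internal_semidirect H T U \<longleftrightarrow>
     subgroup H SL3 \<and> subgroup T (SL3\<lparr>carrier := H\<rparr>) \<and> U \<lhd> (SL3\<lparr>carrier := H\<rparr>) \<and>
     T \<inter> U = {mat 1} \<and> H = T <#>\<^bsub>SL3\<^esub> U"

subsection \<open>Exponential map and Lie algebras\<close>

text \<open>The function \<^const>\<open>exp\<close> is not usable on matrices, because the multiplication
  \<open>(*)\<close> on \<^typ>\<open>mat3\<close> is componentwise.\<close>

definition mexp :: "mat3 \<Rightarrow> mat3" where
  "mexp X = (\<Sum>n. (1 / fact n) *\<^sub>R (((**) X) ^^ n) (mat 1))"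

text \<open>The Lie algebra of a closed subgroup of \<^const>\<open>SL3\<close>, as a subspace of the
  \<open>3 \<times> 3\<close> matrices; the dimension of the group is the dimension of this subspace.\<close>

definition lie_algebra :: "mat3 set \<Rightarrow> mat3 set" where
  "lie_algebra H = {X. \<forall>t::real. mexp (t *\<^sub>R X) \<in> H}"

definition lie_dim :: "mat3 set \<Rightarrow> nat" where
  "lie_dim H = dim (lie_algebra H)"

definition bracket :: "mat3 \<Rightarrow> mat3 \<Rightarrow> mat3" where
  "bracket X Y = X ** Y - Y ** X"

definition lie_a :: "mat3 set" where
  "lie_a = lie_algebra A_grp"

definition sl3 :: "mat3 set" where
  "sl3 = {X. trace X = 0}"

definition trace_on :: "mat3 set \<Rightarrow> (mat3 \<Rightarrow> mat3) \<Rightarrow> real" where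
  "trace_on V f =
     (let B = (SOME B. B \<subseteq> V \<and> independent B \<and> span B = V)
      in \<Sum>b\<in>B. representation B (f b) b)"

definition killing_form :: "mat3 \<Rightarrow> mat3 \<Rightarrow> real" where
  "killing_form X Y = trace_on sl3 (\<lambda>Z. bracket X (bracket Y Z))"

subsection \<open>Roots\<close>

text \<open>A root is encoded by a pair \<open>(i, j)\<close> with \<open>i \<noteq> j\<close>: it is the functional
  \<open>X \<mapsto> X\<^sub>i\<^sub>i - X\<^sub>j\<^sub>j\<close> on \<^const>\<open>lie_a\<close> (the differential of \<open>a \<mapsto> a\<^sub>i / a\<^sub>j\<close>), and its
  negative is \<open>(j, i)\<close>.\<close>

type_synonym root = "3 \<times> 3"

definition root_functional :: "root \<Rightarrow> mat3 \<Rightarrow> real" where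
  "root_functional \<omega> X = X $ fst \<omega> $ fst \<omega> - X $ snd \<omega> $ snd \<omega>"

definition root_space :: "root \<Rightarrow> mat3 set" where
  "root_space \<omega> = {X. \<forall>i j. (i, j) \<noteq> \<omega> \<longrightarrow> X$i$j = 0}"

definition root_subgroup :: "root \<Rightarrow> mat3 set" where
  "root_subgroup \<omega> = mexp ` root_space \<omega>"

definition neg_root :: "root \<Rightarrow> root" where
  "neg_root \<omega> = (snd \<omega>, fst \<omega>)"

definition root_alpha :: root where "root_alpha = (1, 2)"
definition root_beta :: root where "root_beta = (2, 3)"
definition root_alpha_beta :: root where "root_alpha_beta = (1, 3)"

definition positive_roots :: "root set" where
  "positive_roots = {root_alpha, root_beta, root_alpha_beta}"

definition all_roots :: "root set" where
  "all_roots = positive_roots \<union> neg_root ` positive_roots"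

subsection \<open>Weyl chambers and the region attached to a root and a line\<close>

definition weyl_chambers :: "mat3 set set" where
  "weyl_chambers =
     closure ` components {X \<in> lie_a. \<forall>\<omega>\<in>all_roots. root_functional \<omega> X \<noteq> 0}"

definition interior_in_a :: "mat3 set \<Rightarrow> mat3 set" where
  "interior_in_a S = (top_of_set lie_a) interior_of S"

definition coroot_line :: "root \<Rightarrow> mat3 set" where
  "coroot_line \<omega> =
     span {bracket X Y | X Y. X \<in> root_space \<omega> \<and> Y \<in> root_space (neg_root \<omega>)} \<inter> lie_a"

definition ray_in :: "mat3 set \<Rightarrow> mat3 set \<Rightarrow> bool" where
  "ray_in r L \<longleftrightarrow> (\<exists>X\<in>L. X \<noteq> 0 \<and> r = {s *\<^sub>R X | s. s \<ge> 0})"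

definition is_region :: "mat3 set \<Rightarrow> mat3 set \<Rightarrow> bool" where
  "is_region r R \<longleftrightarrow>
     (\<exists>W\<in>weyl_chambers. r - {0} \<subseteq> interior_in_a W \<and> R = interior_in_a W) \<or>
     (\<exists>W1\<in>weyl_chambers. \<exists>W2\<in>weyl_chambers.
        W1 \<noteq> W2 \<and> r = W1 \<inter> W2 \<and> R = interior_in_a (W1 \<union> r \<union> W2))"

text \<open>The pair of rays is unique up to a simultaneous sign change, except when the two lines
  are orthogonal.  The condition below does not depend on the choice: the sign change replaces
  the region by its negative, and in the orthogonal case the condition always fails.\<close>

definition line_in_region :: "root \<Rightarrow> mat3 set \<Rightarrow> bool" where
  "line_in_region \<omega> L \<longleftrightarrow>
     (\<exists>tp ap R. ray_in tp L \<and> ray_in ap (coroot_line \<omega>) \<and>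
        (\<forall>t\<in>tp. \<forall>a\<in>ap. killing_form t a \<ge> 0) \<and>
        is_region ap R \<and> tp - {0} \<subseteq> R)"

definition one_parameter_subgroup_of_A :: "mat3 set \<Rightarrow> bool" where
  "one_parameter_subgroup_of_A T \<longleftrightarrow>
     (\<exists>X\<in>lie_a. X \<noteq> 0 \<and> T = range (\<lambda>s::real. mexp (s *\<^sub>R X)))"

end

theory Submission
  imports Defs
begin

text \<open>By the decomposition \<open>G = KAK\<close>, a closed connected subgroup is a Cartan-decomposition subgroup iff
  the pairs of the sizes of \<open>h\<close> and of \<open>h\<^sup>-\<^sup>1\<close>, for \<open>h\<close> in the subgroup, fill the cone
  \<open>p \<le> q\<^sup>2\<close>, \<open>q \<le> p\<^sup>2\<close>, \<open>p, q \<ge> 1\<close> up to bounded factors.  Compatibility with \<open>A\<close> leaves three kinds of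
  Lie algebras: those inside \<open>\<nn>\<close>, those containing \<open>\<aa>\<close>, and the sums of an ideal \<open>\<uu>\<close> of \<open>\<nn>\<close>-elements and
  a line spanned by \<open>D + c E\<close>, where \<open>D\<close> is diagonal and commutes with the root vector \<open>E\<close>.  On each of
  them the two sizes are explicit.  In dimension at least 3 they fill the cone.  In dimension 2 the cone is
  missed along a boundary line, by a power or (if \<open>c \<noteq> 0\<close>) by a logarithm, exactly in the listed cases.
  For \<open>\<real>D + \<uu>\<^sub>\<omega>\<close> with \<open>\<omega> = (i, j)\<close> this happens iff the diagonal entry of \<open>D\<close> at the third index lies
  strictly between the other two.  Since coroots of \<open>SL(3)\<close> are regular, the region attached to \<open>\<omega>\<close> is an
  open Weyl chamber, and this is the region condition.\<close>

subsection \<open>Matrices\<close>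

text \<open>The criterion needs explicit elements, whereas \<open>H\<close> is given only as a
  closed connected group. The bridge is that such a group is determined by its Lie algebra: for each
  algebra that occurs, an explicit set of exponentials or of products
  \<open>mexp (s *\<^sub>R X) ** mexp U\<close> is shown to be a closed subgroup whose Lie algebra
  contains that of \<open>H\<close>, and connectedness forces \<open>H\<close> into it.

  Compatibility is a condition on group elements and has to be carried down to the algebra. The
  delicate case is a diagonal part D with two equal adjacent entries: its centralizer in N is then
  nontrivial, and adding the corresponding root vector to \<uu> can fail to give a subalgebra.

  The inverse is measured next to the matrix because one norm sees only the largest entry a_1 of the
  Cartan component; the norm of the inverse sees 1/a_3 = a_1 a_2, and the two together determine the
  component up to bounded factors. The logarithmic cases come from the factor c t that the nilpotent
  part c E puts next to exp t: no bounded factor absorbs it, yet it is smaller than every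
  power.\<close>

definition ut :: "real \<Rightarrow> real \<Rightarrow> real \<Rightarrow> real \<Rightarrow> real \<Rightarrow> real \<Rightarrow> mat3" where
  "ut a b c x y z = vector [vector [a, x, z], vector [0, b, y], vector [0, 0, c]]"

text \<open>The adjugate (transposed cofactor matrix). On determinant 1 it is a polynomial formula
  for the inverse, so the entries of an inverse are read off without division.\<close>

definition adj :: "mat3 \<Rightarrow> mat3" where
  "adj M = vector
     [vector [M$2$2 * M$3$3 - M$2$3 * M$3$2, M$1$3 * M$3$2 - M$1$2 * M$3$3, M$1$2 * M$2$3 - M$1$3 * M$2$2],
      vector [M$2$3 * M$3$1 - M$2$1 * M$3$3, M$1$1 * M$3$3 - M$1$3 * M$3$1, M$1$3 * M$2$1 - M$1$1 * M$2$3],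
      vector [M$2$1 * M$3$2 - M$2$2 * M$3$1, M$1$2 * M$3$1 - M$1$1 * M$3$2, M$1$1 * M$2$2 - M$1$2 * M$2$1]]"

text \<open>Submultiplicative, and on triangular matrices literally a sum of absolute values of the
  parameters; this keeps all later size computations exact.\<close>

definition l1 :: "mat3 \<Rightarrow> real" where
  "l1 M = (\<Sum>i\<in>UNIV. \<Sum>j\<in>UNIV. \<bar>M$i$j\<bar>)"

lemma ut_nth [simp]:
  "ut a b c x y z $1$1 = a" "ut a b c x y z $1$2 = x" "ut a b c x y z $1$3 = z"
  "ut a b c x y z $2$1 = 0" "ut a b c x y z $2$2 = b" "ut a b c x y z $2$3 = y"
  "ut a b c x y z $3$1 = 0" "ut a b c x y z $3$2 = 0" "ut a b c x y z $3$3 = c"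
  by (simp_all add: ut_def)

lemma mat3_eq_iff:
  fixes M K :: mat3
  shows "M = K \<longleftrightarrow> M$1$1 = K$1$1 \<and> M$1$2 = K$1$2 \<and> M$1$3 = K$1$3
    \<and> M$2$1 = K$2$1 \<and> M$2$2 = K$2$2 \<and> M$2$3 = K$2$3
    \<and> M$3$1 = K$3$1 \<and> M$3$2 = K$3$2 \<and> M$3$3 = K$3$3"
  by (auto simp: vec_eq_iff forall_3)

lemma mat3_mult_nth: "((A::mat3) ** B)$i$j = A$i$1 * B$1$j + A$i$2 * B$2$j + A$i$3 * B$3$j"
  by (simp add: matrix_matrix_mult_def sum_3)

lemma mat3_1_nth [simp]: "(mat 1 :: mat3)$i$j = (if i = j then 1 else 0)"
  by (simp add: mat_def)

lemma ut_eq_iff [simp]: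
  "ut a b c x y z = ut a' b' c' x' y' z' \<longleftrightarrow> a = a' \<and> b = b' \<and> c = c' \<and> x = x' \<and> y = y' \<and> z = z'"
  by (auto simp: mat3_eq_iff)

lemma ut_mult [simp]:
  "ut a b c x y z ** ut a' b' c' x' y' z' =
     ut (a * a') (b * b') (c * c') (a * x' + x * b') (b * y' + y * c') (a * z' + x * y' + z * c')"
  by (simp add: mat3_eq_iff mat3_mult_nth)

lemma ut_add [simp]:
  "ut a b c x y z + ut a' b' c' x' y' z' = ut (a + a') (b + b') (c + c') (x + x') (y + y') (z + z')"
  by (simp add: mat3_eq_iff)

lemma ut_diff [simp]:
  "ut a b c x y z - ut a' b' c' x' y' z' = ut (a - a') (b - b') (c - c') (x - x') (y - y') (z - z')"
  by (simp add: mat3_eq_iff)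

lemma ut_scaleR [simp]: "r *\<^sub>R ut a b c x y z = ut (r * a) (r * b) (r * c) (r * x) (r * y) (r * z)"
  by (simp add: mat3_eq_iff)

lemma ut_uminus [simp]: "- ut a b c x y z = ut (-a) (-b) (-c) (-x) (-y) (-z)"
  by (simp add: mat3_eq_iff)

lemma mat_1_ut: "(mat 1 :: mat3) = ut 1 1 1 0 0 0"
  by (simp add: mat3_eq_iff)

lemma zero_ut: "(0 :: mat3) = ut 0 0 0 0 0 0"
  by (simp add: mat3_eq_iff)

lemma det_ut [simp]: "det (ut a b c x y z) = a * b * c"
  by (simp add: det_3)

lemma eq_utI: "M$2$1 = 0 \<Longrightarrow> M$3$1 = 0 \<Longrightarrow> M$3$2 = 0 \<Longrightarrow>
    M = ut (M$1$1) (M$2$2) (M$3$3) (M$1$2) (M$2$3) (M$1$3)"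
  by (simp add: mat3_eq_iff)

lemma adj_ut [simp]:
  "adj (ut a b c x y z) = ut (b * c) (a * c) (a * b) (- x * c) (- a * y) (x * y - z * b)"
  by (simp add: mat3_eq_iff adj_def)

lemma l1_eq: "l1 M = \<bar>M$1$1\<bar> + \<bar>M$1$2\<bar> + \<bar>M$1$3\<bar> + (\<bar>M$2$1\<bar> + \<bar>M$2$2\<bar> + \<bar>M$2$3\<bar>)
    + (\<bar>M$3$1\<bar> + \<bar>M$3$2\<bar> + \<bar>M$3$3\<bar>)"
  by (simp add: l1_def sum_3)

lemma l1_ut [simp]: "l1 (ut a b c x y z) = \<bar>a\<bar> + \<bar>b\<bar> + \<bar>c\<bar> + \<bar>x\<bar> + \<bar>y\<bar> + \<bar>z\<bar>"
  by (simp add: l1_eq)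

lemma l1_nonneg [simp]: "0 \<le> l1 M"
  by (simp add: l1_def sum_nonneg)

lemma l1_mult: "l1 (A ** B) \<le> l1 A * l1 B"
proof -
  have "l1 (A ** B) \<le> (\<Sum>i\<in>UNIV. \<Sum>j\<in>UNIV. \<Sum>k\<in>UNIV. \<bar>A$i$k\<bar> * \<bar>B$k$j\<bar>)"
    unfolding l1_def matrix_matrix_mult_def
    by (intro sum_mono) (simp add: order_trans[OF sum_abs] abs_mult)
  also have "\<dots> = (\<Sum>i\<in>UNIV. \<Sum>k\<in>UNIV. \<bar>A$i$k\<bar> * (\<Sum>j\<in>UNIV. \<bar>B$k$j\<bar>))"
    by (subst sum.swap) (simp add: sum_distrib_left)
  also have "\<dots> \<le> (\<Sum>i\<in>UNIV. \<Sum>k\<in>UNIV. \<bar>A$i$k\<bar> * l1 B)"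
    unfolding l1_def
    by (intro sum_mono mult_left_mono member_le_sum) (auto intro: sum_nonneg)
  also have "\<dots> = l1 A * l1 B"
    by (simp add: l1_def sum_distrib_right)
  finally show ?thesis .
qed

lemma mult_adj: "M ** adj M = det M *\<^sub>R mat 1" "adj M ** M = det M *\<^sub>R mat 1"
  by (simp_all add: mat3_eq_iff mat3_mult_nth adj_def det_3 algebra_simps)

lemma adj_mult: "adj (A ** B) = adj B ** adj A"
  by (simp add: mat3_eq_iff mat3_mult_nth adj_def algebra_simps)

lemma adj_adj: "adj (adj M) = det M *\<^sub>R M"
  by (simp add: mat3_eq_iff adj_def det_3 algebra_simps)

subsection \<open>Subgroups\<close>

lemma carrier_SL3 [simp]: "M \<in> carrier SL3 \<longleftrightarrow> det M = 1"
  by (simp add: SL3_def)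

lemma mult_SL3 [simp]: "x \<otimes>\<^bsub>SL3\<^esub> y = x ** y"
  by (simp add: SL3_def)

lemma one_SL3 [simp]: "\<one>\<^bsub>SL3\<^esub> = mat 1"
  by (simp add: SL3_def)

lemma det_adj: "det (M :: mat3) = 1 \<Longrightarrow> det (adj M) = 1"
  using det_mul[of M "adj M"] mult_adj(1)[of M] by simp

lemma inv_SL3: "det M = 1 \<Longrightarrow> inv\<^bsub>SL3\<^esub> M = adj M"
  by (rule group.inv_equality[OF group_SL3]) (auto simp: mult_adj det_adj)

lemma subgroup_SL3_iff:
  "subgroup H SL3 \<longleftrightarrow>
     (\<forall>M\<in>H. det M = 1 \<and> adj M \<in> H) \<and> mat 1 \<in> H \<and> (\<forall>x\<in>H. \<forall>y\<in>H. x ** y \<in> H)" (is "_ \<longleftrightarrow> ?R")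
proof
  assume "subgroup H SL3"
  then show ?R
    using subgroup.subset[of H SL3] subgroup.m_closed[of H SL3] subgroup.m_inv_closed[of H SL3]
      subgroup.one_closed[of H SL3] by (auto simp: inv_SL3 subset_iff)
next
  assume ?R
  then show "subgroup H SL3"
    by (intro group.subgroupI[OF group_SL3]) (auto simp: inv_SL3)
qed

lemma set_mult_SL3: "X <#>\<^bsub>SL3\<^esub> Y = {x ** y | x y. x \<in> X \<and> y \<in> Y}"
  by (auto simp: set_mult_def)

lemma continuous_on_mat3I:
  fixes f :: "'a::topological_space \<Rightarrow> mat3"
  assumes "\<And>i j. continuous_on S (\<lambda>x. f x $ i $ j)"
  shows "continuous_on S f"
proof -
  have "continuous_on S (\<lambda>x. \<chi> i. \<chi> j. f x $ i $ j)"
    by (intro continuous_on_vec_lambda assms)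
  then show ?thesis by simp
qed

lemma continuous_on_adj: "continuous_on S adj"
proof (rule continuous_on_mat3I)
  fix i j :: 3
  have "\<forall>i j. continuous_on S (\<lambda>x. adj x $ i $ j)"
    unfolding forall_3 adj_def vector_3 by (intro conjI continuous_intros)
  then show "continuous_on S (\<lambda>x. adj x $ i $ j)" by blast
qed

lemma continuous_on_det3: "continuous_on S (det :: mat3 \<Rightarrow> real)"
  unfolding det_3[abs_def] by (intro continuous_intros)

lemma continuous_on_l1: "continuous_on S l1"
  unfolding l1_def[abs_def] by (intro continuous_intros)

lemma continuous_on_mat3_mult [continuous_intros]:
  fixes f g :: "'a::topological_space \<Rightarrow> mat3"
  assumes "continuous_on S f" "continuous_on S g"
  shows "continuous_on S (\<lambda>x. f x ** g x)"
  by (intro continuous_on_mat3I)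
     (unfold mat3_mult_nth, intro continuous_intros assms)

lemma closed_SL3: "closed (carrier SL3)"
proof -
  have "carrier SL3 = det -` {1}" by auto
  then show ?thesis
    by (metis closed_singleton closed_vimage continuous_on_det3)
qed

lemma closed_subgroup_iff: "closed_subgroup H \<longleftrightarrow> subgroup H SL3 \<and> closed H"
proof -
  have "H \<subseteq> carrier SL3" if "subgroup H SL3"
    using that by (rule subgroup.subset)
  then show ?thesis
    unfolding closed_subgroup_def using closed_SL3
    by (metis closedin_closed_eq)
qed

lemma norm_le_l1: "norm M \<le> l1 M"
proof -
  have "norm M \<le> (\<Sum>i\<in>UNIV. norm (M$i))"
    unfolding norm_vec_def by (rule L2_set_le_sum) simp
  also have "\<dots> \<le> l1 M"
    unfolding l1_def by (intro sum_mono) (metis norm_le_l1_cart real_norm_def sum.cong)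
  finally show ?thesis .
qed

text \<open>Sets of this shape serve as the compact factor in the decomposition C H C = G.\<close>

lemma compact_l1_ball: "compact {M. det M = 1 \<and> l1 M \<le> R}"
proof -
  have "closed ({M. l1 M \<le> R} \<inter> carrier SL3)"
    by (intro closed_Int closed_SL3 closed_Collect_le continuous_on_l1 continuous_intros)
  moreover have "bounded {M. l1 M \<le> R}"
    unfolding bounded_iff using norm_le_l1 order_trans by blast
  ultimately show ?thesis
    unfolding compact_eq_bounded_closed
    by (auto simp: Int_def conj_commute elim!: bounded_subset)
qed

subsection \<open>The matrix exponential\<close>

text \<open>A copy of the type of matrices whose multiplication is the matrix product and whose
  norm is the operator norm, so that the library's exponential function applies.\<close>

typedef m3 = "UNIV :: mat3 set" morphisms mat_of M3 ..

lemma mat_of_M3 [simp]: "mat_of (M3 X) = X"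
  by (simp add: M3_inverse)

lemma m3_eq_iff: "a = b \<longleftrightarrow> mat_of a = mat_of b"
  by (simp add: mat_of_inject)

instantiation m3 :: real_normed_algebra_1
begin

definition "0 = M3 0"
definition "1 = M3 (mat 1)"
definition "a + b = M3 (mat_of a + mat_of b)"
definition "a - b = M3 (mat_of a - mat_of b)"
definition "- a = M3 (- mat_of a)"
definition "a * b = M3 (mat_of a ** mat_of b)"
definition "r *\<^sub>R a = M3 (r *\<^sub>R mat_of a)"
definition norm_m3 :: "m3 \<Rightarrow> real" where "norm_m3 a = onorm ((*v) (mat_of a))"
definition dist_m3 :: "m3 \<Rightarrow> m3 \<Rightarrow> real" where "dist_m3 a b = norm (a - b)"
definition sgn_m3 :: "m3 \<Rightarrow> m3" where "sgn_m3 a = inverse (norm a) *\<^sub>R a"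
definition uniformity_m3 :: "(m3 \<times> m3) filter"
  where "uniformity_m3 = (INF e\<in>{0 <..}. principal {(x, y). dist x y < e})"
definition open_m3 :: "m3 set \<Rightarrow> bool"
  where "open_m3 U = (\<forall>x\<in>U. \<forall>\<^sub>F (x', y) in uniformity. x' = x \<longrightarrow> y \<in> U)"

lemmas m3_defs = zero_m3_def one_m3_def plus_m3_def minus_m3_def uminus_m3_def times_m3_def
  scaleR_m3_def

instance
proof
  fix a b c :: m3 and r s :: real
  show "a * b * c = a * (b * c)"
    by (simp add: m3_defs matrix_mul_assoc)
  show "(a + b) * c = a * c + b * c"
    by (simp add: m3_defs M3_inject mat3_eq_iff mat3_mult_nth algebra_simps)
  show "a * (b + c) = a * b + a * c"
    by (simp add: m3_defs matrix_add_ldistrib)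
  show "r *\<^sub>R a * b = r *\<^sub>R (a * b)" "a * r *\<^sub>R b = r *\<^sub>R (a * b)"
    by (simp_all add: m3_defs M3_inject mat3_eq_iff mat3_mult_nth algebra_simps)
  have bl: "bounded_linear ((*v) (mat_of a))" for a
    by (rule matrix_vector_mul_bounded_linear)
  show "(norm a = 0) = (a = 0)"
  proof -
    have "(norm a = 0) = (\<forall>x. mat_of a *v x = 0)"
      unfolding norm_m3_def by (rule onorm_eq_0[OF bl])
    also have "\<dots> = (a = 0)"
      by (metis M3_inverse UNIV_I m3_eq_iff matrix_eq matrix_vector_mult_0 zero_m3_def)
    finally show ?thesis .
  qed
  show "norm (a + b) \<le> norm a + norm b"
  proof -
    have "(*v) (mat_of a + mat_of b) = (\<lambda>x. mat_of a *v x + mat_of b *v x)"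
      by (rule ext) (rule matrix_vector_mult_add_rdistrib)
    then show ?thesis
      using onorm_triangle[OF bl[of a] bl[of b]] by (simp add: norm_m3_def m3_defs)
  qed
  show "norm (r *\<^sub>R a) = \<bar>r\<bar> * norm a"
    using onorm_scaleR[OF bl[of a], of r]
    by (simp add: norm_m3_def m3_defs scaleR_matrix_vector_assoc)
  show "norm (a * b) \<le> norm a * norm b"
    using onorm_compose[OF bl[of a] bl[of b]]
    by (simp add: norm_m3_def m3_defs o_def matrix_vector_mul_assoc)
  show "norm (1::m3) = 1"
  proof -
    have "(*v) (mat 1 :: mat3) = (\<lambda>x. x)"
      by (rule ext) simp
    then show ?thesis
      using onorm_id[where 'a="real^3"] by (simp add: norm_m3_def m3_defs)
  qed
  show "(0::m3) \<noteq> 1"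
    by (simp add: m3_defs M3_inject mat3_eq_iff)
qed (auto simp: m3_defs m3_eq_iff scaleR_add_right scaleR_add_left sgn_m3_def dist_m3_def uniformity_m3_def
      open_m3_def algebra_simps)

end

lemma mat_of_simps [simp]:
  "mat_of 0 = 0" "mat_of 1 = mat 1" "mat_of (a + b) = mat_of a + mat_of b"
  "mat_of (a - b) = mat_of a - mat_of b" "mat_of (a * b) = mat_of a ** mat_of b"
  "mat_of (r *\<^sub>R a) = r *\<^sub>R mat_of a" "mat_of (- a) = - mat_of a"
  by (simp_all add: m3_defs)

text \<open>With \<open>bounded_linear_M3\<close> this says that the operator norm and the Euclidean
  norm have the same limits, so that series and derivatives pass from \<open>exp\<close> to
  \<open>mexp\<close>. The constant 9 counts the entries, each bounded by the operator norm.\<close>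

lemma bounded_linear_mat_of: "bounded_linear mat_of"
proof (rule bounded_linear_intro[where K = 9])
  fix a :: m3
  have "\<bar>mat_of a $ i $ j\<bar> \<le> norm a" for i j
  proof -
    have "(mat_of a *v axis j 1) $ i = mat_of a $ i $ j"
      by (simp add: matrix_vector_mult_def axis_def if_distrib sum.delta cong: if_cong)
    then have "\<bar>mat_of a $ i $ j\<bar> \<le> norm (mat_of a *v axis j 1)"
      by (metis component_le_norm_cart real_norm_def)
    also have "\<dots> \<le> norm a * norm (axis j 1 :: real^3)"
      unfolding norm_m3_def by (rule onorm) (rule matrix_vector_mul_bounded_linear)
    finally show ?thesis by simp
  qed
  then have "l1 (mat_of a) \<le> (\<Sum>i\<in>(UNIV::3 set). \<Sum>j\<in>(UNIV::3 set). norm a)"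
    unfolding l1_def by (intro sum_mono)
  then show "norm (mat_of a) \<le> norm a * 9"
    using norm_le_l1[of "mat_of a"] by (simp add: sum_3)
qed simp_all

lemma bounded_linear_M3: "bounded_linear M3"
proof (rule bounded_linear_intro[where K = 9])
  fix X :: mat3
  have "\<bar>X$i$j\<bar> \<le> norm X" for i j
    using component_le_norm_cart[of "X$i" j] Finite_Cartesian_Product.norm_nth_le[of X i]
    by linarith
  then have "norm (M3 X) \<le> real CARD(3) * real CARD(3) * norm X"
    unfolding norm_m3_def mat_of_M3
    by (intro onorm_le_matrix_component)
  then show "norm (M3 X) \<le> norm X * 9" by simp
qed (simp_all add: m3_defs)

instance m3 :: banach
proof (standard)
  fix X :: "nat \<Rightarrow> m3" assume "Cauchy X"
  then have "Cauchy (\<lambda>n. mat_of (X n))"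
    by (rule bounded_linear.Cauchy[OF bounded_linear_mat_of])
  then obtain L where "(\<lambda>n. mat_of (X n)) \<longlonglongrightarrow> L"
    by (meson Cauchy_convergent_iff convergentD)
  then have "(\<lambda>n. M3 (mat_of (X n))) \<longlonglongrightarrow> M3 L"
    by (rule bounded_linear.tendsto[OF bounded_linear_M3])
  then show "convergent X"
    by (auto simp: mat_of_inverse convergent_def)
qed

lemma mat_of_power: "mat_of (M3 X ^ n) = (((**) X) ^^ n) (mat 1)"
  by (induction n) auto

lemma mat_of_exp: "mat_of (exp (M3 X)) = mexp X"
proof -
  have "mat_of (exp (M3 X)) = (\<Sum>n. mat_of (M3 X ^ n /\<^sub>R fact n))"
    unfolding exp_def
    by (rule bounded_linear.suminf[OF bounded_linear_mat_of summable_exp_generic])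
  then show ?thesis
    by (simp add: mexp_def mat_of_power divide_inverse)
qed

lemma mexp_0 [simp]: "mexp 0 = mat 1"
  by (metis exp_zero mat_of_exp mat_of_simps(2) zero_m3_def)

lemma M3_simps: "M3 (X + Y) = M3 X + M3 Y" "M3 (r *\<^sub>R X) = r *\<^sub>R M3 X" "M3 (X ** Y) = M3 X * M3 Y"
  "M3 (mat 1) = 1" "M3 (X - Y) = M3 X - M3 Y"
  by (simp_all add: m3_eq_iff)

lemma mexp_add_scaleR: "mexp ((s + t) *\<^sub>R X) = mexp (s *\<^sub>R X) ** mexp (t *\<^sub>R X)"
proof -
  have "exp ((s + t) *\<^sub>R M3 X) = exp (s *\<^sub>R M3 X) * exp (t *\<^sub>R M3 X)"
    unfolding scaleR_add_left by (rule exp_add_commuting) simp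
  then show ?thesis
    by (metis M3_simps(2) mat_of_exp mat_of_simps(5))
qed

lemma mexp_minus: "mexp (- X) ** mexp X = mat 1" "mexp X ** mexp (- X) = mat 1"
  using mexp_add_scaleR[of "-1" 1 X] mexp_add_scaleR[of 1 "-1" X] by simp_all

lemma continuous_mexp_scaleR: "continuous_on S (\<lambda>t. mexp (t *\<^sub>R X))"
proof -
  have "continuous_on S (\<lambda>t. mat_of (exp (t *\<^sub>R M3 X)))"
    unfolding continuous_on_eq_continuous_within
    by (intro ballI bounded_linear.continuous[OF bounded_linear_mat_of]
        has_vector_derivative_continuous[OF exp_scaleR_has_vector_derivative_right])
  then show ?thesis by (simp add: M3_simps flip: mat_of_exp)
qed

lemma mexp_conj:
  assumes "g' ** g = mat 1" "g ** g' = mat 1"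
  shows "mexp (g ** X ** g') = g ** mexp X ** g'"
proof -
  have pow: "(((**) (g ** X ** g')) ^^ n) (mat 1) = g ** (((**) X) ^^ n) (mat 1) ** g'" for n
  proof (induction n)
    case (Suc n)
    then show ?case
      by (simp add: assms matrix_mul_assoc[symmetric]) (simp add: assms matrix_mul_assoc)
  qed (simp add: assms)
  have bl: "bounded_linear (\<lambda>Y::mat3. g ** Y ** g')"
    by (rule linear_conv_bounded_linear[THEN iffD1])
       (auto intro!: linearI simp: mat3_eq_iff mat3_mult_nth algebra_simps)
  have sc: "g ** (r *\<^sub>R Y) ** g' = r *\<^sub>R (g ** Y ** g')" for r and Y :: mat3
    by (simp add: mat3_eq_iff mat3_mult_nth algebra_simps)
  have sm: "summable (\<lambda>n. (1 / fact n) *\<^sub>R (((**) X) ^^ n) (mat 1))"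
  proof -
    have "summable (\<lambda>n. mat_of (M3 X ^ n /\<^sub>R fact n))"
      by (rule bounded_linear.summable[OF bounded_linear_mat_of summable_exp_generic])
    then show ?thesis by (simp add: mat_of_power divide_inverse)
  qed
  have "g ** mexp X ** g' = (\<Sum>n. g ** ((1 / fact n) *\<^sub>R (((**) X) ^^ n) (mat 1)) ** g')"
    unfolding mexp_def by (rule bounded_linear.suminf[OF bl sm])
  also have "\<dots> = mexp (g ** X ** g')"
    unfolding mexp_def pow
    by (simp add: sc)
  finally show ?thesis by simp
qed

section \<open>High powers of matrices close to the identity\<close>

text \<open>Telescoping produces n terms with n - 1 factors of norm at most m each; because
  \<open>1 \<le> m\<close> the exponent can be relaxed to n, which keeps the induction
  uniform.\<close>

lemma norm_power_diff_le:
  fixes a b :: "'a::real_normed_algebra_1"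
  assumes "norm a \<le> m" "norm b \<le> m" "1 \<le> m"
  shows "norm (a ^ n - b ^ n) \<le> real n * m ^ n * norm (a - b)"
proof (induction n)
  case (Suc n)
  have bn: "norm (b ^ n) \<le> m ^ n"
    using norm_power_ineq[of b n] power_mono[OF assms(2) norm_ge_zero, of n] by linarith
  have "a ^ Suc n - b ^ Suc n = a * (a ^ n - b ^ n) + (a - b) * b ^ n"
    by (simp add: algebra_simps)
  then have "norm (a ^ Suc n - b ^ Suc n) \<le> norm a * norm (a ^ n - b ^ n) + norm (a - b) * norm (b ^ n)"
    by (metis add_mono norm_mult_ineq norm_triangle_le)
  also have "\<dots> \<le> m * (real n * m ^ n * norm (a - b)) + norm (a - b) * m ^ n"
    using Suc assms bn by (intro add_mono mult_mono) auto
  also have "\<dots> \<le> m * (real n * m ^ n * norm (a - b)) + norm (a - b) * m ^ Suc n"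
    using assms(3) power_increasing[of n "Suc n" m] by (intro add_left_mono mult_left_mono) auto
  finally show ?case by (simp add: algebra_simps)
qed simp

lemma exp_scaleR_tendsto:
  fixes X :: "'a::{real_normed_algebra_1,banach}"
  shows "((\<lambda>h. (exp (h *\<^sub>R X) - 1) /\<^sub>R h) \<longlongrightarrow> X) (at 0)"
proof -
  have "((\<lambda>t. exp (t *\<^sub>R X)) has_vector_derivative X) (at 0)"
    using exp_scaleR_has_vector_derivative_right[of X 0 UNIV] by simp
  then have "((\<lambda>t. exp (t *\<^sub>R X)) has_derivative (\<lambda>h. h *\<^sub>R X)) (at 0)"
    by (simp add: has_vector_derivative_def)
  then have lim: "((\<lambda>h. norm (exp (h *\<^sub>R X) - 1 - h *\<^sub>R X) / \<bar>h\<bar>) \<longlongrightarrow> 0) (at 0)"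
    by (simp add: has_derivative_at)
  have "((\<lambda>h. norm ((exp (h *\<^sub>R X) - 1) /\<^sub>R h - X)) \<longlongrightarrow> 0) (at 0)"
  proof (rule Lim_transform_eventually[OF lim])
    have "norm (exp (h *\<^sub>R X) - 1 - h *\<^sub>R X) / \<bar>h\<bar> = norm ((exp (h *\<^sub>R X) - 1) /\<^sub>R h - X)"
      if "h \<noteq> 0" for h
    proof -
      have "(exp (h *\<^sub>R X) - 1) /\<^sub>R h - X = (exp (h *\<^sub>R X) - 1 - h *\<^sub>R X) /\<^sub>R h"
        using that by (simp add: scaleR_diff_right)
      then show ?thesis by (simp add: divide_inverse mult.commute)
    qed
    then show "\<forall>\<^sub>F h in at 0. norm (exp (h *\<^sub>R X) - 1 - h *\<^sub>R X) / \<bar>h\<bar> = norm ((exp (h *\<^sub>R X) - 1) /\<^sub>R h - X)"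
      by (simp add: eventually_at_filter)
  qed
  then show ?thesis
    by (simp add: tendsto_norm_zero_iff LIM_zero_cancel)
qed

lemma exp_inverse_nat_power:
  fixes X :: "'a::{real_normed_algebra_1,banach}"
  assumes "k > 0"
  shows "exp (X /\<^sub>R real k) ^ k = exp X"
proof -
  have "exp (real n *\<^sub>R Y) = exp Y ^ n" for n and Y :: 'a
  proof (induction n)
    case (Suc n)
    have "exp (real (Suc n) *\<^sub>R Y) = exp (Y + real n *\<^sub>R Y)"
      by (simp add: algebra_simps)
    also have "\<dots> = exp Y * exp (real n *\<^sub>R Y)"
      by (rule exp_add_commuting) simp
    finally show ?case using Suc by simp
  qed simp
  from this[of k "X /\<^sub>R real k"] assms show ?thesis by simp
qed

text \<open>Compare \<open>a n\<close> with \<open>b n = exp (X / k n)\<close>, whose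
  \<open>k n\<close>-th power is exactly \<open>exp X\<close>. The two agree to first order, and the
  difference of the powers costs only the bounded factor \<open>exp C\<close> on top of
  \<open>k n * norm (a n - b n)\<close>, which tends to 0.\<close>

lemma power_tendsto_exp:
  fixes a :: "nat \<Rightarrow> 'a::{real_normed_algebra_1,banach}" and k :: "nat \<Rightarrow> nat"
  assumes k: "filterlim k at_top sequentially"
    and lim: "(\<lambda>n. real (k n) *\<^sub>R (a n - 1)) \<longlonglongrightarrow> X"
  shows "(\<lambda>n. a n ^ k n) \<longlonglongrightarrow> exp X"
proof -
  define b where "b n = exp (X /\<^sub>R real (k n))" for n
  define C where "C = norm X + 1"
  have kr: "filterlim (\<lambda>n. real (k n)) at_top sequentially"
    by (rule filterlim_compose[OF filterlim_real_sequentially k])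
  have kpos: "\<forall>\<^sub>F n in sequentially. k n > 0"
    using filterlim_at_top[THEN iffD1, OF k, rule_format, of 1]
    by (rule eventually_mono) simp
  have "filterlim (\<lambda>n. inverse (real (k n))) (at 0) sequentially"
  proof -
    have "filterlim (\<lambda>n. inverse (real (k n))) (at_right 0) sequentially"
      using filterlim_compose[OF filterlim_inverse_at_right_top kr] .
    then show ?thesis by (rule filterlim_mono) (auto simp: at_within_le_at)
  qed
  from filterlim_compose[OF exp_scaleR_tendsto[of X] this]
  have limb: "(\<lambda>n. real (k n) *\<^sub>R (b n - 1)) \<longlonglongrightarrow> X"
    by (simp add: b_def)
  have "\<forall>\<^sub>F n in sequentially. norm (real (k n) *\<^sub>R (a n - 1)) < C"
    using tendsto_norm[OF lim] unfolding C_def by (rule order_tendstoD) simp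
  then have ev: "\<forall>\<^sub>F n in sequentially. norm (a n ^ k n - exp X)
      \<le> exp C * norm (real (k n) *\<^sub>R (a n - 1) - real (k n) *\<^sub>R (b n - 1))"
    using kpos
  proof eventually_elim
    case (elim n)
    \<comment> \<open>A common bound for both norms, chosen so that its \<open>k n\<close>-th power
      is \<open>exp C\<close>, independent of n.\<close>
    define m where "m = exp (C / real (k n))"
    have k0: "real (k n) > 0" using elim by simp
    have le: "real (k n) * norm (a n - 1) < C"
      using elim(1) unfolding norm_scaleR by simp
    have "norm (a n) \<le> 1 + norm (a n - 1)"
      by (metis add.commute diff_add_cancel norm_one norm_triangle_ineq)
    also have "norm (a n - 1) \<le> C / real (k n)"
      using le k0 by (simp add: field_simps)
    also have "1 + C / real (k n) \<le> m"
      unfolding m_def by (rule exp_ge_add_one_self)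
    finally have na: "norm (a n) \<le> m" by simp
    have "norm (b n) \<le> exp (norm (X /\<^sub>R real (k n)))"
      unfolding b_def by (rule norm_exp)
    also have "\<dots> \<le> m"
      unfolding m_def using k0 by (simp add: C_def field_simps)
    finally have nb: "norm (b n) \<le> m" .
    have m1: "1 \<le> m" unfolding m_def using k0 by (simp add: C_def)
    have mk: "m ^ k n = exp C"
      using k0 by (simp add: m_def flip: exp_of_nat_mult)
    have "norm (a n ^ k n - b n ^ k n) \<le> real (k n) * m ^ k n * norm (a n - b n)"
      by (rule norm_power_diff_le[OF na nb m1])
    also have "\<dots> = exp C * norm (real (k n) *\<^sub>R (a n - b n))"
      using mk by simp
    also have "b n ^ k n = exp X"
      unfolding b_def using exp_inverse_nat_power elim(2) by blast
    also have "real (k n) *\<^sub>R (a n - b n) = real (k n) *\<^sub>R (a n - 1) - real (k n) *\<^sub>R (b n - 1)"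
      by (simp add: algebra_simps)
    finally show ?case .
  qed
  have "(\<lambda>n. exp C * norm (real (k n) *\<^sub>R (a n - 1) - real (k n) *\<^sub>R (b n - 1))) \<longlonglongrightarrow> exp C * norm (X - X)"
    by (intro tendsto_intros lim limb)
  then have "(\<lambda>n. norm (a n ^ k n - exp X)) \<longlonglongrightarrow> 0"
    using ev by (intro tendsto_sandwich[OF _ ev tendsto_const]) auto
  then show ?thesis
    using LIM_zero_cancel tendsto_norm_zero_iff by blast
qed

lemma tendsto_mat3_mult [tendsto_intros]:
  fixes f g :: "'a \<Rightarrow> mat3"
  assumes "(f \<longlongrightarrow> a) F" "(g \<longlongrightarrow> b) F"
  shows "((\<lambda>x. f x ** g x) \<longlongrightarrow> a ** b) F"
  by (intro vec_tendstoI) (unfold mat3_mult_nth, intro tendsto_intros assms)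

lemma matpow_tendsto_mexp:
  fixes a :: "nat \<Rightarrow> mat3" and k :: "nat \<Rightarrow> nat"
  assumes "filterlim k at_top sequentially"
    and "(\<lambda>n. real (k n) *\<^sub>R (a n - mat 1)) \<longlonglongrightarrow> X"
  shows "(\<lambda>n. (((**) (a n)) ^^ k n) (mat 1)) \<longlonglongrightarrow> mexp X"
proof -
  have "(\<lambda>n. M3 (real (k n) *\<^sub>R (a n - mat 1))) \<longlonglongrightarrow> M3 X"
    using assms(2) by (rule bounded_linear.tendsto[OF bounded_linear_M3])
  then have "(\<lambda>n. real (k n) *\<^sub>R (M3 (a n) - 1)) \<longlonglongrightarrow> M3 X"
    by (simp only: M3_simps)
  from power_tendsto_exp[OF assms(1) this]
  have "(\<lambda>n. mat_of (M3 (a n) ^ k n)) \<longlonglongrightarrow> mat_of (exp (M3 X))"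
    by (rule bounded_linear.tendsto[OF bounded_linear_mat_of])
  then show ?thesis by (simp only: mat_of_power mat_of_exp)
qed

lemma mexp_scaleR_tendsto: "((\<lambda>h. (mexp (h *\<^sub>R X) - mat 1) /\<^sub>R h) \<longlongrightarrow> X) (at 0)"
proof -
  have "((\<lambda>h. mat_of ((exp (h *\<^sub>R M3 X) - 1) /\<^sub>R h)) \<longlongrightarrow> mat_of (M3 X)) (at 0)"
    by (intro bounded_linear.tendsto[OF bounded_linear_mat_of] exp_scaleR_tendsto)
  then show ?thesis
    by (simp add: mat_of_exp[symmetric] M3_simps)
qed

lemma tendsto_seq_at_0:
  assumes "(f \<longlongrightarrow> L) (at 0)" "e \<longlonglongrightarrow> 0" "\<And>n. e n \<noteq> (0::real)"
  shows "(\<lambda>n. f (e n)) \<longlonglongrightarrow> L"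
  using assms by (auto simp: tendsto_at_iff_sequentially o_def)

lemma seq_inverse_Suc:
  "(\<lambda>n. 1 / real (Suc n)) \<longlonglongrightarrow> 0"
  "filterlim (\<lambda>n. real (Suc n)) at_top sequentially"
  using LIMSEQ_inverse_real_of_nat filterlim_compose[OF filterlim_real_sequentially filterlim_Suc]
  by (simp_all add: inverse_eq_divide)

lemma mat3_inv_unique:
  fixes M K :: mat3
  assumes "M ** K = mat 1" "det M = 1"
  shows "K = adj M"
proof -
  have "K = adj M ** (M ** K)"
    by (simp add: matrix_mul_assoc mult_adj assms(2))
  also have "\<dots> = adj M"
    by (simp add: assms(1))
  finally show ?thesis .
qed

lemma subgroup_matpow:
  assumes "subgroup H SL3" "a \<in> H"
  shows "(((**) a) ^^ n) (mat 1) \<in> H"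
  using assms by (induction n) (auto simp: subgroup_SL3_iff)

subsection \<open>The Lie algebra of a closed subgroup\<close>

lemma lie_algebraD: "X \<in> lie_algebra H \<Longrightarrow> mexp X \<in> H"
  unfolding lie_algebra_def by (metis (mono_tags) mem_Collect_eq scaleR_one)

lemma lie_algebra_mono: "H \<subseteq> K \<Longrightarrow> lie_algebra H \<subseteq> lie_algebra K"
  by (auto simp: lie_algebra_def)

lemma lie_algebra_Int: "lie_algebra (H \<inter> K) = lie_algebra H \<inter> lie_algebra K"
  by (auto simp: lie_algebra_def)

lemma lie_algebra_scaleR: "X \<in> lie_algebra H \<Longrightarrow> r *\<^sub>R X \<in> lie_algebra H"
  by (simp add: lie_algebra_def)

text \<open>A limit direction of elements of H approaching the identity is tangent to H: the powers
  of \<open>g n\<close> with exponent about \<open>t * r n\<close> stay in H and converge to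
  \<open>mexp (t *\<^sub>R X)\<close>, and H is closed. Sums of tangent vectors and the local
  comparison of two subgroups rest on this.\<close>

lemma lie_algebraI_seq:
  assumes H: "closed_subgroup H" and g: "\<And>n. g n \<in> H"
    and r: "filterlim r at_top sequentially" and lim: "(\<lambda>n. r n *\<^sub>R (g n - mat 1)) \<longlonglongrightarrow> X"
  shows "X \<in> lie_algebra H"
proof -
  have sg: "subgroup H SL3" and cl: "closed H"
    using H by (auto simp: closed_subgroup_iff)
  have pos: "mexp (t *\<^sub>R X) \<in> H" if "t > 0" for t
  proof -
    define k where "k n = nat \<lfloor>t * r n\<rfloor>" for n
    have tr: "filterlim (\<lambda>n. t * r n) at_top sequentially"
      using r that by (simp add: filterlim_tendsto_pos_mult_at_top[OF tendsto_const])
    have "filterlim k at_top sequentially"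
      unfolding k_def
      by (intro filterlim_compose[OF filterlim_nat_sequentially] filterlim_compose[OF filterlim_floor_sequentially] tr)
    moreover have "(\<lambda>n. real (k n) *\<^sub>R (g n - mat 1)) \<longlonglongrightarrow> t *\<^sub>R X"
    proof -
      have ev: "\<forall>\<^sub>F n in sequentially. r n > 0"
        using r by (simp add: filterlim_at_top_dense)
      \<comment> \<open>Rounding \<open>t * r n\<close> down to an integer costs at most 1, which is
        negligible after division by \<open>r n\<close>.\<close>
      have b: "\<bar>real (k n) / r n - t\<bar> \<le> 1 / r n" if "r n > 0" for n
      proof -
        have "\<bar>real (k n) - t * r n\<bar> \<le> 1"
          unfolding k_def using \<open>t > 0\<close> that
          by (simp add: abs_le_iff) linarith
        then show ?thesis
          using that by (simp add: field_simps abs_le_iff)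
      qed
      have "(\<lambda>n. 1 / r n) \<longlonglongrightarrow> 0"
        by (rule real_tendsto_divide_at_top[OF tendsto_const r])
      then have "(\<lambda>n. real (k n) / r n - t) \<longlonglongrightarrow> 0"
        by (rule Lim_null_comparison[rotated]) (use ev in eventually_elim, simp add: b)
      then have "(\<lambda>n. real (k n) / r n) \<longlonglongrightarrow> t"
        by (rule LIM_zero_cancel)
      then have "(\<lambda>n. (real (k n) / r n) *\<^sub>R (r n *\<^sub>R (g n - mat 1))) \<longlonglongrightarrow> t *\<^sub>R X"
        by (intro tendsto_intros lim)
      then show ?thesis
        by (rule Lim_transform_eventually) (use ev in eventually_elim, simp)
    qed
    ultimately have "(\<lambda>n. (((**) (g n)) ^^ k n) (mat 1)) \<longlonglongrightarrow> mexp (t *\<^sub>R X)"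
      by (rule matpow_tendsto_mexp)
    then show ?thesis
      by (rule closed_sequentially[OF cl, rotated]) (rule subgroup_matpow[OF sg g])
  qed
  have "mexp (t *\<^sub>R X) \<in> H" for t
  proof (cases t "0::real" rule: linorder_cases)
    case less
    then have m: "mexp ((- t) *\<^sub>R X) \<in> H" by (intro pos) simp
    then have "det (mexp ((- t) *\<^sub>R X)) = 1" using sg by (simp add: subgroup_SL3_iff)
    then have "mexp (t *\<^sub>R X) = adj (mexp ((- t) *\<^sub>R X))"
      using mexp_minus(1)[of "t *\<^sub>R X"] by (intro mat3_inv_unique) auto
    then show ?thesis using m sg by (auto simp: subgroup_SL3_iff)
  next
    case equal
    then show ?thesis using sg by (simp add: subgroup_SL3_iff)
  qed (rule pos)
  then show ?thesis by (simp add: lie_algebra_def)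
qed

lemma mexp_seq_tendsto: "(\<lambda>n. real (Suc n) *\<^sub>R (mexp ((1 / real (Suc n)) *\<^sub>R X) - mat 1)) \<longlonglongrightarrow> X"
  using tendsto_seq_at_0[OF mexp_scaleR_tendsto seq_inverse_Suc(1)] by simp

lemma mexp_seq_tendsto_1: "(\<lambda>n. mexp ((1 / real (Suc n)) *\<^sub>R X)) \<longlonglongrightarrow> mat 1"
proof -
  have "(\<lambda>n. (1 / real (Suc n)) *\<^sub>R (real (Suc n) *\<^sub>R (mexp ((1 / real (Suc n)) *\<^sub>R X) - mat 1)) + mat 1)
      \<longlonglongrightarrow> 0 *\<^sub>R X + mat 1"
    by (intro tendsto_intros seq_inverse_Suc mexp_seq_tendsto)
  then show ?thesis by simp
qed

text \<open>The product rule at the identity. It yields sums in the Lie algebra and, later, the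
  direction X - D of the curve exp (- s D) exp (s X).\<close>

lemma mexp_mult_seq_tendsto:
  "(\<lambda>n. real (Suc n) *\<^sub>R (mexp ((1 / real (Suc n)) *\<^sub>R X) ** mexp ((1 / real (Suc n)) *\<^sub>R Y) - mat 1)) \<longlonglongrightarrow> X + Y"
proof -
  let ?g = "\<lambda>n. mexp ((1 / real (Suc n)) *\<^sub>R X)" and ?h = "\<lambda>n. mexp ((1 / real (Suc n)) *\<^sub>R Y)"
  have "(\<lambda>n. (real (Suc n) *\<^sub>R (?g n - mat 1)) ** ?h n + real (Suc n) *\<^sub>R (?h n - mat 1)) \<longlonglongrightarrow> X ** mat 1 + Y"
    by (intro tendsto_intros mexp_seq_tendsto mexp_seq_tendsto_1)
  moreover have "(r *\<^sub>R (g - mat 1)) ** h + r *\<^sub>R (h - mat 1) = r *\<^sub>R (g ** h - mat 1)" for r and g h :: mat3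
    by (simp add: mat3_eq_iff mat3_mult_nth algebra_simps)
  ultimately show ?thesis
    by simp
qed

lemma lie_algebra_add:
  assumes H: "closed_subgroup H" and X: "X \<in> lie_algebra H" and Y: "Y \<in> lie_algebra H"
  shows "X + Y \<in> lie_algebra H"
proof (rule lie_algebraI_seq[OF H _ seq_inverse_Suc(2)])
  let ?g = "\<lambda>n. mexp ((1 / real (Suc n)) *\<^sub>R X)" and ?h = "\<lambda>n. mexp ((1 / real (Suc n)) *\<^sub>R Y)"
  show "?g n ** ?h n \<in> H" for n
    using H X Y by (auto simp: closed_subgroup_iff subgroup_SL3_iff lie_algebra_def)
  show "(\<lambda>n. real (Suc n) *\<^sub>R (?g n ** ?h n - mat 1)) \<longlonglongrightarrow> X + Y"
    by (rule mexp_mult_seq_tendsto)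
qed

lemma subspace_lie_algebra:
  assumes "closed_subgroup H"
  shows "subspace (lie_algebra H)"
proof (rule subspaceI)
  show "0 \<in> lie_algebra H"
    using assms by (simp add: lie_algebra_def closed_subgroup_iff subgroup_SL3_iff)
qed (auto intro: lie_algebra_add[OF assms] lie_algebra_scaleR)

lemma lie_algebra_Ad:
  assumes H: "closed_subgroup H" and g: "g \<in> H" and X: "X \<in> lie_algebra H"
  shows "g ** X ** adj g \<in> lie_algebra H"
proof -
  have sg: "det g = 1" "adj g \<in> H" "\<And>x y. x \<in> H \<Longrightarrow> y \<in> H \<Longrightarrow> x ** y \<in> H"
    using H g by (auto simp: closed_subgroup_iff subgroup_SL3_iff)
  have "mexp (t *\<^sub>R (g ** X ** adj g)) = g ** mexp (t *\<^sub>R X) ** adj g" for t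
  proof -
    have "t *\<^sub>R (g ** X ** adj g) = g ** (t *\<^sub>R X) ** adj g"
      by (simp add: mat3_eq_iff mat3_mult_nth algebra_simps)
    then show ?thesis using sg mult_adj[of g] by (simp add: mexp_conj)
  qed
  then show ?thesis
    using X sg g by (simp add: lie_algebra_def)
qed

text \<open>The bracket is the derivative of conjugation by \<open>mexp (t *\<^sub>R X)\<close>. The
  difference quotients lie in the Lie algebra, which as a finite-dimensional subspace is
  closed.\<close>

lemma lie_algebra_bracket:
  assumes H: "closed_subgroup H" and X: "X \<in> lie_algebra H" and Y: "Y \<in> lie_algebra H"
  shows "bracket X Y \<in> lie_algebra H"
proof -
  let ?g = "\<lambda>n. mexp ((1 / real (Suc n)) *\<^sub>R X)" and ?h = "\<lambda>n. mexp ((1 / real (Suc n)) *\<^sub>R - X)"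
  have sub: "subspace (lie_algebra H)" by (rule subspace_lie_algebra[OF H])
  have g: "?g n \<in> H" "det (?g n) = 1" for n
    using X H by (auto simp: closed_subgroup_iff subgroup_SL3_iff lie_algebra_def)
  have h: "?h n = adj (?g n)" for n
    by (rule mat3_inv_unique) (use g mexp_minus(2)[of "(1 / real (Suc n)) *\<^sub>R X"] in auto)
  have mem: "real (Suc n) *\<^sub>R (?g n ** Y ** ?h n - Y) \<in> lie_algebra H" for n
    unfolding h by (intro subspace_scale[OF sub] subspace_diff[OF sub] lie_algebra_Ad[OF H] g Y)
  have "(\<lambda>n. (real (Suc n) *\<^sub>R (?g n - mat 1)) ** Y ** ?h n + Y ** (real (Suc n) *\<^sub>R (?h n - mat 1)))
      \<longlonglongrightarrow> X ** Y ** mat 1 + Y ** (- X)"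
    by (intro tendsto_intros mexp_seq_tendsto mexp_seq_tendsto_1)
  moreover have "(r *\<^sub>R (g - mat 1)) ** Y ** h + Y ** (r *\<^sub>R (h - mat 1)) = r *\<^sub>R (g ** Y ** h - Y)" for r and g h :: mat3
    by (simp add: mat3_eq_iff mat3_mult_nth algebra_simps)
  ultimately have "(\<lambda>n. real (Suc n) *\<^sub>R (?g n ** Y ** ?h n - Y)) \<longlonglongrightarrow> X ** Y + Y ** (- X)"
    by simp
  from closed_sequentially[OF closed_subspace[OF sub] mem this]
  have "X ** Y + Y ** (- X) \<in> lie_algebra H" .
  moreover have "X ** Y + Y ** (- X) = bracket X Y"
    by (simp add: bracket_def mat3_eq_iff mat3_mult_nth)
  ultimately show ?thesis by simp
qed

text \<open>If elements of \<open>H - K\<close> accumulated at the identity, translate each by \<open>K\<close> to be as close to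
  the identity as possible.  A limit direction of the translates lies in the Lie algebra of \<open>H\<close>,
  hence in that of \<open>K\<close>, and moving along it in \<open>K\<close> would bring them still closer.\<close>

lemma closed_subgroup_local_eq:
  assumes H: "closed_subgroup H" and K: "closed_subgroup K" and "K \<subseteq> H"
    and lie: "lie_algebra H \<subseteq> lie_algebra K"
  shows "\<exists>e>0. \<forall>g\<in>H. dist g (mat 1) < e \<longrightarrow> g \<in> K"
proof (rule ccontr)
  assume "\<not> ?thesis"
  then have "\<forall>n. \<exists>g. g \<in> H \<and> dist g (mat 1) < 1 / real (Suc n) \<and> g \<notin> K"
    by (metis divide_pos_pos of_nat_0_less_iff zero_less_Suc zero_less_one)
  then obtain g where g: "\<And>n. g n \<in> H" "\<And>n. dist (g n) (mat 1) < 1 / real (Suc n)" "\<And>n. g n \<notin> K"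
    by metis
  have sgH: "mat 1 \<in> H" "\<And>x y. x \<in> H \<Longrightarrow> y \<in> H \<Longrightarrow> x ** y \<in> H" "\<And>x. x \<in> H \<Longrightarrow> adj x \<in> H" "\<And>x. x \<in> H \<Longrightarrow> det x = 1"
    using H by (auto simp: closed_subgroup_iff subgroup_SL3_iff)
  have sgK: "mat 1 \<in> K" "\<And>x y. x \<in> K \<Longrightarrow> y \<in> K \<Longrightarrow> x ** y \<in> K" "\<And>x. x \<in> K \<Longrightarrow> adj x \<in> K" "closed K"
    using K by (auto simp: closed_subgroup_iff subgroup_SL3_iff)
  define Z where "Z n = {z. z ** adj (g n) \<in> K}" for n
  have gZ: "g n \<in> Z n" for n
    using sgH(4)[OF g(1)] sgK(1) by (simp add: Z_def mult_adj)
  have "closed (Z n)" for n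
  proof -
    have "Z n = (\<lambda>z. z ** adj (g n)) -` K" by (auto simp: Z_def)
    then show ?thesis
      by (simp add: closed_vimage sgK(4) continuous_on_mat3_mult continuous_on_id continuous_on_const)
  qed
  then have "\<forall>n. \<exists>z\<in>Z n. \<forall>y\<in>Z n. dist (mat 1) z \<le> dist (mat 1) y"
    using distance_attains_inf gZ by (metis empty_iff)
  then obtain z where z: "\<And>n. z n \<in> Z n" "\<And>n y. y \<in> Z n \<Longrightarrow> dist (mat 1) (z n) \<le> dist (mat 1) y"
    by metis
  have zH: "z n \<in> H" for n
  proof -
    have "z n ** adj (g n) \<in> H" using z(1)[of n] \<open>K \<subseteq> H\<close> by (auto simp: Z_def)
    then have "z n ** adj (g n) ** g n \<in> H" using sgH g by blast
    then show ?thesis using sgH(4)[OF g(1)] by (simp add: matrix_mul_assoc[symmetric] mult_adj)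
  qed
  define \<epsilon> where "\<epsilon> n = norm (z n - mat 1)" for n
  have z1: "z n \<noteq> mat 1" for n
  proof
    assume "z n = mat 1"
    then have "adj (g n) \<in> K" using z(1)[of n] by (simp add: Z_def)
    then have "adj (adj (g n)) \<in> K" by (rule sgK)
    then show False using g(3)[of n] sgH(4)[OF g(1)] by (simp add: adj_adj)
  qed
  then have epos: "\<epsilon> n > 0" for n by (simp add: \<epsilon>_def)
  have elt: "\<epsilon> n \<le> 1 / real (Suc n)" for n
    using z(2)[OF gZ, of n] g(2)[of n] by (simp add: \<epsilon>_def dist_norm norm_minus_commute)
  have e0: "\<epsilon> \<longlonglongrightarrow> 0"
    by (rule Lim_null_comparison[OF _ seq_inverse_Suc(1)]) (use elt epos in \<open>auto simp: less_imp_le abs_of_pos\<close>)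
  define u where "u n = (1 / \<epsilon> n) *\<^sub>R (z n - mat 1)" for n
  have "u n \<in> sphere 0 1" for n
    using epos[of n] by (simp add: u_def \<epsilon>_def)
  then obtain Y s where Y: "Y \<in> sphere 0 1" and s: "strict_mono s" and lim: "(u \<circ> s) \<longlonglongrightarrow> Y"
    using compact_sphere[of "0::mat3" 1] unfolding compact_def by metis
  have es0: "(\<lambda>n. \<epsilon> (s n)) \<longlonglongrightarrow> 0"
    using LIMSEQ_subseq_LIMSEQ[OF e0 s] by (simp add: o_def)
  have inf: "filterlim (\<lambda>n. 1 / \<epsilon> (s n)) at_top sequentially"
    using filterlim_inverse_at_top[OF es0] epos by (simp add: inverse_eq_divide)
  have "Y \<in> lie_algebra H"
    by (rule lie_algebraI_seq[OF H zH[of "s _"] inf]) (use lim in \<open>simp add: u_def o_def\<close>)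
  then have YK: "Y \<in> lie_algebra K" using lie by blast
  define w where "w n = mexp ((- \<epsilon> (s n)) *\<^sub>R Y) ** z (s n)" for n
  have "w n \<in> Z (s n)" for n
  proof -
    have "mexp ((- \<epsilon> (s n)) *\<^sub>R Y) ** (z (s n) ** adj (g (s n))) \<in> K"
      using z(1)[of "s n"] YK sgK(2) unfolding lie_algebra_def Z_def by blast
    then show ?thesis by (simp add: Z_def w_def matrix_mul_assoc)
  qed
  from z(2)[OF this] have ge: "\<epsilon> (s n) \<le> norm (w n - mat 1)" for n
    by (simp add: \<epsilon>_def dist_norm norm_minus_commute)
  have ms: "(\<lambda>n. (mexp ((- \<epsilon> (s n)) *\<^sub>R Y) - mat 1) /\<^sub>R (- \<epsilon> (s n))) \<longlonglongrightarrow> Y"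
    using epos tendsto_minus[OF es0]
    by (intro tendsto_seq_at_0[OF mexp_scaleR_tendsto[of Y]]) (auto simp: less_imp_neq[THEN not_sym])
  have zs: "(\<lambda>n. z (s n)) \<longlonglongrightarrow> mat 1"
  proof -
    have "(\<lambda>n. \<epsilon> (s n) *\<^sub>R (u \<circ> s) n + mat 1) \<longlonglongrightarrow> 0 *\<^sub>R Y + mat 1"
      by (intro tendsto_intros es0 lim)
    moreover have "\<epsilon> (s n) *\<^sub>R (u \<circ> s) n + mat 1 = z (s n)" for n
      using epos[of "s n"] by (simp add: u_def)
    ultimately show ?thesis by simp
  qed
  \<comment> \<open>To first order the factor \<open>mexp ((- \<epsilon> (s n)) *\<^sub>R Y)\<close>
    cancels \<open>z (s n) - mat 1\<close>, so \<open>w n\<close> is at distance o(\<epsilon>) from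
    the identity, against the minimality of \<open>z (s n)\<close>.\<close>
  have "(\<lambda>n. - ((mexp ((- \<epsilon> (s n)) *\<^sub>R Y) - mat 1) /\<^sub>R (- \<epsilon> (s n))) ** z (s n) + (u \<circ> s) n) \<longlonglongrightarrow> - Y ** mat 1 + Y"
    by (intro tendsto_intros ms zs lim)
  moreover have "- ((mexp ((- \<epsilon> (s n)) *\<^sub>R Y) - mat 1) /\<^sub>R (- \<epsilon> (s n))) ** z (s n) + (u \<circ> s) n
      = (1 / \<epsilon> (s n)) *\<^sub>R (w n - mat 1)" for n
  proof -
    have "- ((- q) *\<^sub>R (m - mat 1)) ** z + q *\<^sub>R (z - mat 1) = q *\<^sub>R (m ** z - mat 1)" for q and m z :: mat3
      by (simp add: mat3_eq_iff mat3_mult_nth algebra_simps)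
    from this[of "1 / \<epsilon> (s n)" "mexp ((- \<epsilon> (s n)) *\<^sub>R Y)" "z (s n)"] show ?thesis
      by (simp add: u_def w_def inverse_eq_divide)
  qed
  moreover have "- Y ** mat 1 + Y = (0::mat3)" by simp
  ultimately have "(\<lambda>n. (1 / \<epsilon> (s n)) *\<^sub>R (w n - mat 1)) \<longlonglongrightarrow> 0"
    by simp
  then have "(\<lambda>n. norm ((1 / \<epsilon> (s n)) *\<^sub>R (w n - mat 1))) \<longlonglongrightarrow> 0"
    by (rule tendsto_norm_zero)
  moreover have "1 \<le> norm ((1 / \<epsilon> (s n)) *\<^sub>R (w n - mat 1))" for n
    unfolding norm_scaleR using ge[of n] epos[of "s n"] by (simp add: field_simps)
  ultimately show False
    using Lim_bounded2[of _ 0 0 1] by fastforce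
qed

text \<open>The intersection of H and L has the same Lie algebra as H, hence contains a
  neighbourhood of the identity in H. By translation it is open in H; being also closed, it is all
  of the connected group H.\<close>

theorem connected_subgroup_subset:
  assumes H: "closed_subgroup H" and con: "connected H" and L: "closed_subgroup L"
    and lie: "lie_algebra H \<subseteq> lie_algebra L"
  shows "H \<subseteq> L"
proof -
  define K where "K = H \<inter> L"
  have K: "closed_subgroup K"
    using H L by (auto simp: K_def closed_subgroup_iff subgroup_SL3_iff)
  have "lie_algebra H \<subseteq> lie_algebra K"
    using lie by (simp add: K_def lie_algebra_Int)
  then obtain e where e: "e > 0" "\<And>g. g \<in> H \<Longrightarrow> dist g (mat 1) < e \<Longrightarrow> g \<in> K"
    using closed_subgroup_local_eq[OF H K] by (auto simp: K_def)
  have sgH: "\<And>x y. x \<in> H \<Longrightarrow> y \<in> H \<Longrightarrow> x ** y \<in> H" "\<And>x. x \<in> H \<Longrightarrow> adj x \<in> H" "\<And>x. x \<in> H \<Longrightarrow> det x = 1"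
    using H by (auto simp: closed_subgroup_iff subgroup_SL3_iff)
  have sgK: "mat 1 \<in> K" "\<And>x y. x \<in> K \<Longrightarrow> y \<in> K \<Longrightarrow> x ** y \<in> K" "K \<subseteq> H" "closed K"
    using K by (auto simp: closed_subgroup_iff subgroup_SL3_iff K_def)
  have "openin (top_of_set H) K"
  proof (rule openin_subopen[THEN iffD2], intro ballI)
    fix k assume k: "k \<in> K"
    define T where "T = H \<inter> (\<lambda>h. adj k ** h) -` ball (mat 1) e"
    have kH: "k \<in> H" "det k = 1" using k sgK sgH by auto
    have "open ((\<lambda>h. adj k ** h) -` ball (mat 1) e)"
      by (intro open_vimage open_ball continuous_intros)
    then have "openin (top_of_set H) T"
      unfolding T_def by (rule openin_open_Int)
    moreover have "k \<in> T"
      using kH e(1) by (simp add: T_def mult_adj)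
    moreover have "T \<subseteq> K"
    proof
      fix h assume h: "h \<in> T"
      then have "adj k ** h \<in> K"
        using sgH kH by (intro e(2)) (auto simp: T_def dist_commute)
      then have "k ** (adj k ** h) \<in> K" using k sgK by blast
      then show "h \<in> K" using kH by (simp add: matrix_mul_assoc mult_adj)
    qed
    ultimately show "\<exists>T. openin (top_of_set H) T \<and> k \<in> T \<and> T \<subseteq> K" by blast
  qed
  moreover have "closedin (top_of_set H) K"
    using sgK by (simp add: closed_subset)
  ultimately have "K = H"
    using con sgK(1) by (auto simp: connected_clopen)
  then show ?thesis by (auto simp: K_def)
qed

subsection \<open>The Cartan decomposition and the coarse criterion\<close>

definition SO3 :: "mat3 set" where
  "SO3 = {k. k ** transpose k = mat 1 \<and> det k = 1}"

text \<open>Distinct weights make the stationarity equations for left and right rotations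
  independent, so that off-diagonal entries vanish; with equal weights both would only say that the
  matrix is symmetric. Their decreasing order sorts the diagonal, their positivity gives its
  signs.\<close>

definition trace321 :: "mat3 \<Rightarrow> real" where
  "trace321 M = 3 * M$1$1 + 2 * M$2$2 + M$3$3"

lemma SO3_adj: "k \<in> SO3 \<Longrightarrow> adj k = transpose k"
  using mat3_inv_unique[of k "transpose k"] by (simp add: SO3_def)

lemma SO3_mult: "k \<in> SO3 \<Longrightarrow> l \<in> SO3 \<Longrightarrow> k ** l \<in> SO3"
proof -
  assume k: "k \<in> SO3" and l: "l \<in> SO3"
  have "k ** l ** (transpose l ** transpose k) = k ** (l ** transpose l) ** transpose k"
    by (simp only: matrix_mul_assoc)
  then show ?thesis
    using k l by (simp add: SO3_def det_mul matrix_transpose_mul)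
qed

lemma SO3_transpose: "k \<in> SO3 \<Longrightarrow> transpose k \<in> SO3"
  using mult_adj(2)[of k] SO3_adj[of k] by (simp add: SO3_def det_transpose)

lemma l1_SO3:
  assumes "k \<in> SO3"
  shows "l1 k \<le> 9"
proof -
  have "\<bar>k$i$j\<bar> \<le> 1" for i j
  proof -
    have "(k ** transpose k)$i$i = 1"
      using assms by (simp add: SO3_def)
    then have eq: "(k$i$1)\<^sup>2 + (k$i$2)\<^sup>2 + (k$i$3)\<^sup>2 = 1"
      by (simp add: mat3_mult_nth transpose_def power2_eq_square)
    have "\<forall>j. (k$i$j)\<^sup>2 \<le> 1"
      unfolding forall_3
      using eq zero_le_power2[of "k$i$1"] zero_le_power2[of "k$i$2"] zero_le_power2[of "k$i$3"]
      by linarith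
    then show ?thesis by (simp add: abs_square_le_1)
  qed
  then have "l1 k \<le> (\<Sum>i\<in>(UNIV::3 set). \<Sum>j\<in>(UNIV::3 set). 1)"
    unfolding l1_def by (intro sum_mono)
  then show ?thesis by simp
qed

lemma compact_SO3: "compact SO3"
proof -
  have "closed ((\<lambda>k::mat3. k ** transpose k) -` {mat 1})"
    by (intro closed_vimage closed_singleton continuous_on_mat3_mult continuous_on_id continuous_on_mat3I)
       (simp add: transpose_def, intro continuous_intros)
  then have "compact ((\<lambda>k. k ** transpose k) -` {mat 1} \<inter> {M. det M = 1 \<and> l1 M \<le> 9})"
    by (intro closed_Int_compact compact_l1_ball)
  also have "(\<lambda>k. k ** transpose k) -` {mat 1} \<inter> {M. det M = 1 \<and> l1 M \<le> 9} = SO3"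
    using l1_SO3 by (auto simp: SO3_def)
  finally show ?thesis .
qed

lemma mat_1_SO3: "mat 1 \<in> SO3"
  by (simp add: SO3_def)

lemma rotations_SO3:
  fixes c s :: real
  assumes "c\<^sup>2 + s\<^sup>2 = 1"
  shows "vector [vector [c, -s, 0], vector [s, c, 0], vector [0, 0, 1]] \<in> SO3" (is "?A \<in> _")
    and "vector [vector [c, 0, -s], vector [0, 1, 0], vector [s, 0, c]] \<in> SO3" (is "?B \<in> _")
    and "vector [vector [1, 0, 0], vector [0, c, -s], vector [0, s, c]] \<in> SO3" (is "?C \<in> _")
  using assms
  by (simp_all add: SO3_def mat3_eq_iff mat3_mult_nth transpose_def det_3 power2_eq_square algebra_simps)

text \<open>Stationarity at angle 0 without derivatives: the rational parametrization of the circle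
  is evaluated at a single parameter t proportional to B.\<close>

lemma trig_max_imp_zero:
  fixes A B :: real
  assumes "\<And>c s. c\<^sup>2 + s\<^sup>2 = 1 \<Longrightarrow> A * c + B * s \<le> A"
  shows "B = 0"
proof -
  \<comment> \<open>K exceeds A by at least 1, so that with B = K t the inequality
    \<open>B * t \<le> A * t\<^sup>2\<close> turns into K t^2 \<le> (K - 1) t^2, which forces t =
    0.\<close>
  define K where "K = \<bar>A\<bar> + 1"
  define t where "t = B / K"
  have K: "K > 0" "A \<le> K - 1" by (auto simp: K_def)
  have pos: "1 + t\<^sup>2 > 0" by (simp add: add_pos_nonneg)
  have "((1 - t\<^sup>2) / (1 + t\<^sup>2))\<^sup>2 + (2 * t / (1 + t\<^sup>2))\<^sup>2 = ((1 - t\<^sup>2)\<^sup>2 + (2 * t)\<^sup>2) / (1 + t\<^sup>2)\<^sup>2"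
    by (simp add: power_divide add_divide_distrib)
  also have "(1 - t\<^sup>2)\<^sup>2 + (2 * t)\<^sup>2 = (1 + t\<^sup>2)\<^sup>2"
    by (simp add: power2_eq_square algebra_simps)
  finally have "((1 - t\<^sup>2) / (1 + t\<^sup>2))\<^sup>2 + (2 * t / (1 + t\<^sup>2))\<^sup>2 = 1"
    using pos by simp
  from assms[OF this] have "(A * (1 - t\<^sup>2) + B * (2 * t)) / (1 + t\<^sup>2) \<le> A"
    by (simp add: add_divide_distrib)
  then have "A * (1 - t\<^sup>2) + B * (2 * t) \<le> A * (1 + t\<^sup>2)"
    using pos by (simp add: pos_divide_le_eq)
  then have "B * t \<le> A * t\<^sup>2" by (simp add: algebra_simps)
  also have "\<dots> \<le> (K - 1) * t\<^sup>2" using K by (intro mult_right_mono) auto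
  finally have "B * t \<le> (K - 1) * t\<^sup>2" .
  moreover have "B = K * t" using K by (simp add: t_def)
  ultimately have "t\<^sup>2 \<le> 0" by (simp add: power2_eq_square algebra_simps)
  then show ?thesis using \<open>B = K * t\<close> by simp
qed

text \<open>The weighted trace \<open>trace321 (k ** g ** l)\<close> attains its maximum over rotations \<open>k\<close>, \<open>l\<close>;
  stationarity at the maximum makes \<open>k ** g ** l\<close> diagonal, and comparing the maximum with
  permutation and sign matrices orders the diagonal entries and makes them positive.\<close>

lemma KAK:
  assumes "det g = 1"
  obtains k l a b c where "k \<in> SO3" "l \<in> SO3" "k ** g ** l = ut a b c 0 0 0"
    "a \<ge> b" "b \<ge> c" "c > 0" "a * b * c = 1"
proof -
  have "continuous_on (SO3 \<times> SO3) (\<lambda>p. trace321 (fst p ** g ** snd p))"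
    unfolding trace321_def by (intro continuous_intros)
  moreover have "compact (SO3 \<times> SO3)" by (intro compact_Times compact_SO3)
  ultimately obtain p where p: "p \<in> SO3 \<times> SO3"
    "\<forall>q\<in>SO3 \<times> SO3. trace321 (fst q ** g ** snd q) \<le> trace321 (fst p ** g ** snd p)"
    using continuous_attains_sup[of "SO3 \<times> SO3" "\<lambda>p. trace321 (fst p ** g ** snd p)"] mat_1_SO3 by blast
  define k l where "k = fst p" and "l = snd p"
  have kl: "k \<in> SO3" "l \<in> SO3" using p by (auto simp: k_def l_def)
  define M where "M = k ** g ** l"
  have max: "trace321 (r ** M ** r') \<le> trace321 M" if "r \<in> SO3" "r' \<in> SO3" for r r'
  proof -
    have "r ** M ** r' = (r ** k) ** g ** (l ** r')"
      by (simp add: M_def matrix_mul_assoc)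
    then show ?thesis
      using p(2)[rule_format, of "(r ** k, l ** r')"] SO3_mult kl that by (simp add: M_def k_def l_def)
  qed
  have maxl: "trace321 (r ** M) \<le> trace321 M" and maxr: "trace321 (M ** r) \<le> trace321 M" if "r \<in> SO3" for r
    using max[OF that mat_1_SO3] max[OF mat_1_SO3 that] by simp_all
  note calc = trace321_def mat3_mult_nth transpose_def
  have "2 * M$1$2 - 3 * M$2$1 = 0"
    by (rule trig_max_imp_zero[of "3 * M$1$1 + 2 * M$2$2"])
       (use maxl[OF rotations_SO3(1)] in \<open>auto simp: calc algebra_simps\<close>)
  moreover have "3 * M$1$2 - 2 * M$2$1 = 0"
    by (rule trig_max_imp_zero[of "3 * M$1$1 + 2 * M$2$2"])
       (use maxr[OF rotations_SO3(1)] in \<open>auto simp: calc algebra_simps\<close>)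
  moreover have "1 * M$1$3 - 3 * M$3$1 = 0"
    by (rule trig_max_imp_zero[of "3 * M$1$1 + M$3$3"])
       (use maxl[OF rotations_SO3(2)] in \<open>auto simp: calc algebra_simps\<close>)
  moreover have "3 * M$1$3 - 1 * M$3$1 = 0"
    by (rule trig_max_imp_zero[of "3 * M$1$1 + M$3$3"])
       (use maxr[OF rotations_SO3(2)] in \<open>auto simp: calc algebra_simps\<close>)
  moreover have "1 * M$2$3 - 2 * M$3$2 = 0"
    by (rule trig_max_imp_zero[of "2 * M$2$2 + M$3$3"])
       (use maxl[OF rotations_SO3(3)] in \<open>auto simp: calc algebra_simps\<close>)
  moreover have "2 * M$2$3 - 1 * M$3$2 = 0"
    by (rule trig_max_imp_zero[of "2 * M$2$2 + M$3$3"])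
       (use maxr[OF rotations_SO3(3)] in \<open>auto simp: calc algebra_simps\<close>)
  ultimately have off: "M$1$2 = 0" "M$2$1 = 0" "M$1$3 = 0" "M$3$1 = 0" "M$2$3 = 0" "M$3$2 = 0"
    by linarith+
  define a b c where "a = M$1$1" and "b = M$2$2" and "c = M$3$3"
  have M: "M = ut a b c 0 0 0"
    using off by (simp add: mat3_eq_iff a_def b_def c_def)
  have prod: "a * b * c = 1"
  proof -
    have "det M = 1" using assms kl by (simp add: M_def det_mul SO3_def)
    then show ?thesis by (simp add: M)
  qed
  have "b \<le> a"
    using max[OF rotations_SO3(1)[of 0 1] SO3_transpose[OF rotations_SO3(1)[of 0 1]]]
    by (simp add: calc M)
  moreover have "c \<le> b"
    using max[OF rotations_SO3(3)[of 0 1] SO3_transpose[OF rotations_SO3(3)[of 0 1]]]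
    by (simp add: calc M)
  moreover have "c > 0"
  proof -
    have "0 \<le> 2 * b + c"
      using maxl[OF rotations_SO3(3)[of "-1" 0]] by (simp add: calc M)
    moreover have "b \<noteq> 0" using prod by auto
    ultimately have "b > 0" using \<open>c \<le> b\<close> by linarith
    then have "a * b > 0" using \<open>b \<le> a\<close> by simp
    moreover have "(a * b) * c > 0" using prod by simp
    ultimately show ?thesis using zero_less_mult_pos by blast
  qed
  ultimately show ?thesis
    using that[OF kl] M prod unfolding M_def by blast
qed

text \<open>The pairs \<open>(a\<^sub>1, a\<^sub>1 a\<^sub>2)\<close> for diagonal matrices of determinant 1 with entries
  \<open>a\<^sub>1 \<ge> a\<^sub>2 \<ge> a\<^sub>3 > 0\<close>: up to bounded factors, the sizes of the matrix and of its inverse.\<close>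

definition cone :: "real \<Rightarrow> real \<Rightarrow> bool" where
  "cone p q \<longleftrightarrow> 1 \<le> p \<and> 1 \<le> q \<and> p \<le> q\<^sup>2 \<and> q \<le> p\<^sup>2"

text \<open>In logarithmic coordinates the cone is a closed Weyl chamber and the condition says that
  every point of it is at bounded distance from S.\<close>

definition coarse :: "(real \<times> real) set \<Rightarrow> bool" where
  "coarse S \<longleftrightarrow> (\<exists>M>0. \<forall>p q. cone p q \<longrightarrow>
     (\<exists>P Q. (P, Q) \<in> S \<and> P \<le> M * p \<and> p \<le> M * P \<and> Q \<le> M * q \<and> q \<le> M * Q))"

definition sizes :: "mat3 set \<Rightarrow> (real \<times> real) set" where
  "sizes H = (\<lambda>h. (l1 h, l1 (adj h))) ` H"

lemma l1_mult3: "l1 (a ** b ** c) \<le> l1 a * l1 b * l1 c"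
  using l1_mult[of "a ** b" c] l1_mult[of a b] mult_right_mono[of "l1 (a ** b)" "l1 a * l1 b" "l1 c"]
  by simp

text \<open>A rotation has nine entries of absolute value at most 1, hence the factor 9 * 9. The
  reverse inequalities come from undoing the rotations, and those for the adjugate from its
  reversing products.\<close>

lemma l1_SO3_conj:
  assumes "k \<in> SO3" "l \<in> SO3"
  shows "l1 (k ** M ** l) \<le> 81 * l1 M" "l1 M \<le> 81 * l1 (k ** M ** l)"
    "l1 (adj (k ** M ** l)) \<le> 81 * l1 (adj M)" "l1 (adj M) \<le> 81 * l1 (adj (k ** M ** l))"
proof -
  have *: "l1 (k ** M ** l) \<le> 81 * l1 M" if "k \<in> SO3" "l \<in> SO3" for k l M
  proof -
    have "l1 k * l1 M * l1 l \<le> 9 * l1 M * 9"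
      using l1_SO3 that by (intro mult_mono) auto
    then show ?thesis using l1_mult3[of k M l] by simp
  qed
  have M: "M = transpose k ** (k ** M ** l) ** transpose l"
  proof -
    have "transpose k ** k = mat 1" "l ** transpose l = mat 1"
      using assms SO3_transpose[OF assms(1)] by (auto simp: SO3_def)
    moreover have "transpose k ** (k ** M ** l) ** transpose l = (transpose k ** k) ** M ** (l ** transpose l)"
      by (simp only: matrix_mul_assoc)
    ultimately show ?thesis by simp
  qed
  have t: "transpose k \<in> SO3" "transpose l \<in> SO3"
    using assms by (auto intro: SO3_transpose)
  have adj: "adj (k ** M ** l) = transpose l ** adj M ** transpose k" if "k \<in> SO3" "l \<in> SO3" for k l M
    using that by (simp add: adj_mult SO3_adj matrix_mul_assoc)
  show "l1 (k ** M ** l) \<le> 81 * l1 M" by (rule *[OF assms])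
  show "l1 M \<le> 81 * l1 (k ** M ** l)" using *[OF t, of "k ** M ** l"] M by simp
  show "l1 (adj (k ** M ** l)) \<le> 81 * l1 (adj M)"
    unfolding adj[OF assms] by (rule *[OF t(2) t(1)])
  have "l1 (adj (transpose k ** (k ** M ** l) ** transpose l)) \<le> 81 * l1 (adj (k ** M ** l))"
    unfolding adj[OF t] using * assms by simp
  then show "l1 (adj M) \<le> 81 * l1 (adj (k ** M ** l))"
    using M by simp
qed

lemma diag_cone:
  assumes "a \<ge> b" "b \<ge> c" "c > 0" "a * b * c = (1::real)"
  shows "cone a (a * b)"
proof -
  have c1: "c \<le> 1"
  proof (rule ccontr)
    assume "\<not> c \<le> 1"
    then have "1 < a" "1 < b" "1 < c" using assms by auto
    then have "1 < a * b * c" by (simp add: less_1_mult)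
    then show False using assms by simp
  qed
  have "1 \<le> a * b"
  proof -
    have "a * b * c \<le> a * b * 1" using assms c1 by (intro mult_left_mono) auto
    then show ?thesis using assms by simp
  qed
  moreover have "1 \<le> a"
  proof (rule ccontr)
    assume "\<not> 1 \<le> a"
    then have "a * b < 1" using assms by (intro mult_strict_mono'[of a 1 b 1, simplified]) auto
    then show False using \<open>1 \<le> a * b\<close> by simp
  qed
  moreover have "a * b \<le> a\<^sup>2"
    using assms by (simp add: power2_eq_square)
  moreover have "a \<le> (a * b)\<^sup>2"
  proof -
    have "a * b * c \<le> a * b * b" using assms by (intro mult_left_mono) auto
    then have "a * 1 \<le> a * (a * b * b)" using assms by (intro mult_left_mono) auto
    then show ?thesis by (simp add: power2_eq_square algebra_simps)
  qed
  ultimately show ?thesis by (simp add: cone_def)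
qed

lemma l1_diag:
  assumes "a \<ge> b" "b \<ge> c" "c > (0::real)"
  shows "a \<le> l1 (ut a b c 0 0 0)" "l1 (ut a b c 0 0 0) \<le> 3 * a"
    "a * b \<le> l1 (adj (ut a b c 0 0 0))" "l1 (adj (ut a b c 0 0 0)) \<le> 3 * (a * b)"
proof -
  have "b * c \<le> a * b" "a * c \<le> a * b"
    using assms mult_mono[of b a c b] by (auto simp: mult.commute mult_left_mono)
  moreover have "l1 (ut a b c 0 0 0) = a + b + c"
      "l1 (adj (ut a b c 0 0 0)) = b * c + a * c + a * b" "0 < b * c" "0 < a * c"
    using assms by (simp_all add: abs_mult)
  ultimately show "a \<le> l1 (ut a b c 0 0 0)" "l1 (ut a b c 0 0 0) \<le> 3 * a"
    "a * b \<le> l1 (adj (ut a b c 0 0 0))" "l1 (adj (ut a b c 0 0 0)) \<le> 3 * (a * b)"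
    using assms by linarith+
qed

text \<open>Pick h in H whose two sizes match those of g. Their Cartan components then differ by a
  bounded diagonal matrix D, so g is obtained from h by multiplying with rotations and D.\<close>

lemma coarse_imp_cartan:
  assumes "closed_subgroup H" "connected H" and coarse: "coarse (sizes H)"
  shows "cartan_decomposition_subgroup H"
proof -
  obtain M where M: "M > 0" and Mc: "\<And>p q. cone p q \<Longrightarrow>
     \<exists>h\<in>H. l1 h \<le> M * p \<and> p \<le> M * l1 h \<and> l1 (adj h) \<le> M * q \<and> q \<le> M * l1 (adj h)"
    using coarse unfolding coarse_def sizes_def by (smt (verit) Pair_inject image_iff)
  have H1: "\<And>h. h \<in> H \<Longrightarrow> det h = 1"
    using assms by (auto simp: closed_subgroup_iff subgroup_SL3_iff)
  \<comment> \<open>243 = 81 * 3: a factor 81 for removing the rotations and 3 for comparing a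
    diagonal matrix with its leading entry. In \<open>R\<close> the 81 pays for rotations again, and
    the bracket dominates both 1 (for \<open>x\<close>) and the size of \<open>D\<close> (for
    \<open>y\<close>).\<close>
  define C where "C = 243 * M"
  define R where "R = 81 * (1 + 2 * C + C * C)"
  define B where "B = {x. det x = 1 \<and> l1 x \<le> R}"
  have C0: "C > 0" using M by (simp add: C_def)
  have "g \<in> B <#>\<^bsub>SL3\<^esub> H <#>\<^bsub>SL3\<^esub> B" if g: "det g = 1" for g
  proof -
    obtain k l a b c where kl: "k \<in> SO3" "l \<in> SO3" and kgl: "k ** g ** l = ut a b c 0 0 0"
      and abc: "a \<ge> b" "b \<ge> c" "c > 0" "a * b * c = 1"
      using KAK[OF g] by metis
    obtain h where h: "h \<in> H" "l1 h \<le> M * a" "a \<le> M * l1 h" "l1 (adj h) \<le> M * (a * b)" "a * b \<le> M * l1 (adj h)"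
      using Mc[OF diag_cone[OF abc]] by blast
    obtain k' l' a' b' c' where kl': "k' \<in> SO3" "l' \<in> SO3" and khl: "k' ** h ** l' = ut a' b' c' 0 0 0"
      and abc': "a' \<ge> b'" "b' \<ge> c'" "c' > 0" "a' * b' * c' = 1"
      using KAK[OF H1[OF h(1)]] by metis
    note sz = l1_SO3_conj[OF kl', of h, unfolded khl] and dg = l1_diag[OF abc'(1-3)]
    have pos: "a > 0" "b > 0" "c > 0" "a' > 0" "b' > 0" "c' > 0" using abc abc' by auto
    have "a' \<le> C * a"
    proof -
      have "a' \<le> 81 * (M * a)" using dg(1) sz(1) h(2) by linarith
      also have "\<dots> \<le> C * a" using M pos by (simp add: C_def)
      finally show ?thesis .
    qed
    moreover have "a \<le> C * a'"
    proof -
      have "l1 h \<le> 243 * a'" using dg(2) sz(2) by linarith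
      then have "M * l1 h \<le> M * (243 * a')" using M by (intro mult_left_mono) auto
      then show ?thesis using h(3) by (simp add: C_def algebra_simps)
    qed
    moreover have "a' * b' \<le> C * (a * b)"
    proof -
      have "a' * b' \<le> 81 * (M * (a * b))" using dg(3) sz(3) h(4) by linarith
      also have "\<dots> \<le> C * (a * b)" using M pos by (simp add: C_def)
      finally show ?thesis .
    qed
    moreover have "a * b \<le> C * (a' * b')"
    proof -
      have "l1 (adj h) \<le> 243 * (a' * b')" using dg(4) sz(4) by linarith
      then have "M * l1 (adj h) \<le> M * (243 * (a' * b'))" using M by (intro mult_left_mono) auto
      then show ?thesis using h(5) by (simp add: C_def algebra_simps)
    qed
    ultimately have le: "a' \<le> C * a" "a \<le> C * a'" "a' * b' \<le> C * (a * b)" "a * b \<le> C * (a' * b')" by blast+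
    define D where "D = ut (a / a') (b / b') (c / c') 0 0 0"
    have "a / a' \<le> C" using le pos by (simp add: field_simps)
    \<comment> \<open>The middle entry is the quotient of a b by a, so the two errors multiply to C
      * C.\<close>
    moreover have "b / b' \<le> C * C"
    proof -
      have "(a * b) * a' \<le> (C * (a' * b')) * (C * a)"
        using le pos C0 by (intro mult_mono[of "a * b"]) auto
      then have "a * a' * b \<le> a * a' * (C * C * b')" by (simp add: algebra_simps)
      then have "b \<le> C * C * b'" using pos by (simp add: mult_le_cancel_left)
      then show ?thesis using pos by (simp add: field_simps)
    qed
    moreover have "c / c' \<le> C"
    proof -
      have "c * c' * (a' * b') \<le> c * c' * (C * (a * b))"
        using le pos by (intro mult_left_mono) auto
      moreover have "c * c' * (a' * b') = c * (a' * b' * c')" "c * c' * (C * (a * b)) = C * c' * (a * b * c)"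
        by (simp_all add: algebra_simps)
      ultimately show ?thesis using pos abc(4) abc'(4) by (simp add: pos_divide_le_eq)
    qed
    ultimately have D: "l1 D \<le> 2 * C + C * C" using pos by (simp add: D_def)
    have detD: "det D = 1"
      using abc(4) abc'(4) pos by (simp add: D_def)
    define x where "x = transpose k ** k'"
    define y where "y = l' ** D ** transpose l"
    have "l1 x \<le> 81 * 1"
      using l1_mult[of "transpose k" k'] mult_mono[OF l1_SO3[OF SO3_transpose[OF kl(1)]] l1_SO3[OF kl'(1)]]
      by (simp add: x_def)
    also have "\<dots> \<le> R" unfolding R_def using C0 by (intro mult_left_mono) auto
    finally have "x \<in> B" using kl kl' by (simp add: B_def x_def det_mul SO3_def det_transpose)
    have "l1 y \<le> 81 * l1 D"
      unfolding y_def by (rule l1_SO3_conj(1)[OF kl'(2) SO3_transpose[OF kl(2)]])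
    also have "\<dots> \<le> R" unfolding R_def using D by (intro mult_left_mono) auto
    finally have "y \<in> B" using kl kl' detD by (simp add: B_def y_def det_mul SO3_def det_transpose)
    have "g = transpose k ** (k ** g ** l) ** transpose l"
    proof -
      have "transpose k ** k = mat 1" "l ** transpose l = mat 1"
        using kl SO3_transpose[OF kl(1)] by (auto simp: SO3_def)
      moreover have "transpose k ** (k ** g ** l) ** transpose l = (transpose k ** k) ** g ** (l ** transpose l)"
        by (simp only: matrix_mul_assoc)
      ultimately show ?thesis by simp
    qed
    also have "k ** g ** l = (k' ** h ** l') ** D"
      unfolding kgl khl D_def using pos by simp
    also have "transpose k ** (k' ** h ** l' ** D) ** transpose l = x ** h ** y"
      by (simp add: x_def y_def matrix_mul_assoc)
    finally show ?thesis
      using \<open>x \<in> B\<close> \<open>y \<in> B\<close> h(1) unfolding set_mult_SL3 by blast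
  qed
  moreover have "B <#>\<^bsub>SL3\<^esub> H <#>\<^bsub>SL3\<^esub> B \<subseteq> carrier SL3"
    using H1 by (auto simp: set_mult_SL3 B_def det_mul)
  ultimately have "B <#>\<^bsub>SL3\<^esub> H <#>\<^bsub>SL3\<^esub> B = carrier SL3" by auto
  moreover have "compact B" "B \<subseteq> carrier SL3"
    unfolding B_def by (rule compact_l1_ball, auto)
  ultimately show ?thesis
    unfolding cartan_decomposition_subgroup_def using assms by blast
qed

text \<open>Test the decomposition on the diagonal matrix with a_1 = p and a_1 a_2 = q, whose sizes
  are p and q up to a factor 3. Passing between it and the middle factor h costs one bound R on each
  side, for the matrix and for its inverse.\<close>

lemma cartan_imp_coarse:
  assumes "cartan_decomposition_subgroup H"
  shows "coarse (sizes H)"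
proof -
  obtain C where C: "C \<subseteq> carrier SL3" "compact C" "C <#>\<^bsub>SL3\<^esub> H <#>\<^bsub>SL3\<^esub> C = carrier SL3"
    and H: "closed_subgroup H"
    using assms by (auto simp: cartan_decomposition_subgroup_def)
  have bdd: "\<exists>R. \<forall>c\<in>C. f c \<le> R" if "continuous_on C f" for f :: "mat3 \<Rightarrow> real"
    using bounded_imp_bdd_above[OF compact_imp_bounded[OF compact_continuous_image[OF that C(2)]]]
    by (auto simp: bdd_above_def)
  have "continuous_on C (\<lambda>c. l1 (adj c))"
    by (rule continuous_on_compose2[OF continuous_on_l1[of UNIV] continuous_on_adj]) simp
  then obtain R1 R2 where R12: "\<And>c. c \<in> C \<Longrightarrow> l1 c \<le> R1" "\<And>c. c \<in> C \<Longrightarrow> l1 (adj c) \<le> R2"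
    using bdd[OF continuous_on_l1] bdd[of "\<lambda>c. l1 (adj c)"] by metis
  define R where "R = max 1 (max R1 R2)"
  have R: "\<And>c. c \<in> C \<Longrightarrow> l1 c \<le> R" "\<And>c. c \<in> C \<Longrightarrow> l1 (adj c) \<le> R" "R \<ge> 1"
    using R12 by (force simp: R_def)+
  have bd: "l1 (x ** m ** y) \<le> R * R * l1 m" if "l1 x \<le> R" "l1 y \<le> R" for x m y
  proof -
    have "l1 x * l1 m * l1 y \<le> R * l1 m * R"
      using that R(3) by (intro mult_mono) auto
    then show ?thesis using l1_mult3[of x m y] by (simp add: algebra_simps)
  qed
  show ?thesis
    unfolding coarse_def
  proof (rule exI[of _ "3 * (R * R)"], intro conjI allI impI)
    show "0 < 3 * (R * R)" using R(3) by simp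
    fix p q assume pq: "cone p q"
    then have pq1: "1 \<le> p" "1 \<le> q" "p \<le> q\<^sup>2" "q \<le> p\<^sup>2" by (auto simp: cone_def)
    define g where "g = ut p (q / p) (1 / q) 0 0 0"
    have "q / p \<le> p" "p / q \<le> q"
      using pq1 by (auto simp: field_simps power2_eq_square)
    moreover have "1 / q \<le> 1" "1 / p \<le> 1" using pq1 by auto
    ultimately have "1 / q \<le> p" "1 / p \<le> q" "q / p \<le> p" "p / q \<le> q" using pq1 by linarith+
    then have g: "l1 g \<le> 3 * p" "p \<le> l1 g" "l1 (adj g) \<le> 3 * q" "q \<le> l1 (adj g)"
      using pq1 by (auto simp: g_def abs_mult)
    have "det g = 1" using pq1 by (simp add: g_def)
    then have "g \<in> C <#>\<^bsub>SL3\<^esub> H <#>\<^bsub>SL3\<^esub> C" using C(3) by simp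
    then obtain x h y where xhy: "x \<in> C" "h \<in> H" "y \<in> C" "g = x ** h ** y"
      unfolding set_mult_SL3 by blast
    have det1: "det x = 1" "det y = 1" using xhy C(1) by auto
    have hg: "h = adj x ** g ** adj y"
    proof -
      have "adj x ** (x ** h ** y) ** adj y = (adj x ** x) ** h ** (y ** adj y)"
        by (simp only: matrix_mul_assoc)
      then show ?thesis using xhy det1 by (simp add: mult_adj)
    qed
    have "l1 g \<le> R * R * l1 h" unfolding xhy(4) by (rule bd) (use R xhy in auto)
    moreover have "l1 h \<le> R * R * l1 g" unfolding hg by (rule bd) (use R xhy in auto)
    moreover have "l1 (adj g) \<le> R * R * l1 (adj h)"
    proof -
      have "adj g = adj y ** adj h ** adj x"
        unfolding xhy(4) by (simp add: adj_mult matrix_mul_assoc)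
      then show ?thesis using bd[of "adj y" "adj x" "adj h"] R xhy by simp
    qed
    moreover have "l1 (adj h) \<le> R * R * l1 (adj g)"
    proof -
      have "adj h = y ** adj g ** x"
        unfolding hg by (simp add: adj_mult matrix_mul_assoc adj_adj det1)
      then show ?thesis using bd[of y x "adj g"] R xhy by simp
    qed
    moreover have "R * R * l1 g \<le> R * R * (3 * p)" "R * R * l1 (adj g) \<le> R * R * (3 * q)"
      using g R(3) by (intro mult_left_mono; simp)+
    moreover have "R * R * l1 h \<le> 3 * (R * R) * l1 h" "R * R * l1 (adj h) \<le> 3 * (R * R) * l1 (adj h)"
      using R(3) by (intro mult_right_mono; simp)+
    ultimately have "l1 h \<le> 3 * (R * R) * p" "p \<le> 3 * (R * R) * l1 h"
        "l1 (adj h) \<le> 3 * (R * R) * q" "q \<le> 3 * (R * R) * l1 (adj h)"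
      using g by linarith+
    then show "\<exists>P Q. (P, Q) \<in> sizes H \<and> P \<le> 3 * (R * R) * p \<and> p \<le> 3 * (R * R) * P
        \<and> Q \<le> 3 * (R * R) * q \<and> q \<le> 3 * (R * R) * Q"
      using xhy(2) by (auto simp: sizes_def)
  qed
qed

lemma cartan_iff_coarse:
  "closed_subgroup H \<Longrightarrow> connected H \<Longrightarrow> cartan_decomposition_subgroup H \<longleftrightarrow> coarse (sizes H)"
  using coarse_imp_cartan cartan_imp_coarse by blast

subsection \<open>Upper triangular matrices\<close>

text \<open>The Lie algebra of \<open>N_grp\<close>, a Heisenberg algebra whose centre is the (1,3)
  direction.\<close>

definition nil3 :: "mat3 set" where
  "nil3 = {X. \<exists>x y z. X = ut 0 0 0 x y z}"

lemma nil3_ut [simp]: "ut a b c x y z \<in> nil3 \<longleftrightarrow> a = 0 \<and> b = 0 \<and> c = 0"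
  by (auto simp: nil3_def)

lemma subspace_nil3: "subspace nil3"
  by (auto simp: subspace_def nil3_def zero_ut)

text \<open>A functional that turns powers of X into powers of r turns the exponential series into
  the scalar one. For triangular X each diagonal entry is such a functional.\<close>

lemma mexp_linear:
  assumes "linear \<phi>" "\<And>n. \<phi> ((((**) X) ^^ n) (mat 1)) = r ^ n"
  shows "\<phi> (mexp X) = exp (r::real)"
proof -
  have bl: "bounded_linear (\<lambda>a. \<phi> (mat_of a))"
    by (intro bounded_linear_compose[OF _ bounded_linear_mat_of] assms(1)[unfolded linear_conv_bounded_linear])
  have "\<phi> (mat_of (exp (M3 X))) = (\<Sum>n. \<phi> (mat_of (M3 X ^ n /\<^sub>R fact n)))"
    unfolding exp_def by (rule bounded_linear.suminf[OF bl summable_exp_generic])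
  also have "\<dots> = exp r"
    unfolding exp_def using assms by (simp add: mat_of_power linear_cmul)
  finally show ?thesis by (simp add: mat_of_exp)
qed

lemma linear_entry: "linear (\<lambda>X::mat3. X$i$j)"
  by (rule linearI) auto

lemma mexp_entry_0:
  assumes "\<And>n. ((((**) X) ^^ n) (mat 1))$i$j = 0"
  shows "mexp X $ i $ j = 0"
proof -
  have bl: "bounded_linear (\<lambda>a. mat_of a $ i $ j)"
    by (intro bounded_linear_compose[OF _ bounded_linear_mat_of, of "\<lambda>X. X$i$j"]
        linear_entry[unfolded linear_conv_bounded_linear])
  have "mat_of (exp (M3 X)) $ i $ j = (\<Sum>n. mat_of (M3 X ^ n /\<^sub>R fact n) $ i $ j)"
    unfolding exp_def by (rule bounded_linear.suminf[OF bl summable_exp_generic])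
  then show ?thesis
    using assms by (simp add: mat_of_power mat_of_exp)
qed

lemma ut_power:
  "\<exists>x' y' z'. (((**) (ut a b c x y z)) ^^ n) (mat 1) = ut (a ^ n) (b ^ n) (c ^ n) x' y' z'"
proof (induction n)
  case (Suc n)
  then obtain x' y' z' where
    "(((**) (ut a b c x y z)) ^^ n) (mat 1) = ut (a ^ n) (b ^ n) (c ^ n) x' y' z'" by blast
  then show ?case by simp
qed (simp add: mat_1_ut)

lemma mexp_ut: "\<exists>x' y' z'. mexp (ut a b c x y z) = ut (exp a) (exp b) (exp c) x' y' z'"
proof -
  let ?X = "ut a b c x y z"
  have p: "((((**) ?X) ^^ n) (mat 1))$1$1 = a ^ n" "((((**) ?X) ^^ n) (mat 1))$2$2 = b ^ n"
    "((((**) ?X) ^^ n) (mat 1))$3$3 = c ^ n" "((((**) ?X) ^^ n) (mat 1))$2$1 = 0"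
    "((((**) ?X) ^^ n) (mat 1))$3$1 = 0" "((((**) ?X) ^^ n) (mat 1))$3$2 = 0" for n
    using ut_power[where a = a and b = b and c = c and x = x and y = y and z = z and n = n] by auto
  have "mexp ?X $ 1 $ 1 = exp a" "mexp ?X $ 2 $ 2 = exp b" "mexp ?X $ 3 $ 3 = exp c"
    by (intro mexp_linear linear_entry p)+
  moreover have "mexp ?X $ 2 $ 1 = 0" "mexp ?X $ 3 $ 1 = 0" "mexp ?X $ 3 $ 2 = 0"
    by (intro mexp_entry_0 p)+
  ultimately show ?thesis
    using eq_utI[of "mexp ?X"] by metis
qed

lemma mexp_diag [simp]: "mexp (ut a b c 0 0 0) = ut (exp a) (exp b) (exp c) 0 0 0"
proof -
  have p: "(((**) (ut a b c 0 0 0)) ^^ n) (mat 1) = ut (a ^ n) (b ^ n) (c ^ n) 0 0 0" for n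
    by (induction n) (simp_all add: mat_1_ut)
  have "mexp (ut a b c 0 0 0) $ 1 $ 2 = 0" "mexp (ut a b c 0 0 0) $ 1 $ 3 = 0"
    "mexp (ut a b c 0 0 0) $ 2 $ 3 = 0"
    by (intro mexp_entry_0; simp add: p)+
  then show ?thesis using mexp_ut[of a b c 0 0 0] by auto
qed

lemma mexp_add_commute:
  assumes "X ** Y = Y ** X"
  shows "mexp (X + Y) = mexp X ** mexp Y"
proof -
  have "exp (M3 X + M3 Y) = exp (M3 X) * exp (M3 Y)"
    by (rule exp_add_commuting) (simp add: assms flip: M3_simps)
  then show ?thesis by (metis M3_simps(1) mat_of_exp mat_of_simps(5))
qed

text \<open>Products of three strictly upper triangular matrices vanish, so the series ends with the
  quadratic term; that term is \<open>x * y / 2\<close>.\<close>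

lemma mexp_nil [simp]: "mexp (ut 0 0 0 x y z) = ut 1 1 1 x y (z + x * y / 2)"
proof -
  let ?X = "ut 0 0 0 x y z"
  have "(((**) ?X) ^^ Suc (Suc (Suc n))) (mat 1) = 0" for n
  proof -
    have "(((**) ?X) ^^ Suc (Suc (Suc n))) (mat 1) = (?X ** (?X ** ?X)) ** ((((**) ?X) ^^ n) (mat 1))"
      by (simp only: funpow.simps o_apply matrix_mul_assoc)
    also have "?X ** (?X ** ?X) = 0" by (simp add: zero_ut)
    finally show ?thesis by simp
  qed
  then have z: "(((**) ?X) ^^ n) (mat 1) = 0" if "n \<notin> {..<3}" for n
  proof -
    have "n = Suc (Suc (Suc (n - 3)))" using that by simp
    then show ?thesis using \<open>\<And>n. (((**) ?X) ^^ Suc (Suc (Suc n))) (mat 1) = 0\<close> by metis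
  qed
  have "mexp ?X = (\<Sum>n<3. (1 / fact n) *\<^sub>R (((**) ?X) ^^ n) (mat 1))"
    unfolding mexp_def by (rule suminf_finite) (use z in auto)
  also have "\<dots> = ut 1 1 1 x y (z + x * y / 2)"
    by (simp add: numeral_3_eq_3 fact_numeral mat_1_ut)
  finally show ?thesis .
qed

lemma nil3_mexp_inj: "X \<in> nil3 \<Longrightarrow> Y \<in> nil3 \<Longrightarrow> mexp X = mexp Y \<Longrightarrow> X = Y"
  by (auto simp: nil3_def)

lemma A_grp_iff: "M \<in> A_grp \<longleftrightarrow> (\<exists>a b c. M = ut a b c 0 0 0 \<and> a > 0 \<and> b > 0 \<and> c > 0 \<and> a * b * c = 1)"
  by (auto simp: A_grp_def forall_3 mat3_eq_iff det_3)

lemma N_grp_iff: "M \<in> N_grp \<longleftrightarrow> (\<exists>x y z. M = ut 1 1 1 x y z)"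
  by (auto simp: N_grp_def forall_3 mat3_eq_iff)

lemma AN_iff: "M \<in> A_grp <#>\<^bsub>SL3\<^esub> N_grp \<longleftrightarrow>
    (\<exists>a b c x y z. M = ut a b c x y z \<and> a > 0 \<and> b > 0 \<and> c > 0 \<and> a * b * c = 1)" (is "?L = ?R")
proof
  assume ?L
  then show ?R unfolding set_mult_SL3 A_grp_iff N_grp_iff by fastforce
next
  assume ?R
  then obtain a b c x y z where M: "M = ut a b c x y z" "a > 0" "b > 0" "c > 0" "a * b * c = 1" by blast
  then have "ut a b c 0 0 0 \<in> A_grp" "ut 1 1 1 (x / a) (y / b) (z / a) \<in> N_grp"
    unfolding A_grp_iff N_grp_iff by auto
  moreover have "M = ut a b c 0 0 0 ** ut 1 1 1 (x / a) (y / b) (z / a)" using M by simp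
  ultimately show ?L unfolding set_mult_SL3 by blast
qed

lemma N_grp_mexp: "M \<in> N_grp \<longleftrightarrow> (\<exists>X\<in>nil3. M = mexp X)"
proof
  assume "M \<in> N_grp"
  then obtain x y z where M: "M = ut 1 1 1 x y z" unfolding N_grp_iff by blast
  then have "M = mexp (ut 0 0 0 x y (z - x * y / 2))" by simp
  then show "\<exists>X\<in>nil3. M = mexp X" by (rule bexI) simp
qed (auto simp: nil3_def N_grp_iff)

text \<open>An entry that is constant on the group has derivative 0 at the identity. This reads the
  shape of the algebra off the shape of the group without a logarithm.\<close>

lemma lie_entry:
  assumes "X \<in> lie_algebra H" "\<And>h. h \<in> H \<Longrightarrow> h$i$j = mat 1$i$j"
  shows "X$i$j = 0"
proof -
  have "mexp ((1 / real (Suc n)) *\<^sub>R X) \<in> H" for n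
    using assms(1) by (auto simp: lie_algebra_def)
  then have *: "(real (Suc n) *\<^sub>R (mexp ((1 / real (Suc n)) *\<^sub>R X) - mat 1))$i$j = 0" for n
    using assms(2) by simp
  have "(\<lambda>n. (real (Suc n) *\<^sub>R (mexp ((1 / real (Suc n)) *\<^sub>R X) - mat 1))$i$j) \<longlonglongrightarrow> X$i$j"
    by (intro tendsto_vec_nth mexp_seq_tendsto)
  then show ?thesis unfolding * by (simp add: LIMSEQ_const_iff)
qed

lemma lie_AN:
  assumes "H \<subseteq> A_grp <#>\<^bsub>SL3\<^esub> N_grp" "X \<in> lie_algebra H"
  obtains a b c x y z where "X = ut a b c x y z" "a + b + c = 0"
proof -
  have H: "\<exists>a b c x y z. h = ut a b c x y z \<and> a * b * c = 1" if "h \<in> H" for h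
    using assms(1) that AN_iff by blast
  have "X$2$1 = 0" "X$3$1 = 0" "X$3$2 = 0"
    by (rule lie_entry[OF assms(2)], use H in fastforce)+
  then have X: "X = ut (X$1$1) (X$2$2) (X$3$3) (X$1$2) (X$2$3) (X$1$3)" by (rule eq_utI)
  have "mexp X \<in> H" using assms(2) by (rule lie_algebraD)
  moreover obtain x y z where "mexp X = ut (exp (X$1$1)) (exp (X$2$2)) (exp (X$3$3)) x y z"
    using X mexp_ut by metis
  ultimately have "exp (X$1$1) * exp (X$2$2) * exp (X$3$3) = 1"
    using H[of "mexp X"] by auto
  then have "X$1$1 + X$2$2 + X$3$3 = 0"
    by (simp flip: exp_add)
  then show ?thesis using that X by blast
qed

lemma lie_nil3:
  assumes "\<And>h. h \<in> H \<Longrightarrow> h \<in> N_grp"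
  shows "lie_algebra H \<subseteq> nil3"
proof
  fix X assume X: "X \<in> lie_algebra H"
  have "X$2$1 = 0" "X$3$1 = 0" "X$3$2 = 0" "X$1$1 = 0" "X$2$2 = 0" "X$3$3 = 0"
    by (rule lie_entry[OF X], use assms in \<open>fastforce simp: N_grp_iff\<close>)+
  then show "X \<in> nil3" using eq_utI[of X] by (metis nil3_ut)
qed

lemma bracket_ut [simp]: "bracket (ut a b c x y z) (ut a' b' c' x' y' z') =
   ut 0 0 0 ((a - b) * x' - (a' - b') * x) ((b - c) * y' - (b' - c') * y)
     ((a - c) * z' - (a' - c') * z + x * y' - x' * y)"
  by (simp add: bracket_def algebra_simps)

section \<open>Closed subgroups with a prescribed Lie algebra\<close>

text \<open>The Baker-Campbell-Hausdorff formula, exact after the first bracket because the algebra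
  is two-step nilpotent.\<close>

lemma mexp_nil_mult:
  assumes "X \<in> nil3" "Y \<in> nil3"
  shows "mexp X ** mexp Y = mexp (X + Y + (1/2) *\<^sub>R bracket X Y)"
  using assms by (auto simp: nil3_def field_simps)

text \<open>The inverse of \<open>mexp\<close> on \<open>N_grp\<close>. Being polynomial it is
  continuous, so that images of subspaces under \<open>mexp\<close> become closed sets.\<close>

definition nlog :: "mat3 \<Rightarrow> mat3" where
  "nlog M = ut 0 0 0 (M$1$2) (M$2$3) (M$1$3 - M$1$2 * M$2$3 / 2)"

text \<open>The product formula makes the image of a bracket-closed subspace a group, and
  \<open>nlog\<close> presents it as the preimage of a closed set. Injectivity of
  \<open>mexp\<close> on \<open>nil3\<close> then prevents its Lie algebra from being larger than
  u.\<close>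

lemma closed_subgroup_mexp_nil:
  assumes u: "subspace u" "u \<subseteq> nil3" and br: "\<And>X Y. X \<in> u \<Longrightarrow> Y \<in> u \<Longrightarrow> bracket X Y \<in> u"
  shows "closed_subgroup (mexp ` u)" "lie_algebra (mexp ` u) = u"
proof -
  have minus: "- X \<in> u" if "X \<in> u" for X using that u(1) subspace_neg by blast
  have d1: "det (mexp X) = 1" "adj (mexp X) = mexp (- X)" if "X \<in> u" for X
    using that u(2) by (auto simp: nil3_def)
  have im: "mexp ` u = nlog -` u \<inter> N_grp"
  proof (rule subset_antisym; rule subsetI)
    fix M assume "M \<in> mexp ` u"
    then obtain U where U: "U \<in> u" "M = mexp U" by blast
    then obtain x y z where "U = ut 0 0 0 x y z" using u(2) by (auto simp: nil3_def)
    then show "M \<in> nlog -` u \<inter> N_grp"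
      using U by (simp add: N_grp_iff nlog_def)
  next
    fix M assume "M \<in> nlog -` u \<inter> N_grp"
    then have "nlog M \<in> u" "M \<in> N_grp" by auto
    moreover have "mexp (nlog M) = M" using \<open>M \<in> N_grp\<close> by (auto simp: N_grp_iff nlog_def)
    ultimately show "M \<in> mexp ` u" by (metis imageI)
  qed
  have "continuous_on UNIV nlog"
  proof (rule continuous_on_mat3I)
    fix i j :: 3
    have "\<forall>i j. continuous_on UNIV (\<lambda>x. nlog x $ i $ j)"
      unfolding forall_3 nlog_def ut_nth by (intro conjI continuous_intros) auto
    then show "continuous_on UNIV (\<lambda>x. nlog x $ i $ j)" by blast
  qed
  moreover have "closed N_grp"
    unfolding N_grp_def forall_3
    by (intro closed_Collect_conj closed_Collect_eq continuous_intros)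
  ultimately have "closed (mexp ` u)"
    unfolding im by (intro closed_Int closed_vimage[OF closed_subspace[OF u(1)]])
  moreover have "subgroup (mexp ` u) SL3"
    unfolding subgroup_SL3_iff
  proof (intro conjI ballI)
    show "mat 1 \<in> mexp ` u" using subspace_0[OF u(1)] mexp_0 by (metis imageI)
  next
    fix x y assume "x \<in> mexp ` u" "y \<in> mexp ` u"
    then obtain X Y where XY: "x = mexp X" "y = mexp Y" "X \<in> u" "Y \<in> u" by blast
    then have "x ** y = mexp (X + Y + (1/2) *\<^sub>R bracket X Y)"
      using mexp_nil_mult[of X Y] u(2) by auto
    then show "x ** y \<in> mexp ` u"
      using XY br by (auto intro!: imageI subspace_add[OF u(1)] subspace_scale[OF u(1)])
  qed (use d1 minus in auto)
  ultimately show "closed_subgroup (mexp ` u)" by (simp add: closed_subgroup_iff)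
  show "lie_algebra (mexp ` u) = u"
  proof
    show "u \<subseteq> lie_algebra (mexp ` u)"
      using subspace_scale[OF u(1)] by (auto simp: lie_algebra_def)
    show "lie_algebra (mexp ` u) \<subseteq> u"
    proof
      fix X assume X: "X \<in> lie_algebra (mexp ` u)"
      then obtain Y where Y: "Y \<in> u" "mexp X = mexp Y" using lie_algebraD by blast
      have "X \<in> nil3" using lie_nil3[of "mexp ` u"] X im by auto
      then show "X \<in> u" using Y u(2) nil3_mexp_inj by blast
    qed
  qed
qed

text \<open>A nonzero diagonal entry of \<open>X\<close> recovers \<open>s\<close> from the product, so a convergent sequence in the
  subgroup has convergent factors.\<close>

lemma twisted_closed_subgroup:
  assumes X: "X = ut a b c x y z" "a + b + c = 0" "X \<notin> nil3"
    and u: "subspace u" "u \<subseteq> nil3" and br: "\<And>X Y. X \<in> u \<Longrightarrow> Y \<in> u \<Longrightarrow> bracket X Y \<in> u"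
    and Ad: "\<And>s U. U \<in> u \<Longrightarrow> mexp (s *\<^sub>R X) ** U ** mexp (- s *\<^sub>R X) \<in> u"
  defines "L \<equiv> {mexp (s *\<^sub>R X) ** mexp U | s U. U \<in> u}"
  shows "closed_subgroup L"
proof -
  define E where "E s = mexp (s *\<^sub>R X)" for s
  have E: "E (s + t) = E s ** E t" "E 0 = mat 1" for s t
    by (simp_all add: E_def mexp_add_scaleR)
  have Einv: "E s ** E (- s) = mat 1" "E (- s) ** E s = mat 1" for s
    by (simp_all add: E(2) flip: E(1))
  have detE: "\<exists>p q r. E s = ut (exp (s * a)) (exp (s * b)) (exp (s * c)) p q r" for s
    using mexp_ut[of "s * a"] by (auto simp: E_def X)
  have "det (E s) = 1" for s
  proof -
    have "exp (s * a) * exp (s * b) * exp (s * c) = exp (s * (a + b + c))"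
      by (simp add: distrib_left exp_add)
    then show ?thesis using detE[of s] X(2) by auto
  qed
  have V: "closed_subgroup (mexp ` u)" by (rule closed_subgroup_mexp_nil(1)[OF u br])
  then have sgV: "\<And>x y. x \<in> mexp ` u \<Longrightarrow> y \<in> mexp ` u \<Longrightarrow> x ** y \<in> mexp ` u" "mat 1 \<in> mexp ` u"
    "\<And>x. x \<in> mexp ` u \<Longrightarrow> adj x \<in> mexp ` u" "\<And>x. x \<in> mexp ` u \<Longrightarrow> det x = 1" "closed (mexp ` u)"
    by (auto simp: closed_subgroup_iff subgroup_SL3_iff)
  have L: "M \<in> L \<longleftrightarrow> (\<exists>s. \<exists>v\<in>mexp ` u. M = E s ** v)" for M
    by (auto simp: L_def E_def)
  have norm: "E s ** v ** E (- s) \<in> mexp ` u" if v: "v \<in> mexp ` u" for s v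
  proof -
    obtain U where U: "U \<in> u" "v = mexp U" using v by blast
    have "E s ** v ** E (- s) = mexp (E s ** U ** E (- s))"
      unfolding U(2) by (rule mexp_conj[symmetric]) (rule Einv)+
    then show ?thesis using Ad[OF U(1), of s] by (auto simp: E_def)
  qed
  have sw: "v ** E s = E s ** (E (- s) ** v ** E (- (- s)))" for v s
    using Einv by (simp add: matrix_mul_assoc)
  have "subgroup L SL3"
    unfolding subgroup_SL3_iff
  proof (intro conjI ballI)
    show "mat 1 \<in> L" unfolding L using E(2) sgV(2) matrix_mul_lid by metis
  next
    fix m n assume "m \<in> L" "n \<in> L"
    then obtain s v t w where mn: "m = E s ** v" "n = E t ** w" and vw: "v \<in> mexp ` u" "w \<in> mexp ` u"
      unfolding L by blast
    have "m ** n = E s ** (v ** E t) ** w" by (simp add: mn matrix_mul_assoc)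
    also have "\<dots> = E (s + t) ** ((E (- t) ** v ** E (- (- t))) ** w)"
      unfolding sw[of v t] E(1) by (simp add: matrix_mul_assoc)
    finally show "m ** n \<in> L" unfolding L using norm[OF vw(1)] vw(2) sgV(1) by blast
  next
    fix m assume "m \<in> L"
    then obtain s v where m: "m = E s ** v" "v \<in> mexp ` u" unfolding L by blast
    show "det m = 1" using m sgV(4) \<open>det (E s) = 1\<close> by (simp add: det_mul)
    have "adj (E s) = E (- s)"
      using mat3_inv_unique[OF Einv(1) \<open>det (E s) = 1\<close>] by simp
    then have "adj m = adj v ** E (- s)" by (simp add: m adj_mult)
    also have "\<dots> = E (- s) ** (E (- (- s)) ** adj v ** E (- (- (- s))))"
      by (rule sw)
    finally have "adj m = E (- s) ** (E (- (- s)) ** adj v ** E (- (- (- s))))" .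
    moreover have "E (- (- s)) ** adj v ** E (- (- (- s))) \<in> mexp ` u"
      by (rule norm[OF sgV(3)[OF m(2)]])
    ultimately show "adj m \<in> L" unfolding L by metis
  qed
  moreover have "closed L"
    unfolding closed_sequential_limits
  proof (intro allI impI, elim conjE)
    fix M l assume mem: "\<forall>n. M n \<in> L" and lim: "M \<longlonglongrightarrow> l"
    have "\<forall>n. \<exists>s v. v \<in> mexp ` u \<and> M n = E s ** v" using mem unfolding L by blast
    then obtain s v where Mn: "\<And>n. M n = E (s n) ** v n" and v: "\<And>n. v n \<in> mexp ` u"
      by metis
    have ent: "M n $ i $ i = exp (s n * X $ i $ i)" for n i
    proof -
      obtain p q r where "E (s n) = ut (exp (s n * a)) (exp (s n * b)) (exp (s n * c)) p q r"
        using detE by blast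
      moreover obtain p' q' r' where "v n = ut 1 1 1 p' q' r'"
        using v[of n] u(2) by (auto simp: nil3_def)
      ultimately have "\<forall>i. M n $ i $ i = exp (s n * X $ i $ i)"
        unfolding forall_3 by (simp add: Mn X)
      then show ?thesis by blast
    qed
    have "det (M n) = 1" for n using Mn \<open>\<And>s. det (E s) = 1\<close> sgV(4)[OF v] by (simp add: det_mul)
    have low: "M n $ 2 $ 1 = 0 \<and> M n $ 3 $ 1 = 0 \<and> M n $ 3 $ 2 = 0" for n
    proof -
      obtain p q r where "E (s n) = ut (exp (s n * a)) (exp (s n * b)) (exp (s n * c)) p q r"
        using detE by blast
      moreover obtain p' q' r' where "v n = ut 1 1 1 p' q' r'"
        using v[of n] u(2) by (auto simp: nil3_def)
      ultimately show ?thesis by (simp add: Mn)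
    qed
    have le: "(\<lambda>n. M n $ i $ j) \<longlonglongrightarrow> l $ i $ j" for i j
      by (intro tendsto_vec_nth lim)
    have lnn: "l $ i $ i \<ge> 0" for i
      by (rule LIMSEQ_le_const[OF le]) (simp add: ent)
    have "l$2$1 = 0" "l$3$1 = 0" "l$3$2 = 0"
      using le[of 2 1] le[of 3 1] le[of 3 2] low by (auto simp: LIMSEQ_const_iff)
    \<comment> \<open>Determinant 1 survives in the limit and keeps the limiting diagonal entries
      away from 0, so that their logarithms converge.\<close>
    moreover have "det l = 1"
    proof -
      have "closed (carrier SL3)" by (rule closed_SL3)
      then have "l \<in> carrier SL3"
        by (rule closed_sequentially[OF _ _ lim]) (simp add: \<open>\<And>n. det (M n) = 1\<close>)
      then show ?thesis by simp
    qed
    ultimately have "l$1$1 * l$2$2 * l$3$3 = 1" by (simp add: det_3)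
    then have "\<forall>i. l $ i $ i \<noteq> 0" unfolding forall_3 by auto
    then have lpos: "l $ i $ i > 0" for i using lnn[of i] by (simp add: less_le)
    obtain i where i: "X $ i $ i \<noteq> 0"
      using X by (metis nil3_ut ut_nth(1,5,9))
    have "(\<lambda>n. ln (M n $ i $ i) / X $ i $ i) \<longlonglongrightarrow> ln (l $ i $ i) / X $ i $ i"
      using i lpos[of i] by (intro tendsto_intros le) auto
    then have s: "s \<longlonglongrightarrow> ln (l $ i $ i) / X $ i $ i" (is "_ \<longlonglongrightarrow> ?s")
      using i by (simp add: ent)
    have "continuous_on UNIV E" unfolding E_def by (rule continuous_mexp_scaleR)
    then have "(\<lambda>n. E (- s n)) \<longlonglongrightarrow> E (- ?s)"
      by (rule continuous_on_tendsto_compose) (use s in \<open>auto intro: tendsto_minus\<close>)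
    then have "(\<lambda>n. E (- s n) ** M n) \<longlonglongrightarrow> E (- ?s) ** l"
      by (intro tendsto_intros lim)
    moreover have "E (- s n) ** M n = v n" for n
      using Einv by (simp add: Mn matrix_mul_assoc)
    ultimately have "v \<longlonglongrightarrow> E (- ?s) ** l" by simp
    then have "E (- ?s) ** l \<in> mexp ` u"
      by (rule closed_sequentially[OF sgV(5) v])
    moreover have "l = E ?s ** (E (- ?s) ** l)" using Einv by (simp add: matrix_mul_assoc)
    ultimately show "l \<in> L" unfolding L by metis
  qed
  ultimately show ?thesis by (simp add: closed_subgroup_iff)
qed

subsection \<open>Connected subgroups of AN that are compatible with A\<close>

lemma adj_mexp:
  assumes "det (mexp X) = 1"
  shows "adj (mexp X) = mexp (- X)"
  using mat3_inv_unique[OF mexp_minus(2)[of X] assms] by simp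

lemma mexp_scaleR_ut:
  "\<exists>p q r. mexp (s *\<^sub>R ut a b c x y z) = ut (exp (s * a)) (exp (s * b)) (exp (s * c)) p q r"
  unfolding ut_scaleR by (rule mexp_ut)

lemma lie_algebraI: "(\<And>t. mexp (t *\<^sub>R X) \<in> H) \<Longrightarrow> X \<in> lie_algebra H"
  by (simp add: lie_algebra_def)

locale AN_subgroup =
  fixes H :: "mat3 set"
  assumes closed: "closed_subgroup H" and conn: "connected H"
    and AN: "H \<subseteq> A_grp <#>\<^bsub>SL3\<^esub> N_grp" and compat: "compatible_with_A H"
begin

abbreviation "\<hh> \<equiv> lie_algebra H"
abbreviation "\<uu> \<equiv> lie_algebra H \<inter> nil3"

lemma mem:
  "x \<in> H \<Longrightarrow> det x = 1" "x \<in> H \<Longrightarrow> adj x \<in> H" "x \<in> H \<Longrightarrow> y \<in> H \<Longrightarrow> x ** y \<in> H" "mat 1 \<in> H"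
  using closed by (auto simp: closed_subgroup_iff subgroup_SL3_iff)

lemma subspace_h: "subspace \<hh>"
  by (rule subspace_lie_algebra[OF closed])

lemma subspace_u: "subspace \<uu>"
  by (intro subspace_inter subspace_h subspace_nil3)

lemma h_ut:
  assumes "X \<in> \<hh>"
  obtains a b c x y z where "X = ut a b c x y z" "a + b + c = 0"
  by (rule lie_AN[OF AN assms])

lemma h_bracket: "X \<in> \<hh> \<Longrightarrow> Y \<in> \<hh> \<Longrightarrow> bracket X Y \<in> \<hh>"
  by (rule lie_algebra_bracket[OF closed])

lemma h_bracket_u:
  assumes "X \<in> \<hh>" "Y \<in> \<hh>"
  shows "bracket X Y \<in> \<uu>"
proof -
  obtain a b c x y z where "X = ut a b c x y z" by (rule h_ut[OF assms(1)])
  moreover obtain a b c x y z where "Y = ut a b c x y z" by (rule h_ut[OF assms(2)])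
  ultimately show ?thesis using h_bracket[OF assms] by auto
qed

lemma mexp_mem: "X \<in> \<hh> \<Longrightarrow> mexp (t *\<^sub>R X) \<in> H"
  by (simp add: lie_algebra_def)

lemma adj_mexp_h: "X \<in> \<hh> \<Longrightarrow> adj (mexp (t *\<^sub>R X)) = mexp (- t *\<^sub>R X)"
  using adj_mexp[OF mem(1)[OF mexp_mem[of X t]]] by simp

lemma closed_subgroup_u: "closed_subgroup (mexp ` \<uu>)" "lie_algebra (mexp ` \<uu>) = \<uu>"
  using closed_subgroup_mexp_nil[OF subspace_u] h_bracket_u by auto

lemma unipotent_eq:
  assumes "\<hh> \<subseteq> nil3"
  shows "H = mexp ` \<hh>"
proof
  have "\<uu> = \<hh>" using assms by blast
  then show "H \<subseteq> mexp ` \<hh>"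
    using connected_subgroup_subset[OF closed conn closed_subgroup_u(1)] closed_subgroup_u(2) by simp
  show "mexp ` \<hh> \<subseteq> H" using lie_algebraD by blast
qed

text \<open>The right-hand side is a closed subgroup because conjugation by elements of H preserves
  both \<hh> and \<open>nil3\<close>, hence \<uu>; comparing Lie algebras gives equality. The second
  claim holds since an element with unit diagonal forces s X to have zero diagonal, and X does
  not.\<close>

lemma twisted_eq:
  assumes X: "X \<in> \<hh>" "X \<notin> nil3" and h: "\<And>Y. Y \<in> \<hh> \<Longrightarrow> \<exists>s. \<exists>U\<in>\<uu>. Y = s *\<^sub>R X + U"
  shows "H = {mexp (s *\<^sub>R X) ** mexp U | s U. U \<in> \<uu>}" (is "_ = ?L")
    and "H \<inter> N_grp = mexp ` \<uu>"
proof -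
  obtain a b c x y z where Xe: "X = ut a b c x y z" "a + b + c = 0" by (rule h_ut[OF X(1)])
  have Ad: "mexp (s *\<^sub>R X) ** U ** mexp (- s *\<^sub>R X) \<in> \<uu>" if U: "U \<in> \<uu>" for s U
  proof -
    have "mexp (s *\<^sub>R X) ** U ** adj (mexp (s *\<^sub>R X)) \<in> \<hh>"
      using U by (intro lie_algebra_Ad[OF closed] mexp_mem X) auto
    moreover obtain p q r where "mexp (s *\<^sub>R X) = ut (exp (s * a)) (exp (s * b)) (exp (s * c)) p q r"
      using mexp_scaleR_ut Xe(1) by metis
    then have "mexp (s *\<^sub>R X) ** U ** adj (mexp (s *\<^sub>R X)) \<in> nil3"
      using U by (auto simp: nil3_def)
    ultimately show ?thesis by (simp add: adj_mexp_h X)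
  qed
  have L: "closed_subgroup ?L"
    by (rule twisted_closed_subgroup[OF Xe X(2) subspace_u _ _ Ad]) (use h_bracket_u in auto)
  have "X \<in> lie_algebra ?L"
  proof (rule lie_algebraI)
    fix t
    have "mexp (t *\<^sub>R X) = mexp (t *\<^sub>R X) ** mexp 0" by simp
    then show "mexp (t *\<^sub>R X) \<in> ?L" using subspace_0[OF subspace_u] by blast
  qed
  moreover have "U \<in> lie_algebra ?L" if "U \<in> \<uu>" for U
  proof (rule lie_algebraI)
    fix t
    have "mexp (t *\<^sub>R U) = mexp (0 *\<^sub>R X) ** mexp (t *\<^sub>R U)" by simp
    then show "mexp (t *\<^sub>R U) \<in> ?L"
      using subspace_scale[OF subspace_u that] by blast
  qed
  ultimately have "\<hh> \<subseteq> lie_algebra ?L"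
  proof (intro subsetI)
    assume XU: "X \<in> lie_algebra ?L" "\<And>U. U \<in> \<uu> \<Longrightarrow> U \<in> lie_algebra ?L"
    fix Y assume "Y \<in> \<hh>"
    then obtain s U where "U \<in> \<uu>" "Y = s *\<^sub>R X + U" using h by blast
    then show "Y \<in> lie_algebra ?L"
      using XU by (simp only: subspace_add[OF subspace_lie_algebra[OF L]] subspace_scale[OF subspace_lie_algebra[OF L]])
  qed
  then have "H \<subseteq> ?L" by (rule connected_subgroup_subset[OF closed conn L])
  moreover have "?L \<subseteq> H"
    using mexp_mem[OF X(1)] mem(3) lie_algebraD by blast
  ultimately show H: "H = ?L" by blast
  show "H \<inter> N_grp = mexp ` \<uu>"
  proof
    show "mexp ` \<uu> \<subseteq> H \<inter> N_grp"
      using lie_algebraD by (auto simp: N_grp_mexp)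
    show "H \<inter> N_grp \<subseteq> mexp ` \<uu>"
    proof
      fix M assume M: "M \<in> H \<inter> N_grp"
      then obtain s U where sU: "M = mexp (s *\<^sub>R X) ** mexp U" "U \<in> \<uu>" using H by blast
      obtain p q r where "mexp (s *\<^sub>R X) = ut (exp (s * a)) (exp (s * b)) (exp (s * c)) p q r"
        using mexp_scaleR_ut Xe(1) by metis
      then have "s * a = 0" "s * b = 0" "s * c = 0"
        using sU M by (auto simp: N_grp_iff nil3_def)
      then have "s = 0" using X(2) Xe by auto
      then show "M \<in> mexp ` \<uu>" using sU by simp
    qed
  qed
qed

text \<open>Compatibility writes \<open>mexp (s *\<^sub>R X)\<close> as t v k, and comparing
  diagonals identifies t as the exponential of the diagonal part. The set T contains these diagonal
  matrices, in particular the one for s = 1. Since k commutes with it and exp is injective, an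
  off-diagonal entry of k survives only between equal diagonal entries of X.\<close>

lemma compat_decomp:
  assumes X: "ut a b c x y z \<in> \<hh>"
  obtains v p q r where "v \<in> H \<inter> N_grp"
    "mexp (s *\<^sub>R ut a b c x y z) = ut (exp (s * a)) (exp (s * b)) (exp (s * c)) 0 0 0 ** v ** ut 1 1 1 p q r"
    "p = 0 \<or> a = b" "q = 0 \<or> b = c" "r = 0 \<or> a = c"
proof -
  let ?T = "A_grp \<inter> (H <#>\<^bsub>SL3\<^esub> N_grp)"
  let ?A = "\<lambda>s. ut (exp (s * a)) (exp (s * b)) (exp (s * c)) 0 0 0"
  have E: "\<exists>x' y' z'. mexp (s *\<^sub>R ut a b c x y z) = ut (exp (s * a)) (exp (s * b)) (exp (s * c)) x' y' z'" for s
    by (rule mexp_scaleR_ut)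
  have EH: "mexp (s *\<^sub>R ut a b c x y z) \<in> H" for s by (rule mexp_mem[OF X])
  \<comment> \<open>The exponential of X and that of its diagonal part differ by a unipotent factor,
    so the latter belongs to H N.\<close>
  have T: "?A s \<in> ?T" for s
  proof -
    obtain x' y' z' where e: "mexp (s *\<^sub>R ut a b c x y z) = ut (exp (s * a)) (exp (s * b)) (exp (s * c)) x' y' z'"
      using E by blast
    have d: "exp (s * a) * exp (s * b) * exp (s * c) = 1" using mem(1)[OF EH[of s]] e by simp
    then have "?A s \<in> A_grp" unfolding A_grp_iff by fastforce
    moreover have "adj (mexp (s *\<^sub>R ut a b c x y z)) ** ?A s \<in> N_grp"
    proof -
      have "exp (s * b) * exp (s * c) * exp (s * a) = 1" "exp (s * a) * exp (s * c) * exp (s * b) = 1"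
        using d by (simp_all add: mult_ac)
      then show ?thesis using d unfolding e N_grp_iff by simp
    qed
    moreover have "?A s = mexp (s *\<^sub>R ut a b c x y z) ** (adj (mexp (s *\<^sub>R ut a b c x y z)) ** ?A s)"
      by (simp add: matrix_mul_assoc mult_adj mem(1)[OF EH] del: ut_scaleR)
    ultimately show ?thesis using EH unfolding set_mult_SL3 by blast
  qed
  have "mexp (s *\<^sub>R ut a b c x y z) \<in> ?T <#>\<^bsub>SL3\<^esub> (H \<inter> N_grp) <#>\<^bsub>SL3\<^esub> centralizer_N ?T"
    using compat EH unfolding compatible_with_A_def Let_def by blast
  then obtain t v k where tvk: "mexp (s *\<^sub>R ut a b c x y z) = t ** v ** k" "t \<in> ?T" "v \<in> H \<inter> N_grp" "k \<in> centralizer_N ?T"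
    unfolding set_mult_SL3 by blast
  have "k \<in> N_grp" using tvk(4) by (simp add: centralizer_N_def)
  then obtain p q r where k: "k = ut 1 1 1 p q r" by (auto simp: N_grp_iff)
  have "k ** ?A 1 = ?A 1 ** k" using tvk(4) T unfolding centralizer_N_def by blast
  then have pqr: "p = 0 \<or> a = b" "q = 0 \<or> b = c" "r = 0 \<or> a = c" by (auto simp: k)
  obtain x' y' z' where v: "v = ut 1 1 1 x' y' z'" using tvk(3) by (auto simp: N_grp_iff)
  obtain a' b' c' where t: "t = ut a' b' c' 0 0 0" using IntD1[OF tvk(2)] by (auto simp: A_grp_iff)
  obtain x'' y'' z'' where e: "mexp (s *\<^sub>R ut a b c x y z) = ut (exp (s * a)) (exp (s * b)) (exp (s * c)) x'' y'' z''"
    using E by blast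
  have "t = ?A s" using tvk(1) unfolding t v k e by simp
  then show ?thesis using that tvk(1,3) pqr k by blast
qed

lemma diag_mem_hI:
  assumes X: "ut a b c x y z \<in> \<hh>"
    and s: "\<And>s. \<exists>v\<in>H. mexp (s *\<^sub>R ut a b c x y z) = ut (exp (s * a)) (exp (s * b)) (exp (s * c)) 0 0 0 ** v"
  shows "ut a b c 0 0 0 \<in> \<hh>"
proof -
  have "mexp (s *\<^sub>R ut a b c 0 0 0) \<in> H" for s
  proof -
    obtain v where v: "v \<in> H" "mexp (s *\<^sub>R ut a b c x y z) = ut (exp (s * a)) (exp (s * b)) (exp (s * c)) 0 0 0 ** v"
      using s by blast
    have "mexp (s *\<^sub>R ut a b c x y z) ** adj v \<in> H" by (intro mem mexp_mem X v)
    also have "mexp (s *\<^sub>R ut a b c x y z) ** adj v = ut (exp (s * a)) (exp (s * b)) (exp (s * c)) 0 0 0"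
      by (simp only: v(2) matrix_mul_assoc[symmetric] mult_adj mem(1)[OF v(1)]) simp
    finally show ?thesis by simp
  qed
  then show ?thesis by (simp add: lie_algebra_def)
qed

text \<open>For distinct diagonal entries the centralizer factor k is trivial, so the diagonal part
  of the exponential is a quotient of elements of H.\<close>

lemma regular_mem:
  assumes X: "ut a b c x y z \<in> \<hh>" and "a \<noteq> b" "b \<noteq> c" "a \<noteq> c"
  shows "ut a b c 0 0 0 \<in> \<hh>"
proof (rule diag_mem_hI[OF X])
  fix s
  obtain v p q r where "v \<in> H \<inter> N_grp"
    "mexp (s *\<^sub>R ut a b c x y z) = ut (exp (s * a)) (exp (s * b)) (exp (s * c)) 0 0 0 ** v ** ut 1 1 1 p q r"
    "p = 0 \<or> a = b" "q = 0 \<or> b = c" "r = 0 \<or> a = c"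
    by (rule compat_decomp[OF X, of s])
  then have "v \<in> H" "mexp (s *\<^sub>R ut a b c x y z) = ut (exp (s * a)) (exp (s * b)) (exp (s * c)) 0 0 0 ** v"
    using assms by (auto simp flip: mat_1_ut)
  then show "\<exists>v\<in>H. mexp (s *\<^sub>R ut a b c x y z) = ut (exp (s * a)) (exp (s * b)) (exp (s * c)) 0 0 0 ** v"
    by blast
qed

text \<open>The elements \<open>exp (- s D) exp (s X)\<close> lie in the exponential of the algebra \<open>\<uu> + \<real>E\<close>; their direction
  at the identity is \<open>X - D\<close>.\<close>

lemma compat_bracket_closed:
  assumes X: "ut a b c x y z \<in> \<hh>" and E: "E \<in> nil3"
    and br: "\<And>U. U \<in> \<uu> \<Longrightarrow> \<exists>U'\<in>\<uu>. \<exists>r. bracket U E = U' + r *\<^sub>R E"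
    and dec: "\<And>s. \<exists>U\<in>\<uu>. \<exists>r. mexp (s *\<^sub>R ut a b c x y z)
      = ut (exp (s * a)) (exp (s * b)) (exp (s * c)) 0 0 0 ** mexp U ** mexp (r *\<^sub>R E)"
  shows "\<exists>r. ut a b c 0 0 0 + r *\<^sub>R E \<in> \<hh>"
proof -
  define B where "B = {U + r *\<^sub>R E | U r. U \<in> \<uu>}"
  have BI: "U + r *\<^sub>R E \<in> B" if "U \<in> \<uu>" for U r using that by (auto simp: B_def)
  have subB: "subspace B"
  proof (rule subspaceI)
    show "0 \<in> B" using BI[OF subspace_0[OF subspace_u], of 0] by simp
  next
    fix P Q assume "P \<in> B" "Q \<in> B"
    then obtain U r U' r' where "P = U + r *\<^sub>R E" "Q = U' + r' *\<^sub>R E" "U \<in> \<uu>" "U' \<in> \<uu>"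
      unfolding B_def by blast
    then have "P + Q = (U + U') + (r + r') *\<^sub>R E" "U + U' \<in> \<uu>"
      using subspace_add[OF subspace_u] by (simp_all add: scaleR_add_left)
    then show "P + Q \<in> B" using BI by metis
  next
    fix k P assume "P \<in> B"
    then obtain U r where "P = U + r *\<^sub>R E" "U \<in> \<uu>" unfolding B_def by blast
    then have "k *\<^sub>R P = k *\<^sub>R U + (k * r) *\<^sub>R E" "k *\<^sub>R U \<in> \<uu>"
      using subspace_scale[OF subspace_u] by (simp_all add: scaleR_add_right)
    then show "k *\<^sub>R P \<in> B" using BI by metis
  qed
  have uB: "U \<in> B" if "U \<in> \<uu>" for U using BI[OF that, of 0] by simp
  have EB: "r *\<^sub>R E \<in> B" for r using BI[OF subspace_0[OF subspace_u], of r] by simp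
  have Bnil: "B \<subseteq> nil3"
    using E subspace_add[OF subspace_nil3] subspace_scale[OF subspace_nil3] by (auto simp: B_def)
  have UE: "bracket U E \<in> B" if "U \<in> \<uu>" for U using br[OF that] BI by metis
  have brB: "bracket P Q \<in> B" if PQ: "P \<in> B" "Q \<in> B" for P Q
  proof -
    obtain U r U' r' where e: "P = U + r *\<^sub>R E" "Q = U' + r' *\<^sub>R E" "U \<in> \<uu>" "U' \<in> \<uu>"
      using PQ unfolding B_def by blast
    have "bracket P Q = bracket U U' + r' *\<^sub>R bracket U E - r *\<^sub>R bracket U' E"
      unfolding e bracket_def by (simp add: mat3_eq_iff mat3_mult_nth algebra_simps)
    moreover have "bracket U U' \<in> B" using h_bracket_u e uB by blast
    ultimately show ?thesis
      using UE[OF e(3)] UE[OF e(4)] subspace_add[OF subB] subspace_diff[OF subB] subspace_scale[OF subB] by metis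
  qed
  have clB: "closed_subgroup (mexp ` B)" "lie_algebra (mexp ` B) = B"
    by (rule closed_subgroup_mexp_nil[OF subB Bnil brB]; assumption)+
  let ?X = "ut a b c x y z" and ?D = "ut a b c 0 0 0"
  define F where "F s = mexp (s *\<^sub>R - ?D) ** mexp (s *\<^sub>R ?X)" for s
  have "F s \<in> mexp ` B" for s
  proof -
    obtain U r where Ur: "U \<in> \<uu>" "mexp (s *\<^sub>R ?X)
      = ut (exp (s * a)) (exp (s * b)) (exp (s * c)) 0 0 0 ** mexp U ** mexp (r *\<^sub>R E)" using dec by blast
    have "mexp (s *\<^sub>R - ?D) ** ut (exp (s * a)) (exp (s * b)) (exp (s * c)) 0 0 0 = mat 1"
      by (simp add: mat_1_ut flip: exp_add)
    then have "F s = mexp U ** mexp (r *\<^sub>R E)"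
      unfolding F_def Ur(2) by (metis matrix_mul_assoc matrix_mul_lid)
    then show ?thesis
      using clB(1) uB[OF Ur(1)] EB by (auto simp: closed_subgroup_iff subgroup_SL3_iff)
  qed
  then have Fm: "F (1 / real (Suc n)) \<in> mexp ` B" for n by blast
  have "(\<lambda>n. real (Suc n) *\<^sub>R (F (1 / real (Suc n)) - mat 1)) \<longlonglongrightarrow> - ?D + ?X"
    unfolding F_def by (rule mexp_mult_seq_tendsto)
  then have "- ?D + ?X \<in> lie_algebra (mexp ` B)"
    by (rule lie_algebraI_seq[OF clB(1) Fm seq_inverse_Suc(2)])
  then have "- ?D + ?X \<in> B" unfolding clB(2) .
  then obtain U r where Ur: "U \<in> \<uu>" "- ?D + ?X = U + r *\<^sub>R E" unfolding B_def by blast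
  have "D + V = Y - U" if "- D + Y = U + V" for D V Y :: mat3
  proof -
    have "Y = D + (- D + Y)" by simp
    then show ?thesis unfolding that by (simp add: algebra_simps)
  qed
  from this[OF Ur(2)] have "?D + r *\<^sub>R E = ?X - U" .
  then show ?thesis using subspace_diff[OF subspace_h X IntD1[OF Ur(1)]] by metis
qed

end

section \<open>Subalgebras of the strictly upper triangular matrices\<close>

lemma nil3E:
  assumes "X \<in> nil3" obtains x y z where "X = ut 0 0 0 x y z"
  using assms by (auto simp: nil3_def)

lemma nil_scaleE:
  assumes "subspace S" "ut 0 0 0 (k * x) (k * y) (k * z) \<in> S" "k \<noteq> 0"
  shows "ut 0 0 0 x y z \<in> S"
proof -
  have "(1 / k) *\<^sub>R ut 0 0 0 (k * x) (k * y) (k * z) \<in> S" using assms subspace_scale by blast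
  then show ?thesis using assms(3) by simp
qed

text \<open>Suppose S is not a line. If some member has x and y both nonzero, S contains the centre:
  a second member either has a nonzero bracket with it or is parallel to it modulo the centre.
  Otherwise one of the coordinates x, y vanishes on all of S, since a sum would make both nonzero,
  and two independent members fill the remaining plane.\<close>

lemma nil_subspace_cases:
  assumes S: "subspace S" "S \<subseteq> nil3" and br: "\<And>X Y. X \<in> S \<Longrightarrow> Y \<in> S \<Longrightarrow> bracket X Y \<in> S"
  obtains (line) W where "W \<in> S" "S = range (\<lambda>s. s *\<^sub>R W)"
  | (mixed) x y z where "ut 0 0 0 x y z \<in> S" "x \<noteq> 0" "y \<noteq> 0" "ut 0 0 0 0 0 1 \<in> S"
  | (alpha) "S = {ut 0 0 0 x 0 z | x z. True}"
  | (beta) "S = {ut 0 0 0 0 y z | y z. True}"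
proof (cases "\<exists>W\<in>S. S \<subseteq> range (\<lambda>s. s *\<^sub>R W)")
  case True
  then obtain W where "W \<in> S" "S \<subseteq> range (\<lambda>s. s *\<^sub>R W)" by blast
  then show ?thesis using line subspace_scale[OF S(1)] by blast
next
  case False
  then have no: "\<exists>V\<in>S. V \<notin> range (\<lambda>s. s *\<^sub>R W)" if "W \<in> S" for W using that by blast
  have sum: "s *\<^sub>R V + t *\<^sub>R W \<in> S" if "V \<in> S" "W \<in> S" for s t V W
    using that subspace_add[OF S(1)] subspace_scale[OF S(1)] by blast
  show ?thesis
  proof (cases "\<exists>x y z. ut 0 0 0 x y z \<in> S \<and> x \<noteq> 0 \<and> y \<noteq> 0")
    case True
    then obtain x y z where V: "ut 0 0 0 x y z \<in> S" "x \<noteq> 0" "y \<noteq> 0" by blast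
    obtain W where W: "W \<in> S" "W \<notin> range (\<lambda>s. s *\<^sub>R ut 0 0 0 x y z)" using no[OF V(1)] by blast
    obtain x' y' z' where We: "W = ut 0 0 0 x' y' z'" using W(1) S(2) nil3E by blast
    have "ut 0 0 0 0 0 1 \<in> S"
    proof (cases "x * y' - x' * y = 0")
      case False
      have "bracket (ut 0 0 0 x y z) W \<in> S" using br V W by blast
      then have "ut 0 0 0 ((x * y' - x' * y) * 0) ((x * y' - x' * y) * 0) ((x * y' - x' * y) * 1) \<in> S"
        by (simp add: We)
      then show ?thesis by (rule nil_scaleE[OF S(1) _ False])
    next
      case True
      have y': "y' = x' / x * y" using True V(2) by (simp add: field_simps)
      have "z' - x' / x * z \<noteq> 0"
      proof
        assume "z' - x' / x * z = 0"
        then have "W = (x' / x) *\<^sub>R ut 0 0 0 x y z" using y' V(2) by (simp add: We)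
        then show False using W(2) by blast
      qed
      moreover have "1 *\<^sub>R W + (- (x' / x)) *\<^sub>R ut 0 0 0 x y z \<in> S" by (rule sum[OF W(1) V(1)])
      then have "ut 0 0 0 ((z' - x' / x * z) * 0) ((z' - x' / x * z) * 0) ((z' - x' / x * z) * 1) \<in> S"
        using V(2) y' by (simp add: We)
      ultimately show ?thesis by (metis nil_scaleE[OF S(1)])
    qed
    then show ?thesis using mixed V by blast
  next
    case nm: False
    have "0 \<in> S" by (rule subspace_0[OF S(1)])
    then obtain V where V: "V \<in> S" "V \<notin> range (\<lambda>s. s *\<^sub>R 0)" using no by blast
    obtain W where W: "W \<in> S" "W \<notin> range (\<lambda>s. s *\<^sub>R V)" using no[OF V(1)] by blast
    obtain x y z where Ve: "V = ut 0 0 0 x y z" using V(1) S(2) nil3E by blast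
    obtain x' y' z' where We: "W = ut 0 0 0 x' y' z'" using W(1) S(2) nil3E by blast
    have V0: "x \<noteq> 0 \<or> y \<noteq> 0 \<or> z \<noteq> 0" using V(2) Ve zero_ut by auto
    have "(\<forall>x y z. ut 0 0 0 x y z \<in> S \<longrightarrow> y = 0) \<or> (\<forall>x y z. ut 0 0 0 x y z \<in> S \<longrightarrow> x = 0)"
    proof (rule ccontr)
      assume "\<not> ?thesis"
      then obtain x1 y1 z1 x2 y2 z2 where *: "ut 0 0 0 x1 y1 z1 \<in> S" "y1 \<noteq> 0" "ut 0 0 0 x2 y2 z2 \<in> S" "x2 \<noteq> 0"
        by blast
      then have "x1 = 0" "y2 = 0" using nm by blast+
      moreover have "ut 0 0 0 x1 y1 z1 + ut 0 0 0 x2 y2 z2 \<in> S" using * subspace_add[OF S(1)] by blast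
      ultimately have "ut 0 0 0 x2 y1 (z1 + z2) \<in> S" by simp
      then show False using nm * by blast
    qed
    then show ?thesis
    proof
      assume y0: "\<forall>x y z. ut 0 0 0 x y z \<in> S \<longrightarrow> y = 0"
      then have yy: "y = 0" "y' = 0" using V W Ve We by blast+
      have d: "x * z' - x' * z \<noteq> 0"
      proof
        assume d: "x * z' - x' * z = 0"
        have "W = (if x = 0 then z' / z else x' / x) *\<^sub>R V"
          using d V0 yy by (auto simp: Ve We field_simps)
        then show False using W(2) by blast
      qed
      have "ut 0 0 0 p 0 q \<in> S" for p q
      proof -
        \<comment> \<open>The coefficients below are those of Cramer's rule.\<close>
        let ?d = "x * z' - x' * z"
        have "((p * z' - q * x') / ?d) *\<^sub>R V + ((q * x - p * z) / ?d) *\<^sub>R W \<in> S"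
          by (rule sum[OF V(1) W(1)])
        moreover have "(p * z' - q * x') / ?d * x + (q * x - p * z) / ?d * x' = p"
          "(p * z' - q * x') / ?d * z + (q * x - p * z) / ?d * z' = q"
          using d by (simp_all add: divide_simps) (simp_all add: algebra_simps)
        ultimately show ?thesis using yy by (simp add: Ve We)
      qed
      moreover have "\<exists>x z. P = ut 0 0 0 x 0 z" if "P \<in> S" for P
        using that S(2) y0 nil3E by (metis subsetD)
      ultimately show ?thesis by (intro alpha) blast
    next
      assume x0: "\<forall>x y z. ut 0 0 0 x y z \<in> S \<longrightarrow> x = 0"
      then have xx: "x = 0" "x' = 0" using V W Ve We by blast+
      have d: "y * z' - y' * z \<noteq> 0"
      proof
        assume d: "y * z' - y' * z = 0"
        have "W = (if y = 0 then z' / z else y' / y) *\<^sub>R V"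
          using d V0 xx by (auto simp: Ve We field_simps)
        then show False using W(2) by blast
      qed
      have "ut 0 0 0 0 p q \<in> S" for p q
      proof -
        let ?d = "y * z' - y' * z"
        have "((p * z' - q * y') / ?d) *\<^sub>R V + ((q * y - p * z) / ?d) *\<^sub>R W \<in> S"
          by (rule sum[OF V(1) W(1)])
        moreover have "(p * z' - q * y') / ?d * y + (q * y - p * z) / ?d * y' = p"
          "(p * z' - q * y') / ?d * z + (q * y - p * z) / ?d * z' = q"
          using d by (simp_all add: divide_simps) (simp_all add: algebra_simps)
        ultimately show ?thesis using xx by (simp add: Ve We)
      qed
      moreover have "\<exists>y z. P = ut 0 0 0 0 y z" if "P \<in> S" for P
        using that S(2) x0 nil3E by (metis subsetD)
      ultimately show ?thesis by (intro beta) blast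
    qed
  qed
qed

context AN_subgroup
begin

lemma u_bracket_closed: "X \<in> \<uu> \<Longrightarrow> Y \<in> \<uu> \<Longrightarrow> bracket X Y \<in> \<uu>"
  using h_bracket_u by blast

lemma u_lin: "U \<in> \<uu> \<Longrightarrow> V \<in> \<uu> \<Longrightarrow> s *\<^sub>R U + t *\<^sub>R V \<in> \<uu>"
  using subspace_add[OF subspace_u] subspace_scale[OF subspace_u] by blast

text \<open>The nilpotent part of X can be corrected modulo \<uu> to commute with the diagonal part
  D. If \<open>a = c\<close>, the root vector E is central and \<uu> + \<real>E is a subalgebra. If
  \<open>a = b\<close> or \<open>b = c\<close>, it can fail to be one; then \<uu> misses the centre
  but contains an element whose bracket with E is central and nonzero. Brackets with X then force
  the relevant entries of X and of \<uu> to vanish, and D itself lies in \<hh>.\<close>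

lemma compat_normal:
  assumes X: "ut a b c x y z \<in> \<hh>" "ut a b c x y z \<notin> nil3"
    and h: "\<And>Y. Y \<in> \<hh> \<Longrightarrow> \<exists>s. \<exists>U\<in>\<uu>. Y = s *\<^sub>R ut a b c x y z + U"
  shows "\<exists>p q r. ut a b c p q r \<in> \<hh> \<and> (p = 0 \<or> a = b) \<and> (q = 0 \<or> b = c) \<and> (r = 0 \<or> a = c)"
proof -
  have HN: "H \<inter> N_grp = mexp ` \<uu>" by (rule twisted_eq(2)[OF X h])
  have tr: "a + b + c = 0"
    using h_ut[OF X(1)] by (metis ut_eq_iff)
  have dec: "\<exists>U\<in>\<uu>. \<exists>p q r. mexp (s *\<^sub>R ut a b c x y z)
      = ut (exp (s * a)) (exp (s * b)) (exp (s * c)) 0 0 0 ** mexp U ** ut 1 1 1 p q r \<and>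
      (p = 0 \<or> a = b) \<and> (q = 0 \<or> b = c) \<and> (r = 0 \<or> a = c)" for s
  proof (rule compat_decomp[OF X(1), of s])
    fix v p q r
    assume v: "v \<in> H \<inter> N_grp" and e: "mexp (s *\<^sub>R ut a b c x y z)
      = ut (exp (s * a)) (exp (s * b)) (exp (s * c)) 0 0 0 ** v ** ut 1 1 1 p q r"
      and pqr: "p = 0 \<or> a = b" "q = 0 \<or> b = c" "r = 0 \<or> a = c"
    obtain U where "U \<in> \<uu>" "v = mexp U" using v HN by blast
    then show ?thesis using e pqr by blast
  qed
  consider "a \<noteq> b \<and> b \<noteq> c \<and> a \<noteq> c" | "a = b" "b \<noteq> c" "a \<noteq> c" | "b = c" "a \<noteq> b" "a \<noteq> c" | "a = c" "a \<noteq> b" "b \<noteq> c"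
    using X(2) tr by fastforce
  then show ?thesis
  proof cases
    case 1
    then show ?thesis using regular_mem[OF X(1)] by blast
  next
    case 4
    have "\<exists>r. ut a b c 0 0 0 + r *\<^sub>R ut 0 0 0 0 0 1 \<in> \<hh>"
    proof (rule compat_bracket_closed[OF X(1)])
      fix U assume "U \<in> \<uu>"
      then obtain x y z where "U = ut 0 0 0 x y z" using nil3E by blast
      then have "bracket U (ut 0 0 0 0 0 1) = 0 + 0 *\<^sub>R ut 0 0 0 0 0 1"
        by (simp add: zero_ut)
      then show "\<exists>U'\<in>\<uu>. \<exists>r. bracket U (ut 0 0 0 0 0 1) = U' + r *\<^sub>R ut 0 0 0 0 0 1"
        using subspace_0[OF subspace_u] by blast
    next
      fix s
      obtain U p q r where U: "U \<in> \<uu>" "mexp (s *\<^sub>R ut a b c x y z)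
        = ut (exp (s * a)) (exp (s * b)) (exp (s * c)) 0 0 0 ** mexp U ** ut 1 1 1 p q r" "p = 0" "q = 0"
        using dec[of s] 4 by blast
      moreover have "ut 1 1 1 0 0 r = mexp (r *\<^sub>R ut 0 0 0 0 0 1)" by simp
      ultimately show "\<exists>U\<in>\<uu>. \<exists>r. mexp (s *\<^sub>R ut a b c x y z)
        = ut (exp (s * a)) (exp (s * b)) (exp (s * c)) 0 0 0 ** mexp U ** mexp (r *\<^sub>R ut 0 0 0 0 0 1)" by metis
    qed simp
    then obtain r where "ut a b c 0 0 r \<in> \<hh>" by auto
    then show ?thesis using 4 by blast
  next
    case 2
    have d: "\<exists>U\<in>\<uu>. \<exists>p. mexp (s *\<^sub>R ut a b c x y z)
        = ut (exp (s * a)) (exp (s * b)) (exp (s * c)) 0 0 0 ** mexp U ** ut 1 1 1 p 0 0" for s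
      using dec[of s] 2 by blast
    show ?thesis
    proof (cases "\<forall>U\<in>\<uu>. \<exists>U'\<in>\<uu>. \<exists>r. bracket U (ut 0 0 0 1 0 0) = U' + r *\<^sub>R ut 0 0 0 1 0 0")
      case True
      have "\<exists>r. ut a b c 0 0 0 + r *\<^sub>R ut 0 0 0 1 0 0 \<in> \<hh>"
      proof (rule compat_bracket_closed[OF X(1)])
        fix s
        have "ut 1 1 1 p 0 0 = mexp (p *\<^sub>R ut 0 0 0 1 0 0)" for p by simp
        then show "\<exists>U\<in>\<uu>. \<exists>r. mexp (s *\<^sub>R ut a b c x y z)
          = ut (exp (s * a)) (exp (s * b)) (exp (s * c)) 0 0 0 ** mexp U ** mexp (r *\<^sub>R ut 0 0 0 1 0 0)"
          using d[of s] by metis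
      qed (use True in auto)
      then obtain r where "ut a b c r 0 0 \<in> \<hh>" by auto
      then show ?thesis using 2 by blast
    next
      case False
      then obtain U where U: "U \<in> \<uu>" "\<And>U' r. U' \<in> \<uu> \<Longrightarrow> bracket U (ut 0 0 0 1 0 0) \<noteq> U' + r *\<^sub>R ut 0 0 0 1 0 0"
        by blast
      obtain x' y' z' where Ue: "U = ut 0 0 0 x' y' z'" using U(1) nil3E by blast
      \<comment> \<open>The bracket of U with the root vector is central; a central element in \<uu>
        would therefore repair the failure of closure.\<close>
      have e13: "ut 0 0 0 0 0 k \<notin> \<uu>" if "k \<noteq> 0" for k
      proof
        assume "ut 0 0 0 0 0 k \<in> \<uu>"
        then have "(- y' / k) *\<^sub>R ut 0 0 0 0 0 k \<in> \<uu>" by (rule subspace_scale[OF subspace_u])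
        moreover have "bracket U (ut 0 0 0 1 0 0) = (- y' / k) *\<^sub>R ut 0 0 0 0 0 k + 0 *\<^sub>R ut 0 0 0 1 0 0"
          using that by (simp add: Ue)
        ultimately show False using U(2) by blast
      qed
      have y': "y' \<noteq> 0"
        using U(2)[OF subspace_0[OF subspace_u], of 0] by (auto simp: Ue zero_ut)
      \<comment> \<open>On the (2,3) coordinate of U the bracket with X acts as
        \<open>b - c = a - c\<close>. Subtracting this multiple of U leaves an element of \<uu>
        without that coordinate. Its bracket with U is central and must vanish, so x' = 0; the
        element is then itself central, and x = 0 follows.\<close>
      have 1: "1 *\<^sub>R bracket (ut a b c x y z) U + (- (a - c)) *\<^sub>R U \<in> \<uu>"
        by (intro u_lin U h_bracket_u X) (use U in blast)
      then have xu: "ut 0 0 0 (- (a - c) * x') 0 (x * y' - x' * y) \<in> \<uu>"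
        using 2(1) by (simp add: Ue algebra_simps)
      have x': "x' = 0"
        using u_bracket_closed[OF U(1) xu] e13[of "y' * ((a - c) * x')"] y' 2 by (auto simp: Ue algebra_simps)
      then have x0: "x = 0"
        using xu e13[of "x * y'"] y' by auto
      have all0: "V$1$2 = 0" if V: "V \<in> \<uu>" for V
      proof -
        obtain x1 y1 z1 where Ve: "V = ut 0 0 0 x1 y1 z1" using V nil3E by blast
        show ?thesis
          using u_bracket_closed[OF U(1) V] e13[of "- (x1 * y')"] y' by (auto simp: Ue Ve x')
      qed
      have "ut a b c 0 0 0 \<in> \<hh>"
      proof (rule diag_mem_hI[OF X(1)])
        fix s
        obtain V p where Vp: "V \<in> \<uu>" "mexp (s *\<^sub>R ut a b c x y z)
          = ut (exp (s * a)) (exp (s * b)) (exp (s * c)) 0 0 0 ** mexp V ** ut 1 1 1 p 0 0" using d by blast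
        have "((((**) (s *\<^sub>R ut a b c x y z)) ^^ n) (mat 1))$1$2 = 0" for n
        proof -
          \<comment> \<open>Upper triangular matrices with vanishing (1,2) entry are closed under
            multiplication, so this entry also vanishes in the exponential.\<close>
          have "\<exists>a' b' c' y' z'. (((**) (ut a b c 0 y z)) ^^ n) (mat 1) = ut a' b' c' 0 y' z'" for a b c y z
          proof (induction n)
            case (Suc n)
            then obtain a' b' c' y' z' where "(((**) (ut a b c 0 y z)) ^^ n) (mat 1) = ut a' b' c' 0 y' z'" by blast
            then show ?case by simp
          qed (simp add: mat_1_ut)
          from this[of "s * a" "s * b" "s * c" "s * y" "s * z"] show ?thesis using x0 by auto
        qed
        then have "mexp (s *\<^sub>R ut a b c x y z) $1$2 = 0" by (rule mexp_entry_0)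
        moreover obtain y1 z1 where "V = ut 0 0 0 0 y1 z1" using all0[OF Vp(1)] Vp(1) nil3E by (metis IntD2 ut_nth(2))
        ultimately have "p = 0" using Vp(2) by simp
        then have "mexp (s *\<^sub>R ut a b c x y z) = ut (exp (s * a)) (exp (s * b)) (exp (s * c)) 0 0 0 ** mexp V"
          unfolding Vp(2) by (simp flip: mat_1_ut)
        moreover have "mexp V \<in> H" using Vp(1) lie_algebraD by blast
        ultimately show "\<exists>v\<in>H. mexp (s *\<^sub>R ut a b c x y z) = ut (exp (s * a)) (exp (s * b)) (exp (s * c)) 0 0 0 ** v"
          by blast
      qed
      then show ?thesis by blast
    qed
  next
    \<comment> \<open>The mirror image of the case \<open>a = b\<close>: reflection in the
      antidiagonal exchanges the (1,2) and (2,3) entries.\<close>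
    case 3
    have d: "\<exists>U\<in>\<uu>. \<exists>p. mexp (s *\<^sub>R ut a b c x y z)
        = ut (exp (s * a)) (exp (s * b)) (exp (s * c)) 0 0 0 ** mexp U ** ut 1 1 1 0 p 0" for s
      using dec[of s] 3 by blast
    show ?thesis
    proof (cases "\<forall>U\<in>\<uu>. \<exists>U'\<in>\<uu>. \<exists>r. bracket U (ut 0 0 0 0 1 0) = U' + r *\<^sub>R ut 0 0 0 0 1 0")
      case True
      have "\<exists>r. ut a b c 0 0 0 + r *\<^sub>R ut 0 0 0 0 1 0 \<in> \<hh>"
      proof (rule compat_bracket_closed[OF X(1)])
        fix s
        have "ut 1 1 1 0 p 0 = mexp (p *\<^sub>R ut 0 0 0 0 1 0)" for p by simp
        then show "\<exists>U\<in>\<uu>. \<exists>r. mexp (s *\<^sub>R ut a b c x y z)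
          = ut (exp (s * a)) (exp (s * b)) (exp (s * c)) 0 0 0 ** mexp U ** mexp (r *\<^sub>R ut 0 0 0 0 1 0)"
          using d[of s] by metis
      qed (use True in auto)
      then obtain r where "ut a b c 0 r 0 \<in> \<hh>" by auto
      then show ?thesis using 3 by blast
    next
      case False
      then obtain U where U: "U \<in> \<uu>" "\<And>U' r. U' \<in> \<uu> \<Longrightarrow> bracket U (ut 0 0 0 0 1 0) \<noteq> U' + r *\<^sub>R ut 0 0 0 0 1 0"
        by blast
      obtain x' y' z' where Ue: "U = ut 0 0 0 x' y' z'" using U(1) nil3E by blast
      have e13: "ut 0 0 0 0 0 k \<notin> \<uu>" if "k \<noteq> 0" for k
      proof
        assume "ut 0 0 0 0 0 k \<in> \<uu>"
        then have "(x' / k) *\<^sub>R ut 0 0 0 0 0 k \<in> \<uu>" by (rule subspace_scale[OF subspace_u])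
        moreover have "bracket U (ut 0 0 0 0 1 0) = (x' / k) *\<^sub>R ut 0 0 0 0 0 k + 0 *\<^sub>R ut 0 0 0 0 1 0"
          using that by (simp add: Ue)
        ultimately show False using U(2) by blast
      qed
      have x': "x' \<noteq> 0"
        using U(2)[OF subspace_0[OF subspace_u], of 0] by (auto simp: Ue zero_ut)
      have 1: "1 *\<^sub>R bracket (ut a b c x y z) U + (- (a - b)) *\<^sub>R U \<in> \<uu>"
        by (intro u_lin U h_bracket_u X) (use U in blast)
      then have xu: "ut 0 0 0 0 (- (a - b) * y') (x * y' - x' * y) \<in> \<uu>"
        using 3(1) by (simp add: Ue algebra_simps)
      have y': "y' = 0"
        using u_bracket_closed[OF U(1) xu] e13[of "- (x' * ((a - b) * y'))"] x' 3 by (auto simp: Ue algebra_simps)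
      then have y0: "y = 0"
        using xu e13[of "- (x' * y)"] x' by auto
      have all0: "V$2$3 = 0" if V: "V \<in> \<uu>" for V
      proof -
        obtain x1 y1 z1 where Ve: "V = ut 0 0 0 x1 y1 z1" using V nil3E by blast
        show ?thesis
          using u_bracket_closed[OF U(1) V] e13[of "x' * y1"] x' by (auto simp: Ue Ve y')
      qed
      have "ut a b c 0 0 0 \<in> \<hh>"
      proof (rule diag_mem_hI[OF X(1)])
        fix s
        obtain V p where Vp: "V \<in> \<uu>" "mexp (s *\<^sub>R ut a b c x y z)
          = ut (exp (s * a)) (exp (s * b)) (exp (s * c)) 0 0 0 ** mexp V ** ut 1 1 1 0 p 0" using d by blast
        have "((((**) (s *\<^sub>R ut a b c x y z)) ^^ n) (mat 1))$2$3 = 0" for n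
        proof -
          have "\<exists>a' b' c' x' z'. (((**) (ut a b c x 0 z)) ^^ n) (mat 1) = ut a' b' c' x' 0 z'" for a b c x z
          proof (induction n)
            case (Suc n)
            then obtain a' b' c' x' z' where "(((**) (ut a b c x 0 z)) ^^ n) (mat 1) = ut a' b' c' x' 0 z'" by blast
            then show ?case by simp
          qed (simp add: mat_1_ut)
          from this[of "s * a" "s * b" "s * c" "s * x" "s * z"] show ?thesis using y0 by auto
        qed
        then have "mexp (s *\<^sub>R ut a b c x y z) $2$3 = 0" by (rule mexp_entry_0)
        moreover obtain x1 z1 where "V = ut 0 0 0 x1 0 z1" using all0[OF Vp(1)] Vp(1) nil3E by (metis IntD2 ut_nth(6))
        ultimately have "p = 0" using Vp(2) by simp
        then have "mexp (s *\<^sub>R ut a b c x y z) = ut (exp (s * a)) (exp (s * b)) (exp (s * c)) 0 0 0 ** mexp V"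
          unfolding Vp(2) by (simp flip: mat_1_ut)
        moreover have "mexp V \<in> H" using Vp(1) lie_algebraD by blast
        ultimately show "\<exists>v\<in>H. mexp (s *\<^sub>R ut a b c x y z) = ut (exp (s * a)) (exp (s * b)) (exp (s * c)) 0 0 0 ** v"
          by blast
      qed
      then show ?thesis by blast
    qed
  qed
qed

end

subsection \<open>Coarse sets\<close>

text \<open>These are the sizes of a unipotent matrix with simple-root entries proportional to s and
  free corner entry w. Taking s as the square root of the larger of p and q makes the quadratic term
  the larger size, while w supplies the smaller one. The linear term \<open>s * k\<close> is
  harmless because inside the cone the larger coordinate is at most the square of the
  smaller.\<close>

lemma coarse_unipotent:
  assumes m: "m \<noteq> 0" and k: "k \<ge> 0"
    and S: "\<And>s w. s \<ge> 0 \<Longrightarrow> (3 + s * k + \<bar>w\<bar>, 3 + s * k + \<bar>s\<^sup>2 * m - w\<bar>) \<in> S"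
  shows "coarse S"
proof -
  define M where "M = 4 + k + \<bar>m\<bar> + 1 / \<bar>m\<bar>"
  have m0: "\<bar>m\<bar> > 0" "1 / \<bar>m\<bar> > 0" using m by auto
  have M: "M > 0" "4 + k \<le> M" "4 + k + \<bar>m\<bar> \<le> M" "1 \<le> M * \<bar>m\<bar>" "1 \<le> M"
    using m0 k unfolding M_def by (linarith, linarith, linarith, simp add: distrib_right, linarith)
  have est: "3 + sqrt q * k + p \<le> M * p" "p \<le> M * (3 + sqrt q * k + p)"
    "3 + sqrt q * k + (q * \<bar>m\<bar> + p) \<le> M * q" "q \<le> M * (3 + sqrt q * k + (q * \<bar>m\<bar> + p))"
    if pq: "1 \<le> p" "p \<le> q" "q \<le> p\<^sup>2" for p q
  proof -
    have s: "0 \<le> sqrt q" "sqrt q \<le> p" "sqrt q \<le> q"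
      using pq real_sqrt_le_mono[of q "p\<^sup>2"] real_sqrt_le_mono[of q "q\<^sup>2"] by (auto simp: power2_eq_square)
    have sk: "0 \<le> sqrt q * k" "sqrt q * k \<le> p * k" "sqrt q * k \<le> q * k"
      using s k by (auto intro: mult_right_mono)
    have "3 + sqrt q * k + p \<le> (4 + k) * p" using pq sk by (simp add: algebra_simps)
    also have "\<dots> \<le> M * p" using M pq by (intro mult_right_mono) auto
    finally show "3 + sqrt q * k + p \<le> M * p" .
    have "1 * p \<le> M * (3 + sqrt q * k + p)" using M pq sk by (intro mult_mono) auto
    then show "p \<le> M * (3 + sqrt q * k + p)" by simp
    have "3 + sqrt q * k + (q * \<bar>m\<bar> + p) \<le> (4 + k + \<bar>m\<bar>) * q" using pq sk by (simp add: algebra_simps)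
    also have "\<dots> \<le> M * q" using M pq by (intro mult_right_mono) auto
    finally show "3 + sqrt q * k + (q * \<bar>m\<bar> + p) \<le> M * q" .
    have "1 * q \<le> (M * \<bar>m\<bar>) * q" using M pq by (intro mult_right_mono) auto
    also have "\<dots> = M * (q * \<bar>m\<bar>)" by simp
    also have "\<dots> \<le> M * (3 + sqrt q * k + (q * \<bar>m\<bar> + p))" using M pq sk by (intro mult_left_mono) auto
    finally show "q \<le> M * (3 + sqrt q * k + (q * \<bar>m\<bar> + p))" by simp
  qed
  have "\<exists>P Q. (P, Q) \<in> S \<and> P \<le> M * p \<and> p \<le> M * P \<and> Q \<le> M * q \<and> q \<le> M * Q" if c: "cone p q" for p q
  proof (cases "p \<le> q")
    case True
    then have pq: "1 \<le> p" "p \<le> q" "q \<le> p\<^sup>2" "1 \<le> q" using c by (auto simp: cone_def)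
    \<comment> \<open>The sign of w is opposite to that of m, so nothing cancels in the second
      size.\<close>
    have "\<bar>- sgn m * p\<bar> = p" using m pq by (simp add: abs_mult sgn_if)
    moreover have "\<bar>(sqrt q)\<^sup>2 * m - - sgn m * p\<bar> = q * \<bar>m\<bar> + p"
    proof (cases "m > 0")
      case True
      then have "0 \<le> q * m" using pq by auto
      then show ?thesis using pq True by (simp add: abs_of_nonneg)
    next
      case False
      then have m: "m < 0" using m by simp
      then have "q * m \<le> 0" using pq by (simp add: mult_nonneg_nonpos)
      then show ?thesis using pq m by simp
    qed
    ultimately have "(3 + sqrt q * k + p, 3 + sqrt q * k + (q * \<bar>m\<bar> + p)) \<in> S"
      using S[of "sqrt q" "- sgn m * p"] pq by simp
    then show ?thesis using est[OF pq(1-3)] by blast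
  next
    case False
    then have pq: "1 \<le> q" "q \<le> p" "p \<le> q\<^sup>2" "1 \<le> p" using c by (auto simp: cone_def)
    have "\<bar>p * m + sgn m * q\<bar> = p * \<bar>m\<bar> + q"
    proof (cases "m > 0")
      case True
      then have "0 \<le> p * m" using pq by auto
      then show ?thesis using pq True by (simp add: abs_of_nonneg)
    next
      case False
      then have m: "m < 0" using m by simp
      then have "p * m \<le> 0" using pq by (simp add: mult_nonneg_nonpos)
      then show ?thesis using pq m by simp
    qed
    moreover have "\<bar>(sqrt p)\<^sup>2 * m - (p * m + sgn m * q)\<bar> = q" using m pq by (simp add: abs_mult sgn_if)
    ultimately have "(3 + sqrt p * k + (p * \<bar>m\<bar> + q), 3 + sqrt p * k + q) \<in> S"
      using S[of "sqrt p" "p * m + sgn m * q"] pq by simp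
    then show ?thesis using est[OF pq(1-3)] by blast
  qed
  then show ?thesis unfolding coarse_def using M(1) by blast
qed

lemma coarse_witness:
  fixes M p q P Q :: real
  assumes "(P, Q) \<in> S" "P \<le> M * p" "p \<le> P" "Q \<le> M * q" "q \<le> Q" "1 \<le> p" "1 \<le> q" "1 \<le> M"
  shows "\<exists>P Q. (P, Q) \<in> S \<and> P \<le> M * p \<and> p \<le> M * P \<and> Q \<le> M * q \<and> q \<le> M * Q"
proof -
  have "1 * p \<le> M * P" "1 * q \<le> M * Q" using assms by (intro mult_mono; simp)+
  then show ?thesis using assms by auto
qed

lemma coarse_diagonal:
  assumes S: "\<And>a b c. a > 0 \<Longrightarrow> b > 0 \<Longrightarrow> c > 0 \<Longrightarrow> a * b * c = 1 \<Longrightarrow> (a + b + c, b * c + a * c + a * b) \<in> S"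
  shows "coarse S"
  unfolding coarse_def
proof (rule exI[of _ 3], intro conjI allI impI)
  fix p q assume "cone p q"
  then have pq: "1 \<le> p" "1 \<le> q" "p \<le> q\<^sup>2" "q \<le> p\<^sup>2" by (auto simp: cone_def)
  have "(p + q / p + 1 / q, q / p * (1 / q) + p * (1 / q) + p * (q / p)) \<in> S"
    using pq by (intro S) auto
  then have mem: "(p + q / p + 1 / q, 1 / p + p / q + q) \<in> S" using pq by simp
  have "q / p \<le> p" "p / q \<le> q"
    using pq by (auto simp: field_simps power2_eq_square)
  moreover have "1 / q \<le> 1" "1 / p \<le> 1" "0 < q / p" "0 < 1 / q" "0 < p / q" "0 < 1 / p" using pq by auto
  ultimately have bd: "p + q / p + 1 / q \<le> 3 * p" "p \<le> p + q / p + 1 / q"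
      "1 / p + p / q + q \<le> 3 * q" "q \<le> 1 / p + p / q + q"
    using pq by linarith+
  show "\<exists>P Q. (P, Q) \<in> S \<and> P \<le> 3 * p \<and> p \<le> 3 * P \<and> Q \<le> 3 * q \<and> q \<le> 3 * Q"
    by (rule coarse_witness[OF mem bd pq(1,2)]) simp
qed simp

text \<open>Here x is the root entry and c the diagonal entry at the index outside the root; in the
  adjugate x is multiplied by exp (s c). So one solves |x| = p and exp (s c) = q / p. The remaining
  exponentials must stay below p and q: c not lying strictly between a and b means, by trace 0, that
  a and b are multiples r c with -2 \<le> r \<le> 1. Hence exp (s a) and exp (s b) are at most the
  larger of q / p and (p / q)^2, which the cone bounds by p.\<close>

lemma coarse_diag_root:
  assumes abc: "a + b + c = 0" "a \<noteq> 0 \<or> b \<noteq> 0 \<or> c \<noteq> 0" and le: "0 \<le> (c - a) * (c - b)"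
    and S: "\<And>s x. (exp (s * a) + exp (s * b) + exp (s * c) + \<bar>x\<bar>,
      exp (- s * a) + exp (- s * b) + exp (- s * c) + \<bar>x\<bar> * exp (s * c)) \<in> S"
  shows "coarse S"
  unfolding coarse_def
proof (rule exI[of _ 4], intro conjI allI impI)
  fix p q assume "cone p q"
  then have pq: "1 \<le> p" "1 \<le> q" "p \<le> q\<^sup>2" "q \<le> p\<^sup>2" by (auto simp: cone_def)
  have b: "b = - a - c" using abc by simp
  have "0 \<le> (c - a) * (2 * c + a)" using le by (simp add: b algebra_simps)
  have c0: "c \<noteq> 0"
  proof
    assume "c = 0"
    then have "a * a \<le> 0" using le b by simp
    then have "a = 0" by (metis mult_eq_0_iff order_antisym zero_le_square)
    then show False using \<open>c = 0\<close> b abc(2) by simp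
  qed
  define u where "u = ln (q / p)"
  define s where "s = u / c"
  have eu: "exp u = q / p" using pq by (simp add: u_def)
  have sc: "s * c = u" using c0 by (simp add: s_def)
  have "exp (2 * u) = (q / p)\<^sup>2" using eu by (simp add: exp_double)
  then have eu2: "exp (- 2 * u) = (p / q)\<^sup>2" by (simp add: exp_minus inverse_eq_divide power_divide)
  have up: "exp u \<le> p" "exp (- 2 * u) \<le> p"
    using pq unfolding eu eu2 by (simp_all add: field_simps power2_eq_square)
  have bound: "exp (s * d) \<le> p" if "0 \<le> (c - d) * (2 * c + d)" for d
  proof -
    define r where "r = d / c"
    have "d = r * c" using c0 by (simp add: r_def)
    then have "0 \<le> c * c * ((1 - r) * (2 + r))" using that by (simp add: algebra_simps)
    moreover have "c * c > 0" using c0 by (metis not_real_square_gt_zero)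
    ultimately have "0 \<le> (1 - r) * (2 + r)" by (simp add: zero_le_mult_iff)
    then have r: "-2 \<le> r" "r \<le> 1" by (auto simp: zero_le_mult_iff)
    have "s * d = u * r" using c0 by (simp add: s_def r_def)
    moreover have "u * r \<le> u \<or> u * r \<le> - 2 * u"
    proof (cases "u \<ge> 0")
      case True
      then show ?thesis using r mult_left_mono[of r 1 u] by simp
    next
      case False
      then show ?thesis using r mult_left_mono_neg[of "-2" r u] by simp
    qed
    ultimately show ?thesis using up by (metis exp_le_cancel_iff order_trans)
  qed
  have ea: "exp (s * a) \<le> p" by (rule bound) fact
  have "0 \<le> (c - b) * (2 * c + b)" using le by (simp add: b algebra_simps)
  then have eb: "exp (s * b) \<le> p" by (rule bound)
  have ec: "exp (s * c) = q / p" "exp (- s * c) = p / q" using sc eu by (simp_all add: exp_minus)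
  have sum0: "- s * a = s * b + s * c" "- s * b = s * a + s * c"
  proof -
    have "s * a + s * b + s * c = 0" using abc(1) by (simp flip: distrib_left)
    then show "- s * a = s * b + s * c" "- s * b = s * a + s * c" by linarith+
  qed
  have ea': "exp (- s * a) \<le> q" "exp (- s * b) \<le> q"
  proof -
    have "exp (- s * a) = exp (s * b) * (q / p)" "exp (- s * b) = exp (s * a) * (q / p)"
      unfolding sum0 exp_add ec by simp_all
    moreover have "exp (s * b) * (q / p) \<le> p * (q / p)" "exp (s * a) * (q / p) \<le> p * (q / p)"
      using ea eb pq by (intro mult_right_mono; simp)+
    ultimately show "exp (- s * a) \<le> q" "exp (- s * b) \<le> q" using pq by simp_all
  qed
  have "q / p \<le> p" "p / q \<le> q" "0 < q / p" "0 < p / q"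
    using pq by (auto simp: field_simps power2_eq_square)
  moreover have "0 < exp (s * a)" "0 < exp (s * b)" "0 < exp (- s * a)" "0 < exp (- s * b)" by simp_all
  ultimately have bd: "exp (s * a) + exp (s * b) + q / p + p \<le> 4 * p" "p \<le> exp (s * a) + exp (s * b) + q / p + p"
      "exp (- s * a) + exp (- s * b) + p / q + q \<le> 4 * q" "q \<le> exp (- s * a) + exp (- s * b) + p / q + q"
    using ea eb ea' pq by linarith+
  have mem: "(exp (s * a) + exp (s * b) + q / p + p, exp (- s * a) + exp (- s * b) + p / q + q) \<in> S"
    using S[of s p] pq unfolding ec by simp
  show "\<exists>P Q. (P, Q) \<in> S \<and> P \<le> 4 * p \<and> p \<le> 4 * P \<and> Q \<le> 4 * q \<and> q \<le> 4 * Q"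
    by (rule coarse_witness[OF mem bd pq(1,2)]) simp
qed simp

text \<open>Inverts the growth e^t (1 + k t) of a Jordan block by the intermediate value theorem; at
  t = y the left side already exceeds y.\<close>

lemma exp_linear_surj:
  assumes "k \<ge> 0" "1 \<le> (y::real)"
  shows "\<exists>t\<ge>0. exp t * (1 + k * t) = y"
proof -
  have "\<exists>t\<ge>0. t \<le> y \<and> exp t * (1 + k * t) = y"
  proof (rule IVT')
    have "y \<le> exp y" using exp_ge_add_one_self[of y] by linarith
    then have "y \<le> exp y * 1" by simp
    also have "\<dots> \<le> exp y * (1 + k * y)" using assms by (intro mult_left_mono) auto
    finally show "y \<le> exp y * (1 + k * y)" .
  qed (use assms in \<open>auto intro!: continuous_intros\<close>)
  then show ?thesis by blast
qed

text \<open>For \<open>p \<le> q\<close> take \<open>a = p\<close>, \<open>b = 0\<close> and \<open>e\<^sup>t (1 + \<bar>c\<bar> t) = q / p\<close>; for \<open>q \<le> p\<close> take \<open>t \<le> 0\<close> and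
  \<open>b = a c t\<close>.\<close>

lemma coarse_jordan:
  assumes S: "\<And>t a b. (2 * exp t + exp (- 2 * t) + \<bar>c * t\<bar> * exp t + \<bar>a\<bar> + \<bar>b\<bar>,
     2 * exp (- t) + exp (2 * t) + \<bar>c * t\<bar> * exp (- t) + \<bar>a\<bar> * exp t + \<bar>a * (c * t) - b\<bar> * exp t) \<in> S"
  shows "coarse S"
  unfolding coarse_def
proof (rule exI[of _ 5], intro conjI allI impI)
  fix p q assume "cone p q"
  then have pq: "1 \<le> p" "1 \<le> q" "p \<le> q\<^sup>2" "q \<le> p\<^sup>2" by (auto simp: cone_def)
  let ?k = "\<bar>c\<bar>"
  show "\<exists>P Q. (P, Q) \<in> S \<and> P \<le> 5 * p \<and> p \<le> 5 * P \<and> Q \<le> 5 * q \<and> q \<le> 5 * Q"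
  proof (cases "p \<le> q")
    case True
    obtain t where t: "t \<ge> 0" "exp t * (1 + ?k * t) = q / p"
      using exp_linear_surj[of ?k "q / p"] pq True by auto
    have kt: "0 \<le> ?k * t" using t by simp
    have "exp t + ?k * t * exp t = q / p" "0 \<le> ?k * t * exp t"
      using t(2) mult_nonneg_nonneg[OF kt exp_ge_zero[of t]] by (simp_all add: algebra_simps)
    then have e: "exp t \<le> q / p" "?k * t * exp t \<le> q / p"
      using exp_gt_zero[of t] by linarith+
    have qp: "q / p \<le> p" "q / p \<le> q" "(q / p) * (q / p) \<le> q"
      using pq True by (auto simp: field_simps power2_eq_square intro: mult_left_mono)
    have "exp (2 * t) = exp t * exp t" by (simp flip: exp_add)
    also have "\<dots> \<le> (q / p) * (q / p)" using e pq by (intro mult_mono) auto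
    finally have e2: "exp (2 * t) \<le> q" using qp by simp
    have "exp (- t) \<le> 1" "exp (- 2 * t) \<le> 1" "exp (- t) \<le> exp t" using t by auto
    moreover then have "?k * t * exp (- t) \<le> ?k * t * exp t" using kt by (intro mult_left_mono) auto
    moreover have "\<bar>p\<bar> * exp t + \<bar>p * (c * t) - 0\<bar> * exp t = q"
    proof -
      have "\<bar>p * (c * t)\<bar> = p * (?k * t)" using pq t by (simp add: abs_mult)
      then have "\<bar>p\<bar> * exp t + \<bar>p * (c * t) - 0\<bar> * exp t = p * (exp t * (1 + ?k * t))"
        using pq by (simp add: algebra_simps)
      then show ?thesis using t(2) pq by simp
    qed
    moreover have "0 < exp t" "0 < exp (- t)" "0 < exp (2 * t)" "0 < exp (- 2 * t)" "0 \<le> ?k * t * exp t" "0 \<le> ?k * t * exp (- t)"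
      using kt by auto
    moreover have ct: "\<bar>c * t\<bar> = ?k * t" "\<bar>p\<bar> = p" "\<bar>0::real\<bar> = 0" using t pq by (simp_all add: abs_mult)
    ultimately have bd: "2 * exp t + exp (- 2 * t) + \<bar>c * t\<bar> * exp t + \<bar>p\<bar> + \<bar>0\<bar> \<le> 5 * p"
        "p \<le> 2 * exp t + exp (- 2 * t) + \<bar>c * t\<bar> * exp t + \<bar>p\<bar> + \<bar>0\<bar>"
        "2 * exp (- t) + exp (2 * t) + \<bar>c * t\<bar> * exp (- t) + \<bar>p\<bar> * exp t + \<bar>p * (c * t) - 0\<bar> * exp t \<le> 5 * q"
        "q \<le> 2 * exp (- t) + exp (2 * t) + \<bar>c * t\<bar> * exp (- t) + \<bar>p\<bar> * exp t + \<bar>p * (c * t) - 0\<bar> * exp t"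
      using e e2 qp pq unfolding ct by linarith+
    show ?thesis by (rule coarse_witness[OF S[of t p 0] bd pq(1,2)]) simp
  next
    case False
    obtain t where t: "t \<ge> 0" "exp t * (1 + ?k * t) = p / q"
      using exp_linear_surj[of ?k "p / q"] pq False by auto
    have kt: "0 \<le> ?k * t" using t by simp
    have "exp t + ?k * t * exp t = p / q" "0 \<le> ?k * t * exp t"
      using t(2) mult_nonneg_nonneg[OF kt exp_ge_zero[of t]] by (simp_all add: algebra_simps)
    then have e: "exp t \<le> p / q" "?k * t * exp t \<le> p / q"
      using exp_gt_zero[of t] by linarith+
    have qp: "p / q \<le> q" "p / q \<le> p" "(p / q) * (p / q) \<le> p"
      using pq False by (auto simp: field_simps power2_eq_square intro: mult_left_mono)
    have "exp (2 * t) = exp t * exp t" by (simp flip: exp_add)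
    also have "\<dots> \<le> (p / q) * (p / q)" using e pq by (intro mult_mono) auto
    finally have e2: "exp (2 * t) \<le> p" using qp by simp
    have "exp (- t) \<le> 1" "exp (- 2 * t) \<le> 1" "exp (- t) \<le> exp t" using t by auto
    moreover then have "?k * t * exp (- t) \<le> ?k * t * exp t" using kt by (intro mult_left_mono) auto
    moreover define a where "a = p / (1 + ?k * t)"
    have a: "a > 0" "a * (1 + ?k * t) = p" using kt pq by (auto simp: a_def)
    have "a * exp (- t) = q"
    proof -
      have "a * (1 + ?k * t) * q = exp t * (1 + ?k * t) * q * q"
        using a t(2) pq by simp
      then have "a * q = exp t * q * q" using kt by (simp add: mult.commute mult.left_commute)
      then have "a = exp t * q" using pq by simp
      then show ?thesis by (simp add: exp_minus)
    qed
    moreover have "\<bar>a\<bar> + \<bar>a * (c * - t)\<bar> = p"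
      using a t kt by (simp add: abs_mult algebra_simps)
    moreover have "0 < exp t" "0 < exp (- t)" "0 < exp (2 * t)" "0 < exp (- 2 * t)" "0 \<le> ?k * t * exp t" "0 \<le> ?k * t * exp (- t)"
      using kt by auto
    moreover have ct: "\<bar>c * - t\<bar> = ?k * t" using t by (simp add: abs_mult)
    have aa: "\<bar>a\<bar> = a" using a by simp
    ultimately have bd: "2 * exp (- t) + exp (2 * t) + \<bar>c * - t\<bar> * exp (- t) + \<bar>a\<bar> + \<bar>a * (c * - t)\<bar> \<le> 5 * p"
        "p \<le> 2 * exp (- t) + exp (2 * t) + \<bar>c * - t\<bar> * exp (- t) + \<bar>a\<bar> + \<bar>a * (c * - t)\<bar>"
        "2 * exp t + exp (- 2 * t) + \<bar>c * - t\<bar> * exp t + \<bar>a\<bar> * exp (- t) \<le> 5 * q"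
        "q \<le> 2 * exp t + exp (- 2 * t) + \<bar>c * - t\<bar> * exp t + \<bar>a\<bar> * exp (- t)"
      using e e2 qp pq a(1) unfolding ct aa by linarith+
    have mem: "(2 * exp (- t) + exp (2 * t) + \<bar>c * - t\<bar> * exp (- t) + \<bar>a\<bar> + \<bar>a * (c * - t)\<bar>,
       2 * exp t + exp (- 2 * t) + \<bar>c * - t\<bar> * exp t + \<bar>a\<bar> * exp (- t)) \<in> S"
      using S[of "- t" a "a * (c * - t)"] by simp
    show ?thesis by (rule coarse_witness[OF mem bd pq(1,2)]) simp
  qed
qed simp

subsection \<open>Sets that are not coarse\<close>

text \<open>Tested on the boundary points \<open>(p, p\<^sup>2)\<close> of the cone.\<close>

lemma not_coarse_power:
  assumes k: "0 \<le> k" "k < 2" and S: "\<And>P Q. (P, Q) \<in> S \<Longrightarrow> 0 \<le> P \<and> Q \<le> C * P powr k"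
  shows "\<not> coarse S"
proof
  assume "coarse S"
  then obtain M where M: "M > 0" "\<And>p q. cone p q \<Longrightarrow>
     \<exists>P Q. (P, Q) \<in> S \<and> P \<le> M * p \<and> p \<le> M * P \<and> Q \<le> M * q \<and> q \<le> M * Q"
    unfolding coarse_def by metis
  \<comment> \<open>The assumptions give p^2 \<le> K p^k on the tested points; p is chosen with p^(2
    - k) = K + 1 to violate this.\<close>
  define K where "K = M * (\<bar>C\<bar> * M powr k)"
  define p where "p = (K + 1) powr (1 / (2 - k))"
  have K: "0 \<le> K" using M by (simp add: K_def)
  have p: "1 \<le> p" "p powr (2 - k) = K + 1"
    using K k by (simp_all add: p_def powr_powr ge_one_powr_ge_zero)
  have "cone p (p\<^sup>2)"
    using p(1) one_le_power[OF p(1), of 2] power_increasing[of 1 4 p] p(1)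
    by (simp add: cone_def)
  then obtain P Q where PQ: "(P, Q) \<in> S" "P \<le> M * p" "p\<^sup>2 \<le> M * Q" using M(2) by blast
  have "p powr k * p powr (2 - k) = p powr 2" by (simp flip: powr_add)
  also have "\<dots> = p\<^sup>2" using p by simp
  also have "\<dots> \<le> M * Q" by (rule PQ)
  also have "\<dots> \<le> M * (\<bar>C\<bar> * P powr k)"
  proof -
    have "C * P powr k \<le> \<bar>C\<bar> * P powr k" by (intro mult_right_mono) auto
    then show ?thesis using S[OF PQ(1)] M(1) by (intro mult_left_mono) auto
  qed
  also have "\<dots> \<le> M * (\<bar>C\<bar> * (M * p) powr k)"
    using S[OF PQ(1)] PQ(2) M(1) k by (intro mult_left_mono powr_mono2) auto
  also have "\<dots> = K * p powr k" using M p by (simp add: K_def powr_mult)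
  finally have "p powr k * (K + 1) \<le> p powr k * K" unfolding p(2) by (simp add: mult.commute)
  then show False using p(1) by (simp add: mult_le_cancel_left)
qed

text \<open>Exchanging a and b and reversing s reduces to b < c < a with c \<ge> 0. For s \<ge> 0
  both |x| and exp (s a) are at most P, so |x| exp (s c) and exp (- s b) are at most P to the power
  1 + c / a; for s < 0 even Q = O(P). The exponent is below 2 precisely because c < a, so the
  quadratic edge of the cone is missed.\<close>

lemma not_coarse_diag_root:
  assumes abc: "a + b + c = 0" and lt: "(c - a) * (c - b) < 0"
    and S: "\<And>P Q. (P, Q) \<in> S \<Longrightarrow> \<exists>s x. P = exp (s * a) + exp (s * b) + exp (s * c) + \<bar>x\<bar> \<and>
      Q = exp (- s * a) + exp (- s * b) + exp (- s * c) + \<bar>x\<bar> * exp (s * c)"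
  shows "\<not> coarse S"
proof -
  have main: "\<not> coarse S" if abc: "a + b + c = 0" "b < c" "c < a" "0 \<le> c"
    and S: "\<And>P Q. (P, Q) \<in> S \<Longrightarrow> \<exists>s x. P = exp (s * a) + exp (s * b) + exp (s * c) + \<bar>x\<bar> \<and>
      Q = exp (- s * a) + exp (- s * b) + exp (- s * c) + \<bar>x\<bar> * exp (s * c)" for a b c
  proof (rule not_coarse_power[where C = 4])
    define k where "k = 1 + c / a"
    have a0: "a > 0" using abc by linarith
    show "0 \<le> 1 + c / a" "1 + c / a < 2" using abc a0 by auto
    fix P Q assume "(P, Q) \<in> S"
    then obtain s x where P: "P = exp (s * a) + exp (s * b) + exp (s * c) + \<bar>x\<bar>"
      and Q: "Q = exp (- s * a) + exp (- s * b) + exp (- s * c) + \<bar>x\<bar> * exp (s * c)" using S by blast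
    have Pge: "exp (s * a) \<le> P" "exp (s * b) \<le> P" "\<bar>x\<bar> \<le> P" "0 \<le> P"
      unfolding P by (simp_all add: add_nonneg_nonneg)
    have k1: "1 \<le> k" using abc a0 by (simp add: k_def)
    have "Q \<le> 4 * P powr k"
    proof (cases "s \<ge> 0")
      case True
      have P1: "1 \<le> P" using Pge(1) one_le_exp_iff[of "s * a"] True a0 by (meson mult_nonneg_nonneg less_imp_le order_trans)
      have Pk: "1 \<le> P powr k" using P1 k1 by (simp add: ge_one_powr_ge_zero)
      have e: "exp (- s * b) = exp (s * a) powr k"
      proof -
        have "s * a + s * b + s * c = 0" using abc(1) by (simp flip: distrib_left)
        moreover have "k * (s * a) = s * a + s * c" using a0 by (simp add: k_def field_simps)
        ultimately have "- s * b = k * (s * a)" by linarith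
        then show ?thesis by (simp add: powr_def)
      qed
      have "exp (- s * b) \<le> P powr k" unfolding e using Pge k1 by (intro powr_mono2) auto
      moreover have "exp (- s * a) \<le> 1" "exp (- s * c) \<le> 1" using True a0 abc by auto
      moreover have "\<bar>x\<bar> * exp (s * c) \<le> P powr k"
      proof -
        have "exp (s * c) = exp (s * a) powr (c / a)" using a0 by (simp add: powr_def)
        also have "\<dots> \<le> P powr (c / a)" using Pge abc a0 by (intro powr_mono2) auto
        finally have "\<bar>x\<bar> * exp (s * c) \<le> P * P powr (c / a)" using Pge by (intro mult_mono) auto
        also have "\<dots> = P powr k" using P1 by (simp add: k_def powr_add)
        finally show ?thesis .
      qed
      ultimately show ?thesis using Pk unfolding Q by linarith
    next
      case False
      then have sb: "0 \<le> s * b" using abc a0 by (intro mult_nonpos_nonpos) auto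
      then have P1: "1 \<le> P" using Pge(2) one_le_exp_iff[of "s * b"] by linarith
      have "P \<le> P powr k" using powr_mono[OF k1 P1] P1 by simp
      moreover have "- s * a \<le> s * b" "- s * c \<le> s * b"
      proof -
        have "0 \<le> - s * c" "0 \<le> - s * a" using False abc a0 by (auto simp: mult_nonpos_nonneg)
        moreover have "s * a + s * b + s * c = 0" using abc(1) by (simp flip: distrib_left)
        then have "s * b = - s * a + - s * c" by linarith
        ultimately show "- s * a \<le> s * b" "- s * c \<le> s * b" by linarith+
      qed
      then have "exp (- s * a) \<le> P" "exp (- s * c) \<le> P" using Pge(2) by (meson exp_le_cancel_iff order_trans)+
      moreover have "exp (- s * b) \<le> 1" using sb by simp
      moreover have "\<bar>x\<bar> * exp (s * c) \<le> \<bar>x\<bar> * 1" using False abc by (intro mult_left_mono) (auto simp: mult_nonpos_nonneg)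
      ultimately show ?thesis using P1 Pge unfolding Q by linarith
    qed
    then show "0 \<le> P \<and> Q \<le> 4 * P powr (1 + c / a)" using Pge by (simp add: k_def)
  qed
  have S': "\<exists>s x. P = exp (s * b) + exp (s * a) + exp (s * c) + \<bar>x\<bar> \<and>
      Q = exp (- s * b) + exp (- s * a) + exp (- s * c) + \<bar>x\<bar> * exp (s * c)" if PQ: "(P, Q) \<in> S" for P Q
  proof -
    obtain s x where "P = exp (s * a) + exp (s * b) + exp (s * c) + \<bar>x\<bar>"
      "Q = exp (- s * a) + exp (- s * b) + exp (- s * c) + \<bar>x\<bar> * exp (s * c)" using S[OF PQ] by blast
    then show ?thesis by - (rule exI[of _ s], rule exI[of _ x], simp)
  qed
  have neg: "\<exists>s x. P = exp (s * - a) + exp (s * - b) + exp (s * - c) + \<bar>x\<bar> \<and>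
      Q = exp (- s * - a) + exp (- s * - b) + exp (- s * - c) + \<bar>x\<bar> * exp (s * - c)" if PQ: "(P, Q) \<in> S" for P Q
  proof -
    obtain s x where "P = exp (s * a) + exp (s * b) + exp (s * c) + \<bar>x\<bar>"
      "Q = exp (- s * a) + exp (- s * b) + exp (- s * c) + \<bar>x\<bar> * exp (s * c)" using S[OF PQ] by blast
    then show ?thesis by - (rule exI[of _ "- s"], rule exI[of _ x], simp)
  qed
  have neg': "\<exists>s x. P = exp (s * - b) + exp (s * - a) + exp (s * - c) + \<bar>x\<bar> \<and>
      Q = exp (- s * - b) + exp (- s * - a) + exp (- s * - c) + \<bar>x\<bar> * exp (s * - c)" if PQ: "(P, Q) \<in> S" for P Q
  proof -
    obtain s x where "P = exp (s * b) + exp (s * a) + exp (s * c) + \<bar>x\<bar>"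
      "Q = exp (- s * b) + exp (- s * a) + exp (- s * c) + \<bar>x\<bar> * exp (s * c)" using S'[OF PQ] by blast
    then show ?thesis by - (rule exI[of _ "- s"], rule exI[of _ x], simp)
  qed
  have "b < c \<and> c < a \<or> a < c \<and> c < b" using lt by (auto simp: mult_less_0_iff)
  then consider "b < c" "c < a" "0 \<le> c" | "a < c" "c < b" "0 \<le> c" | "b < c" "c < a" "c \<le> 0" | "a < c" "c < b" "c \<le> 0"
    using linear[of c 0] by blast
  then show ?thesis
  proof cases
    case 1 then show ?thesis using main[of a b c] S abc by blast
  next
    case 2 then show ?thesis using main[of b a c] S' abc by (simp add: add.commute)
  next
    case 3 then show ?thesis using main[of "- b" "- a" "- c"] neg' abc by simp
  next
    case 4 then show ?thesis using main[of "- a" "- b" "- c"] neg abc by simp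
  qed
qed

text \<open>Here the edge (p, p^2) is missed only by a logarithm. For t \<ge> 0 one has Q \<le> 2
  e^t P, so Q of order p^2 with P of order p requires p = O(e^t). But P also contains |c| t e^t,
  which then bounds t and hence p. For t < 0 the bound Q = O(P) is linear.\<close>

lemma not_coarse_jordan:
  assumes c: "c \<noteq> 0"
    and S: "\<And>P Q. (P, Q) \<in> S \<Longrightarrow> \<exists>t z. P = 2 * exp t + exp (- 2 * t) + \<bar>c * t\<bar> * exp t + \<bar>z\<bar> \<and>
      Q = 2 * exp (- t) + exp (2 * t) + \<bar>c * t\<bar> * exp (- t) + \<bar>z\<bar> * exp t"
  shows "\<not> coarse S"
proof
  assume "coarse S"
  then obtain M where M: "M > 0" "\<And>p q. cone p q \<Longrightarrow>
     \<exists>P Q. (P, Q) \<in> S \<and> P \<le> M * p \<and> p \<le> M * P \<and> Q \<le> M * q \<and> q \<le> M * Q"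
    unfolding coarse_def by metis
  define k where "k = \<bar>c\<bar>"
  have k: "k > 0" using c by (simp add: k_def)
  \<comment> \<open>\<open>K1\<close> bounds p when t is negative; \<open>K2\<close> and
    \<open>K3\<close> do so when t is nonnegative, \<open>K3\<close> being the resulting bound on
    e^t. The test value p beats both bounds.\<close>
  define K1 where "K1 = M * ((3 + k) * M)"
  define K2 where "K2 = 2 * (M * M)"
  define K3 where "K3 = exp (M * K2 / k)"
  have K: "0 < K1" "0 < K2" "0 < K3" using M k by (auto simp: K1_def K2_def K3_def)
  define p where "p = 1 + K1 + K2 * K3"
  have p: "1 \<le> p" "K1 < p" "K2 * K3 < p"
    using K mult_pos_pos[OF K(2,3)] unfolding p_def by linarith+
  have "cone p (p\<^sup>2)"
    using p(1) one_le_power[OF p(1), of 2] power_increasing[of 1 4 p] p(1) by (simp add: cone_def)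
  then obtain P Q where PQ: "(P, Q) \<in> S" "P \<le> M * p" "p\<^sup>2 \<le> M * Q" using M(2) by blast
  obtain t z where P: "P = 2 * exp t + exp (- 2 * t) + \<bar>c * t\<bar> * exp t + \<bar>z\<bar>"
    and Q: "Q = 2 * exp (- t) + exp (2 * t) + \<bar>c * t\<bar> * exp (- t) + \<bar>z\<bar> * exp t"
    using S[OF PQ(1)] by blast
  show False
  proof (cases "t \<ge> 0")
    case True
    define e where "e = exp t"
    have e: "1 \<le> e" "exp (2 * t) = e * e" "exp (- t) \<le> 1" using True by (auto simp: e_def simp flip: exp_add)
    have ct: "\<bar>c * t\<bar> = k * t" using True by (simp add: k_def abs_mult)
    have kt: "0 \<le> k * t" using k True by simp
    have ee: "1 \<le> e * e" using e(1) mult_mono[of 1 e 1 e] by simp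
    have "k * t * exp (- t) \<le> k * t * (e * e)" using order_trans[OF e(3) ee] kt by (intro mult_left_mono)
    then have "Q \<le> 3 * (e * e) + k * t * (e * e) + \<bar>z\<bar> * e"
      unfolding Q e(2) ct e_def[symmetric] using order_trans[OF e(3) ee] by linarith
    also have "\<dots> \<le> 2 * e * (2 * e + k * t * e + \<bar>z\<bar>)"
    proof -
      have "0 \<le> e * e" "0 \<le> k * t * (e * e)" "0 \<le> \<bar>z\<bar> * e" using kt e by auto
      then show ?thesis by (simp add: algebra_simps)
    qed
    also have "\<dots> \<le> 2 * e * P"
      using e(1) unfolding P ct e_def[symmetric] by (intro mult_left_mono) auto
    also have "\<dots> \<le> 2 * e * (M * p)" using PQ(2) e(1) by (intro mult_left_mono) auto
    finally have "M * Q \<le> M * (2 * e * (M * p))" using M by (intro mult_left_mono) auto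
    then have "p * p \<le> (K2 * e) * p" using PQ(3) by (simp add: K2_def power2_eq_square algebra_simps)
    then have pe: "p \<le> K2 * e" using p(1) by simp
    have "k * t * e \<le> P" unfolding P ct e_def[symmetric] using e(1) by simp
    also have "\<dots> \<le> M * (K2 * e)" using PQ(2) pe M mult_left_mono[OF pe, of M] by linarith
    finally have "(k * t) * e \<le> (M * K2) * e" by (simp add: mult.assoc)
    then have "k * t \<le> M * K2" using e(1) by simp
    then have "t \<le> M * K2 / k" using k by (simp add: field_simps)
    then have "e \<le> K3" by (simp add: e_def K3_def)
    then have "K2 * e \<le> K2 * K3" using K by simp
    then show False using pe p(3) by linarith
  next
    case False
    define e where "e = exp (- t)"
    have e: "1 \<le> e" "exp (- 2 * t) = e * e" "exp (2 * t) \<le> 1" "exp t \<le> 1" using False by (auto simp: e_def simp flip: exp_add)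
    have te: "- t \<le> e" using exp_ge_add_one_self[of "- t"] by (simp add: e_def)
    have ct: "\<bar>c * t\<bar> = k * (- t)" using False by (simp add: k_def abs_mult)
    have ee: "1 \<le> e * e" "e \<le> e * e" using e(1) mult_mono[of 1 e 1 e] by auto
    have "k * (- t) * e \<le> k * e * e" using te k e by (intro mult_right_mono mult_left_mono) auto
    moreover have "\<bar>z\<bar> * exp t \<le> \<bar>z\<bar> * 1" using e by (intro mult_left_mono) auto
    ultimately have "Q \<le> 2 * (e * e) + e * e + k * (e * e) + \<bar>z\<bar>"
      unfolding Q ct e_def[symmetric] using ee e by linarith
    also have "\<dots> \<le> (3 + k) * (e * e + \<bar>z\<bar>)"
    proof -
      have "0 \<le> k * \<bar>z\<bar>" using k by simp
      then show ?thesis by (simp add: algebra_simps)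
    qed
    also have "\<dots> \<le> (3 + k) * P"
    proof -
      have "0 \<le> \<bar>c * t\<bar> * exp t" by simp
      then show ?thesis unfolding P e(2) using k by (intro mult_left_mono) auto
    qed
    also have "\<dots> \<le> (3 + k) * (M * p)" using PQ(2) k by (intro mult_left_mono) auto
    finally have "M * Q \<le> M * ((3 + k) * (M * p))" using M by (intro mult_left_mono) auto
    then have "p * p \<le> K1 * p" using PQ(3) by (simp add: K1_def power2_eq_square algebra_simps)
    then have "p \<le> K1" using p(1) by simp
    then show False using p(2) by simp
  qed
qed

text \<open>Above the stated bound the linear side is at most t^2 / 2, which exp t exceeds.\<close>

lemma exp_le_linear_bound:
  fixes t A k :: real
  assumes "0 \<le> t" "exp t \<le> A * (3 + k * t)" "0 \<le> A" "0 \<le> k"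
  shows "t \<le> 2 * A * (3 + k) + 1"
proof (rule ccontr)
  assume t: "\<not> ?thesis"
  then have t1: "1 \<le> t" using assms by (smt (verit) mult_nonneg_nonneg)
  have "A * (3 + k * t) \<le> A * ((3 + k) * t)"
    using assms t1 by (intro mult_left_mono) (auto simp: algebra_simps)
  also have "\<dots> = t * (2 * A * (3 + k)) / 2" by simp
  also have "\<dots> \<le> t * t / 2" using t t1 by (intro divide_right_mono mult_left_mono) auto
  also have "\<dots> < exp t"
    using exp_lower_Taylor_quadratic[OF assms(1)] assms(1) by (simp add: power2_eq_square)
  finally show False using assms(2) by simp
qed

text \<open>A single one-parameter group already misses the line p = q: for t \<ge> 0 one size is at
  most e^t (3 + k t) and the other at least e^(2t), so they are comparable only for bounded t.
  Negative t exchanges the two sizes.\<close>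

lemma not_coarse_jordan_line:
  assumes S: "\<And>P Q. (P, Q) \<in> S \<Longrightarrow> \<exists>t. P = 2 * exp t + exp (- 2 * t) + \<bar>c * t\<bar> * exp t \<and>
      Q = 2 * exp (- t) + exp (2 * t) + \<bar>c * t\<bar> * exp (- t)"
  shows "\<not> coarse S"
proof
  assume "coarse S"
  then obtain M where M: "M > 0" "\<And>p q. cone p q \<Longrightarrow>
     \<exists>P Q. (P, Q) \<in> S \<and> P \<le> M * p \<and> p \<le> M * P \<and> Q \<le> M * q \<and> q \<le> M * Q"
    unfolding coarse_def by metis
  define k where "k = \<bar>c\<bar>"
  have k: "k \<ge> 0" by (simp add: k_def)
  define T where "T = 2 * (M * M) * (3 + k) + 1"
  define K where "K = M * (exp T * (3 + k * T))"
  have T: "T \<ge> 0" using M k by (simp add: T_def)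
  define p where "p = 1 + K"
  have K: "0 \<le> K" using M k T by (simp add: K_def)
  have p: "1 \<le> p" "K < p" using K by (auto simp: p_def)
  have "cone p p" using p by (simp add: cone_def power2_eq_square)
  then obtain P Q where PQ: "(P, Q) \<in> S" "P \<le> M * p" "p \<le> M * P" "Q \<le> M * p" "p \<le> M * Q"
    using M(2) by blast
  obtain t where P: "P = 2 * exp t + exp (- 2 * t) + \<bar>c * t\<bar> * exp t"
    and Q: "Q = 2 * exp (- t) + exp (2 * t) + \<bar>c * t\<bar> * exp (- t)"
    using S[OF PQ(1)] by blast
  have main: False if le: "V \<le> M * p" "p \<le> M * U" and U: "U = 2 * exp \<tau> + exp (- 2 * \<tau>) + k * \<tau> * exp \<tau>"
    and V: "exp (2 * \<tau>) \<le> V" and tau: "\<tau> \<ge> 0" for U V \<tau>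
  proof -
    have kt: "0 \<le> k * \<tau>" using k tau by simp
    have "exp (- 2 * \<tau>) \<le> exp \<tau>" using tau by simp
    then have Ub: "U \<le> exp \<tau> * (3 + k * \<tau>)" unfolding U by (simp add: algebra_simps)
    have "exp \<tau> * exp \<tau> \<le> V" using V by (simp flip: exp_add)
    also have "\<dots> \<le> M * (M * U)" using le M mult_left_mono[OF le(2), of M] by linarith
    also have "\<dots> \<le> M * (M * (exp \<tau> * (3 + k * \<tau>)))" using Ub M by (intro mult_left_mono) auto
    finally have "exp \<tau> * exp \<tau> \<le> exp \<tau> * (M * M * (3 + k * \<tau>))" by (simp add: algebra_simps)
    then have "exp \<tau> \<le> M * M * (3 + k * \<tau>)" by simp
    then have tT: "\<tau> \<le> T" unfolding T_def using M k tau by (intro exp_le_linear_bound) auto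
    have "exp \<tau> * (3 + k * \<tau>) \<le> exp T * (3 + k * T)"
      using tT k tau by (intro mult_mono add_mono mult_left_mono) auto
    then have "p \<le> K" using le(2) Ub M unfolding K_def by (meson mult_left_mono less_imp_le order_trans)
    then show False using p(2) by simp
  qed
  show False
  proof (cases "t \<ge> 0")
    case True
    have "\<bar>c * t\<bar> = k * t" using True by (simp add: k_def abs_mult)
    moreover have "exp (2 * t) \<le> Q" unfolding Q by simp
    ultimately show ?thesis using main[OF PQ(4,3), of t] True unfolding P by simp
  next
    case False
    have "\<bar>c * t\<bar> = k * - t" using False by (simp add: k_def abs_mult)
    moreover have "exp (2 * - t) \<le> P" unfolding P by simp
    ultimately show ?thesis using main[OF PQ(2,5), of "- t"] False unfolding Q by simp
  qed
qed

subsection \<open>Weyl chambers\<close>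

lemma lie_a_iff: "X \<in> lie_a \<longleftrightarrow> (\<exists>a b c. X = ut a b c 0 0 0 \<and> a + b + c = 0)"
proof
  assume X: "X \<in> lie_a"
  have "A_grp \<subseteq> A_grp <#>\<^bsub>SL3\<^esub> N_grp"
    by (auto simp: AN_iff A_grp_iff)
  then obtain a b c x y z where abc: "X = ut a b c x y z" "a + b + c = 0"
    using lie_AN X unfolding lie_a_def by metis
  have "X$1$2 = 0" "X$1$3 = 0" "X$2$3 = 0"
    using X unfolding lie_a_def by (auto intro!: lie_entry simp: A_grp_def)
  then show "\<exists>a b c. X = ut a b c 0 0 0 \<and> a + b + c = 0" using abc by auto
next
  assume "\<exists>a b c. X = ut a b c 0 0 0 \<and> a + b + c = 0"
  then show "X \<in> lie_a"
    unfolding lie_a_def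
    by (auto intro!: lie_algebraI simp: A_grp_iff simp flip: exp_add distrib_left)
qed

lemma subspace_lie_a: "subspace lie_a"
  unfolding subspace_def
proof (intro conjI ballI allI)
  show "0 \<in> lie_a" by (auto simp: lie_a_iff zero_ut)
  fix x y assume "x \<in> lie_a" "y \<in> lie_a"
  then show "x + y \<in> lie_a" by (fastforce simp: lie_a_iff)
next
  fix c :: real and x assume "x \<in> lie_a"
  then obtain p q r where "x = ut p q r 0 0 0" "p + q + r = 0" by (auto simp: lie_a_iff)
  then show "c *\<^sub>R x \<in> lie_a" by (simp add: lie_a_iff flip: distrib_left)
qed

lemma all_roots_eq: "all_roots = {(1,2), (2,3), (1,3), (2,1), (3,2), (3,1)}"
  by (auto simp: all_roots_def positive_roots_def neg_root_def root_alpha_def root_beta_def root_alpha_beta_def)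

lemma root_functional_add: "root_functional \<omega> (x + y) = root_functional \<omega> x + root_functional \<omega> y"
  by (simp add: root_functional_def)

lemma root_functional_scaleR: "root_functional \<omega> (c *\<^sub>R x) = c * root_functional \<omega> x"
  by (simp add: root_functional_def right_diff_distrib)

lemma linear_root_functional: "linear (root_functional \<omega>)"
  by (rule linearI) (simp_all add: root_functional_add root_functional_scaleR)

lemma continuous_on_root_functional: "continuous_on S (root_functional \<omega>)"
  by (intro linear_continuous_on linear_root_functional[unfolded linear_conv_bounded_linear])

definition regular_a :: "mat3 set" where
  "regular_a = {X \<in> lie_a. \<forall>\<omega>\<in>all_roots. root_functional \<omega> X \<noteq> 0}"

text \<open>A chamber is described by sign agreement with a point of it, so that no enumeration of
  the six chambers occurs.\<close>

definition open_chamber :: "mat3 \<Rightarrow> mat3 set" where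
  "open_chamber x = {y \<in> lie_a. \<forall>\<omega>\<in>all_roots. root_functional \<omega> x * root_functional \<omega> y > 0}"

definition closed_chamber :: "mat3 \<Rightarrow> mat3 set" where
  "closed_chamber x = {y \<in> lie_a. \<forall>\<omega>\<in>all_roots. root_functional \<omega> x * root_functional \<omega> y \<ge> 0}"

lemma open_chamber_self: "x \<in> regular_a \<Longrightarrow> x \<in> open_chamber x"
  by (auto simp: regular_a_def open_chamber_def zero_less_mult_iff linorder_neq_iff)

lemma open_chamber_regular: "open_chamber x \<subseteq> regular_a"
  by (auto simp: regular_a_def open_chamber_def)

lemma open_chamber_scaleR:
  assumes "y \<in> open_chamber x" "t > 0"
  shows "t *\<^sub>R y \<in> open_chamber x"
proof -
  have "0 < root_functional \<omega> x * root_functional \<omega> (t *\<^sub>R y)" if "\<omega> \<in> all_roots" for \<omega>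
  proof -
    have "0 < t * (root_functional \<omega> x * root_functional \<omega> y)"
      using assms that by (simp add: open_chamber_def)
    then show ?thesis unfolding root_functional_scaleR by (simp only: mult_ac)
  qed
  then show ?thesis using assms subspace_scale[OF subspace_lie_a] by (simp add: open_chamber_def)
qed

lemma open_chamber_eq:
  assumes "y \<in> open_chamber x"
  shows "open_chamber y = open_chamber x"
proof -
  have "0 < root_functional \<omega> y * r \<longleftrightarrow> 0 < root_functional \<omega> x * r" if "\<omega> \<in> all_roots" for \<omega> r
    using assms that by (auto simp: open_chamber_def zero_less_mult_iff)
  then show ?thesis by (auto simp: open_chamber_def)
qed

lemma open_chamber_linear: "open_chamber x = lie_a \<inter> (\<Inter>\<omega>\<in>all_roots. (\<lambda>y. root_functional \<omega> x * root_functional \<omega> y) -` {0<..})"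
  by (auto simp: open_chamber_def)

lemma convex_open_chamber: "convex (open_chamber x)"
proof -
  have "linear (\<lambda>y. root_functional \<omega> x * root_functional \<omega> y)" for \<omega>
    by (rule linearI) (simp_all add: root_functional_add root_functional_scaleR algebra_simps)
  then show ?thesis unfolding open_chamber_linear
    by (intro convex_Int convex_INT subspace_imp_convex subspace_lie_a convex_linear_vimage convex_real_interval)
qed

lemma open_in_open_chamber: "openin (top_of_set lie_a) (open_chamber x)"
  unfolding open_chamber_linear
  by (intro openin_open_Int open_INT ballI open_vimage continuous_intros continuous_on_root_functional)
     (auto simp: all_roots_eq)

text \<open>The chamber is convex, hence connected; conversely a root that changes sign on a
  connected set vanishes somewhere on it.\<close>

lemma component_regular_a:
  assumes x: "x \<in> regular_a"
  shows "connected_component_set regular_a x = open_chamber x"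
proof
  show "open_chamber x \<subseteq> connected_component_set regular_a x"
    by (intro connected_component_maximal open_chamber_self x open_chamber_regular convex_connected convex_open_chamber)
  show "connected_component_set regular_a x \<subseteq> open_chamber x"
  proof
    fix y assume y: "y \<in> connected_component_set regular_a x"
    let ?C = "connected_component_set regular_a x"
    have C: "connected ?C" "?C \<subseteq> regular_a" "x \<in> ?C"
      using x by (auto simp: connected_component_subset connected_component_refl)
    have "root_functional \<omega> x * root_functional \<omega> y > 0" if w: "\<omega> \<in> all_roots" for \<omega>
    proof (rule ccontr)
      assume n: "\<not> ?thesis"
      have "connected (root_functional \<omega> ` ?C)"
        by (intro connected_continuous_image continuous_on_root_functional C)
      moreover have "root_functional \<omega> x \<in> root_functional \<omega> ` ?C" "root_functional \<omega> y \<in> root_functional \<omega> ` ?C"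
        using C(3) y by blast+
      moreover have "root_functional \<omega> x \<le> 0 \<and> 0 \<le> root_functional \<omega> y \<or> root_functional \<omega> y \<le> 0 \<and> 0 \<le> root_functional \<omega> x"
        using n by (auto simp: zero_less_mult_iff not_less)
      ultimately have "0 \<in> root_functional \<omega> ` ?C"
        by (meson atLeastAtMost_iff connected_contains_Icc subsetD)
      then show False using C(2) w by (auto simp: regular_a_def)
    qed
    then show "y \<in> open_chamber x" using y C(2) by (auto simp: open_chamber_def regular_a_def)
  qed
qed

text \<open>A small push towards the regular point x makes every weak inequality strict.\<close>

lemma closure_open_chamber:
  assumes x: "x \<in> regular_a"
  shows "closure (open_chamber x) = closed_chamber x"
proof
  have "closed_chamber x = lie_a \<inter> (\<Inter>\<omega>\<in>all_roots. {y. 0 \<le> root_functional \<omega> x * root_functional \<omega> y})"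
    by (auto simp: closed_chamber_def)
  then have "closed (closed_chamber x)"
    by (simp only:) (intro closed_Int closed_INT ballI closed_subspace subspace_lie_a closed_Collect_le
        continuous_intros continuous_on_root_functional)
  then show "closure (open_chamber x) \<subseteq> closed_chamber x"
    by (intro closure_minimal) (auto simp: open_chamber_def closed_chamber_def less_imp_le)
  show "closed_chamber x \<subseteq> closure (open_chamber x)"
  proof
    fix y assume y: "y \<in> closed_chamber x"
    have xa: "x \<in> lie_a" using x by (simp add: regular_a_def)
    have mem: "y + (1 / real (Suc n)) *\<^sub>R x \<in> open_chamber x" for n
    proof -
      have "0 < root_functional \<omega> x * root_functional \<omega> (y + (1 / real (Suc n)) *\<^sub>R x)" if w: "\<omega> \<in> all_roots" for \<omega>
      proof -
        have "0 < (1 / real (Suc n)) * (root_functional \<omega> x * root_functional \<omega> x)"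
          using x w by (auto simp: regular_a_def zero_less_mult_iff linorder_neq_iff)
        moreover have "0 \<le> root_functional \<omega> x * root_functional \<omega> y" using y w by (simp add: closed_chamber_def)
        moreover have "root_functional \<omega> x * root_functional \<omega> (y + (1 / real (Suc n)) *\<^sub>R x)
            = root_functional \<omega> x * root_functional \<omega> y + (1 / real (Suc n)) * (root_functional \<omega> x * root_functional \<omega> x)"
          unfolding root_functional_add root_functional_scaleR by (simp only: distrib_left mult_ac)
        ultimately show ?thesis by linarith
      qed
      then show ?thesis
        using y xa subspace_add[OF subspace_lie_a] subspace_scale[OF subspace_lie_a]
        by (auto simp: open_chamber_def closed_chamber_def)
    qed
    have "(\<lambda>n. y + (1 / real (Suc n)) *\<^sub>R x) \<longlonglongrightarrow> y + 0 *\<^sub>R x"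
      by (intro tendsto_intros seq_inverse_Suc)
    then show "y \<in> closure (open_chamber x)"
      using mem unfolding closure_sequential by force
  qed
qed

text \<open>An interior point stays in the closed chamber after a small push away from x; this push
  would make a vanishing root take the wrong sign.\<close>

lemma interior_closed_chamber:
  assumes x: "x \<in> regular_a"
  shows "interior_in_a (closed_chamber x) = open_chamber x"
proof
  show "open_chamber x \<subseteq> interior_in_a (closed_chamber x)"
    unfolding interior_in_a_def
    by (intro interior_of_maximal open_in_open_chamber) (auto simp: open_chamber_def closed_chamber_def less_imp_le)
  show "interior_in_a (closed_chamber x) \<subseteq> open_chamber x"
  proof
    fix y assume "y \<in> interior_in_a (closed_chamber x)"
    then obtain T where T: "openin (top_of_set lie_a) T" "y \<in> T" "T \<subseteq> closed_chamber x"
      unfolding interior_in_a_def interior_of_def by blast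
    then obtain U where U: "open U" "T = lie_a \<inter> U" by (meson openin_open)
    have ya: "y \<in> lie_a" "y \<in> U" "y \<in> closed_chamber x" using T U by auto
    have xa: "x \<in> lie_a" using x by (simp add: regular_a_def)
    have "(\<lambda>n. y + (- (1 / real (Suc n))) *\<^sub>R x) \<longlonglongrightarrow> y + (- 0) *\<^sub>R x"
      by (intro tendsto_intros seq_inverse_Suc)
    then have "\<forall>\<^sub>F n in sequentially. y + (- (1 / real (Suc n))) *\<^sub>R x \<in> U"
      using topological_tendstoD[OF _ U(1)] ya(2) by simp
    then obtain n where "y + (- (1 / real (Suc n))) *\<^sub>R x \<in> U"
      using eventually_sequentially by auto
    moreover have "y + (- (1 / real (Suc n))) *\<^sub>R x \<in> lie_a"
      by (intro subspace_add[OF subspace_lie_a] subspace_scale[OF subspace_lie_a] ya xa)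
    ultimately have m: "y + (- (1 / real (Suc n))) *\<^sub>R x \<in> closed_chamber x" using T U by blast
    have "root_functional \<omega> x * root_functional \<omega> y > 0" if w: "\<omega> \<in> all_roots" for \<omega>
    proof -
      have "0 < (1 / real (Suc n)) * (root_functional \<omega> x * root_functional \<omega> x)"
        using x w by (auto simp: regular_a_def zero_less_mult_iff linorder_neq_iff)
      moreover have "0 \<le> root_functional \<omega> x * root_functional \<omega> (y + (- (1 / real (Suc n))) *\<^sub>R x)"
        using m w by (simp add: closed_chamber_def)
      moreover have "root_functional \<omega> x * root_functional \<omega> (y + (- (1 / real (Suc n))) *\<^sub>R x)
          = root_functional \<omega> x * root_functional \<omega> y - (1 / real (Suc n)) * (root_functional \<omega> x * root_functional \<omega> x)"
        unfolding root_functional_add root_functional_scaleR by (simp only: algebra_simps)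
      ultimately show ?thesis by linarith
    qed
    then show "y \<in> open_chamber x" using ya by (simp add: open_chamber_def)
  qed
qed

lemma weyl_chambers_eq: "weyl_chambers = closed_chamber ` regular_a"
proof -
  have "components regular_a = open_chamber ` regular_a"
    using component_regular_a by (auto simp: components_def)
  then show ?thesis
    unfolding weyl_chambers_def regular_a_def[symmetric]
    by (simp add: image_image closure_open_chamber)
qed

lemma closed_chamber_eq:
  assumes "x \<in> regular_a" "z \<in> regular_a" "z \<in> closed_chamber x"
  shows "open_chamber x = open_chamber z"
proof -
  have "z \<in> open_chamber x"
    using assms by (auto simp: closed_chamber_def open_chamber_def regular_a_def less_le)
  then show ?thesis by (rule open_chamber_eq[symmetric])
qed

text \<open>For a ray through a regular point the wall alternative of \<open>is_region\<close> is
  impossible: a regular point belongs to only one closed chamber. The region is thus unique.\<close>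

lemma is_region_regular:
  assumes z: "z \<in> regular_a"
  shows "is_region {s *\<^sub>R z | s. s \<ge> 0} R \<longleftrightarrow> R = open_chamber z"
proof -
  let ?r = "{s *\<^sub>R z | s. s \<ge> 0}"
  have z0: "z \<noteq> 0" using z by (auto simp: regular_a_def all_roots_eq root_functional_def)
  have zr: "z \<in> ?r" by (auto intro!: exI[of _ 1])
  have 1: "?r - {0} \<subseteq> interior_in_a W \<and> R = interior_in_a W \<longleftrightarrow> W = closed_chamber z \<and> R = open_chamber z"
    if W: "W \<in> weyl_chambers" for W
  proof -
    obtain x where x: "W = closed_chamber x" "x \<in> regular_a" using W weyl_chambers_eq by auto
    have *: "closed_chamber x = closed_chamber z \<longleftrightarrow> open_chamber x = open_chamber z"
      using closure_open_chamber x(2) z interior_closed_chamber by metis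
    have r: "?r - {0} \<subseteq> open_chamber z"
    proof
      fix y assume "y \<in> ?r - {0}"
      then obtain s where s: "y = s *\<^sub>R z" "s \<ge> 0" "s *\<^sub>R z \<noteq> 0" by auto
      then have "s > 0" by (auto simp: less_le)
      then show "y \<in> open_chamber z"
        unfolding s(1) by (intro open_chamber_scaleR open_chamber_self[OF z])
    qed
    show ?thesis
    proof
      assume a: "?r - {0} \<subseteq> interior_in_a W \<and> R = interior_in_a W"
      then have "z \<in> open_chamber x" using zr z0 x interior_closed_chamber by blast
      then have "open_chamber x = open_chamber z" by (rule open_chamber_eq[symmetric])
      then show "W = closed_chamber z \<and> R = open_chamber z"
        using a x * interior_closed_chamber by simp
    next
      assume "W = closed_chamber z \<and> R = open_chamber z"
      then show "?r - {0} \<subseteq> interior_in_a W \<and> R = interior_in_a W"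
        using r interior_closed_chamber[OF z] by simp
    qed
  qed
  have 2: False if W: "W1 \<in> weyl_chambers" "W2 \<in> weyl_chambers" "W1 \<noteq> W2" "?r = W1 \<inter> W2" for W1 W2
  proof -
    obtain x1 x2 where x: "W1 = closed_chamber x1" "x1 \<in> regular_a" "W2 = closed_chamber x2" "x2 \<in> regular_a"
      using W(1,2) unfolding weyl_chambers_eq by blast
    have "z \<in> closed_chamber x1" "z \<in> closed_chamber x2" using zr W(4) x by auto
    then have "open_chamber x1 = open_chamber x2" using closed_chamber_eq x z by metis
    then show False using W(3) x closure_open_chamber by metis
  qed
  show ?thesis
  proof
    assume "is_region ?r R"
    then show "R = open_chamber z" unfolding is_region_def using 1 2 by blast
  next
    assume R: "R = open_chamber z"
    have "closed_chamber z \<in> weyl_chambers" using z weyl_chambers_eq by blast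
    then show "is_region ?r R" unfolding is_region_def using 1[of "closed_chamber z"] R by blast
  qed
qed

subsection \<open>The Killing form on diagonal matrices\<close>

text \<open>\<open>trace_on\<close> uses a chosen basis, so evaluating it requires a change of
  basis. Both traces equal the double sum of C-coordinates of b times B-coordinates of f c.\<close>

lemma trace_basis_independent:
  fixes f :: "'a::euclidean_space \<Rightarrow> 'a"
  assumes B: "independent B" "span B = V" and C: "independent C" "span C = V"
    and f: "linear f" "f ` V \<subseteq> V"
  shows "(\<Sum>b\<in>B. representation B (f b) b) = (\<Sum>c\<in>C. representation C (f c) c)"
proof -
  have fin: "finite B" "finite C" using B C by (auto intro: finiteI_independent)
  have BV: "b \<in> V" if "b \<in> B" for b using that B(2) span_base by blast
  have CV: "c \<in> V" if "c \<in> C" for c using that C(2) span_base by blast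
  have fV: "f v \<in> V" if "v \<in> V" for v using that f(2) by blast
  have "representation B (f b) b = (\<Sum>c\<in>C. representation C b c * representation B (f c) b)" if b: "b \<in> B" for b
  proof -
    have "b = (\<Sum>c\<in>C. representation C b c *\<^sub>R c)"
      using sum_representation_eq[OF C(1) _ fin(2) subset_refl, of b] BV[OF b] C(2) by simp
    then have "f b = f (\<Sum>c\<in>C. representation C b c *\<^sub>R c)" by simp
    also have "\<dots> = (\<Sum>c\<in>C. representation C b c *\<^sub>R f c)"
      by (simp add: linear_sum[OF f(1)] linear_cmul[OF f(1)])
    finally have "representation B (f b) b = representation B (\<Sum>c\<in>C. representation C b c *\<^sub>R f c) b" by simp
    also have "\<dots> = (\<Sum>c\<in>C. representation B (representation C b c *\<^sub>R f c) b)"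
      by (subst representation_sum[OF B(1)]) (use CV fV B(2) in \<open>auto intro!: span_scale\<close>)
    also have "\<dots> = (\<Sum>c\<in>C. representation C b c * representation B (f c) b)"
      using CV fV B by (intro sum.cong) (simp_all add: representation_scale)
    finally show ?thesis .
  qed
  then have "(\<Sum>b\<in>B. representation B (f b) b) = (\<Sum>c\<in>C. \<Sum>b\<in>B. representation C b c * representation B (f c) b)"
    by (subst sum.swap) simp
  also have "\<dots> = (\<Sum>c\<in>C. representation C (f c) c)"
  proof (rule sum.cong[OF refl])
    fix c assume c: "c \<in> C"
    have "f c = (\<Sum>b\<in>B. representation B (f c) b *\<^sub>R b)"
      using sum_representation_eq[OF B(1) _ fin(1) subset_refl, of "f c"] fV[OF CV[OF c]] B(2) by simp
    then have "representation C (f c) c = representation C (\<Sum>b\<in>B. representation B (f c) b *\<^sub>R b) c"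
      by simp
    also have "\<dots> = (\<Sum>b\<in>B. representation C (representation B (f c) b *\<^sub>R b) c)"
      by (subst representation_sum[OF C(1)]) (use BV C(2) in \<open>auto intro!: span_scale\<close>)
    also have "\<dots> = (\<Sum>b\<in>B. representation B (f c) b * representation C b c)"
      using BV C by (intro sum.cong) (simp_all add: representation_scale)
    finally show "(\<Sum>b\<in>B. representation C b c * representation B (f c) b) = representation C (f c) c"
      by (simp add: mult.commute)
  qed
  finally show ?thesis .
qed

lemma subspace_sl3: "subspace sl3"
  by (auto simp: subspace_def sl3_def trace_def sum_3 simp flip: distrib_left)

text \<open>Pass to a basis of eigenvectors extracted from the spanning set; each contributes its
  eigenvalue.\<close>

lemma trace_on_nonneg:
  assumes f: "linear f" "f ` V \<subseteq> V" and V: "subspace V"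
    and eig: "V \<subseteq> span {v \<in> V. \<exists>k\<ge>0. f v = k *\<^sub>R v}"
  shows "trace_on V f \<ge> 0"
proof -
  define B where "B = (SOME B. B \<subseteq> V \<and> independent B \<and> span B = V)"
  have "\<exists>B. B \<subseteq> V \<and> independent B \<and> span B = V"
    using basis_exists[of V] span_subspace[OF _ _ V] by metis
  then have B: "B \<subseteq> V" "independent B" "span B = V"
    unfolding B_def by (metis (mono_tags, lifting) someI_ex)+
  obtain C where C: "C \<subseteq> {v \<in> V. \<exists>k\<ge>0. f v = k *\<^sub>R v}" "independent C"
     "{v \<in> V. \<exists>k\<ge>0. f v = k *\<^sub>R v} \<subseteq> span C"
    by (rule maximal_independent_subset)
  have "span C = V"
  proof
    show "span C \<subseteq> V" using C(1) by (intro span_minimal V) auto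
    show "V \<subseteq> span C" by (rule order_trans[OF eig span_minimal[OF C(3) subspace_span]])
  qed
  then have "trace_on V f = (\<Sum>c\<in>C. representation C (f c) c)"
    unfolding trace_on_def Let_def B_def[symmetric]
    by (rule trace_basis_independent[OF B(2,3) C(2) _ f])
  also have "\<dots> \<ge> 0"
  proof (rule sum_nonneg)
    fix c assume c: "c \<in> C"
    then obtain k where k: "k \<ge> 0" "f c = k *\<^sub>R c" using C(1) by blast
    then show "0 \<le> representation C (f c) c"
      using c C(2) by (simp add: representation_scale representation_basis span_base)
  qed
  finally show ?thesis .
qed

definition unit_mat :: "3 \<Rightarrow> 3 \<Rightarrow> mat3" where
  "unit_mat i j = (\<chi> k l. if k = i \<and> l = j then 1 else 0)"

lemma unit_mat_nth [simp]: "unit_mat i j $ k $ l = (if k = i \<and> l = j then 1 else 0)"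
  by (simp add: unit_mat_def)

text \<open>For diagonal X and Y the operator is diagonalized by the matrix units, with eigenvalue
  the product of the root values at X and Y, and it kills the diagonal part of sl3. So points of one
  closed chamber have nonnegative inner product, which is the sign condition on the two
  rays.\<close>

lemma killing_form_nonneg:
  assumes X: "X \<in> lie_a" and Y: "Y \<in> lie_a"
    and le: "\<And>\<omega>. \<omega> \<in> all_roots \<Longrightarrow> root_functional \<omega> X * root_functional \<omega> Y \<ge> 0"
  shows "killing_form X Y \<ge> 0"
proof -
  obtain a b c where Xe: "X = ut a b c 0 0 0" using X lie_a_iff by auto
  obtain p q r where Ye: "Y = ut p q r 0 0 0" using Y lie_a_iff by auto
  let ?f = "\<lambda>Z. bracket X (bracket Y Z)"
  let ?E = "{v \<in> sl3. \<exists>k\<ge>0. ?f v = k *\<^sub>R v}"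
  have "linear ?f"
    by (rule linearI) (simp_all add: bracket_def mat3_eq_iff mat3_mult_nth algebra_simps)
  moreover have "?f ` sl3 \<subseteq> sl3"
    by (auto simp: sl3_def trace_def sum_3 bracket_def mat3_mult_nth algebra_simps)
  moreover have "sl3 \<subseteq> span ?E"
  proof
    fix Z assume Z: "Z \<in> sl3"
    have "0 \<le> (a - b) * (p - q)" "0 \<le> (a - c) * (p - r)" "0 \<le> (b - c) * (q - r)"
      using le[of "(1,2)"] le[of "(1,3)"] le[of "(2,3)"]
      by (auto simp: all_roots_eq root_functional_def Xe Ye)
    then have le': "0 \<le> (a - b) * (p - q)" "0 \<le> (a - c) * (p - r)" "0 \<le> (b - c) * (q - r)"
       "0 \<le> (b - a) * (q - p)" "0 \<le> (c - a) * (r - p)" "0 \<le> (c - b) * (r - q)"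
      by (simp_all add: algebra_simps)
    have u: "unit_mat i j \<in> span ?E" if "i \<noteq> j" for i j
    proof -
      have "\<forall>i j. i \<noteq> j \<longrightarrow> 0 \<le> (X$i$i - X$j$j) * (Y$i$i - Y$j$j)"
        unfolding forall_3 using le' by (simp add: Xe Ye)
      moreover have "\<forall>i j. i \<noteq> j \<longrightarrow> ?f (unit_mat i j) = ((X$i$i - X$j$j) * (Y$i$i - Y$j$j)) *\<^sub>R unit_mat i j"
        unfolding forall_3 by (simp add: Xe Ye bracket_def mat3_eq_iff mat3_mult_nth algebra_simps)
      moreover have "unit_mat i j \<in> sl3" using that by (auto simp: sl3_def trace_def intro!: sum.neutral)
      ultimately show ?thesis using that by (intro span_base) blast
    qed
    have d: "ut (Z$1$1) (Z$2$2) (Z$3$3) 0 0 0 \<in> span ?E"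
    proof (rule span_base)
      have "?f (ut (Z$1$1) (Z$2$2) (Z$3$3) 0 0 0) = 0 *\<^sub>R ut (Z$1$1) (Z$2$2) (Z$3$3) 0 0 0"
        by (simp add: Xe Ye)
      then show "ut (Z$1$1) (Z$2$2) (Z$3$3) 0 0 0 \<in> ?E"
        using Z by (auto simp: sl3_def trace_def sum_3)
    qed
    have "Z = ut (Z$1$1) (Z$2$2) (Z$3$3) 0 0 0 + Z$1$2 *\<^sub>R unit_mat 1 2 + Z$1$3 *\<^sub>R unit_mat 1 3 + Z$2$3 *\<^sub>R unit_mat 2 3
       + Z$2$1 *\<^sub>R unit_mat 2 1 + Z$3$1 *\<^sub>R unit_mat 3 1 + Z$3$2 *\<^sub>R unit_mat 3 2"
      by (simp add: mat3_eq_iff)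
    also have "\<dots> \<in> span ?E"
      by (intro span_add span_scale u d) auto
    finally show "Z \<in> span ?E" .
  qed
  ultimately show ?thesis
    unfolding killing_form_def by (intro trace_on_nonneg subspace_sl3)
qed

subsection \<open>The region attached to a root and a line\<close>

definition coroot :: "root \<Rightarrow> mat3" where
  "coroot \<omega> = unit_mat (fst \<omega>) (fst \<omega>) - unit_mat (snd \<omega>) (snd \<omega>)"

lemma root_space_eq: "root_space \<omega> = range (\<lambda>s. s *\<^sub>R unit_mat (fst \<omega>) (snd \<omega>))"
proof
  show "root_space \<omega> \<subseteq> range (\<lambda>s. s *\<^sub>R unit_mat (fst \<omega>) (snd \<omega>))"
  proof
    fix X assume X: "X \<in> root_space \<omega>"
    have "X = (X $ fst \<omega> $ snd \<omega>) *\<^sub>R unit_mat (fst \<omega>) (snd \<omega>)"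
      using X by (cases \<omega>) (auto simp: root_space_def vec_eq_iff)
    then show "X \<in> range (\<lambda>s. s *\<^sub>R unit_mat (fst \<omega>) (snd \<omega>))" by blast
  qed
qed (auto simp: root_space_def)

lemma unit_mat_mult: "unit_mat i j ** unit_mat k l = (if j = k then unit_mat i l else 0)"
proof -
  have "(unit_mat i j ** unit_mat k l) $ p $ q = (if j = k then unit_mat i l else 0) $ p $ q" for p q
    using exhaust_3[of j] by (auto simp: mat3_mult_nth)
  then show ?thesis by (simp add: vec_eq_iff)
qed

lemma coroot_eq: "coroot (1,2) = ut 1 (-1) 0 0 0 0" "coroot (2,3) = ut 0 1 (-1) 0 0 0"
    "coroot (1,3) = ut 1 0 (-1) 0 0 0"
  by (simp_all add: coroot_def mat3_eq_iff)

lemma positive_roots_eq: "positive_roots = {(1,2), (2,3), (1,3)}"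
  by (simp add: positive_roots_def root_alpha_def root_beta_def root_alpha_beta_def)

lemma coroot_regular: "\<omega> \<in> positive_roots \<Longrightarrow> coroot \<omega> \<in> regular_a"
  by (auto simp: positive_roots_eq coroot_eq regular_a_def lie_a_iff all_roots_eq root_functional_def)

lemma coroot_line_eq:
  assumes "\<omega> \<in> positive_roots"
  shows "coroot_line \<omega> = range (\<lambda>s. s *\<^sub>R coroot \<omega>)"
proof -
  have br: "bracket (s *\<^sub>R unit_mat (fst \<omega>) (snd \<omega>)) (t *\<^sub>R unit_mat (snd \<omega>) (fst \<omega>)) = (s * t) *\<^sub>R coroot \<omega>" for s t
  proof -
    have "bracket (s *\<^sub>R P) (t *\<^sub>R Q) = (s * t) *\<^sub>R (P ** Q - Q ** P)" for P Q :: mat3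
      by (simp add: bracket_def mat3_eq_iff mat3_mult_nth algebra_simps)
    then show ?thesis by (simp add: unit_mat_mult coroot_def)
  qed
  have "{bracket X Y | X Y. X \<in> root_space \<omega> \<and> Y \<in> root_space (neg_root \<omega>)} = range (\<lambda>s. s *\<^sub>R coroot \<omega>)"
    unfolding root_space_eq neg_root_def fst_conv snd_conv
  proof (intro subset_antisym subsetI)
    fix x assume "x \<in> range (\<lambda>s. s *\<^sub>R coroot \<omega>)"
    then obtain s where "x = s *\<^sub>R coroot \<omega>" by blast
    then have "x = bracket (s *\<^sub>R unit_mat (fst \<omega>) (snd \<omega>)) (1 *\<^sub>R unit_mat (snd \<omega>) (fst \<omega>))"
      using br[of s 1] by simp
    then show "x \<in> {bracket X Y |X Y. X \<in> range (\<lambda>s. s *\<^sub>R unit_mat (fst \<omega>) (snd \<omega>)) \<and> Y \<in> range (\<lambda>s. s *\<^sub>R unit_mat (snd \<omega>) (fst \<omega>))}"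
      by blast
  qed (use br in auto)
  moreover have "range (\<lambda>s. s *\<^sub>R coroot \<omega>) = span {coroot \<omega>}"
    by (simp add: span_singleton)
  moreover have "span {coroot \<omega>} \<subseteq> lie_a"
    using coroot_regular[OF assms] by (intro span_minimal subspace_lie_a) (auto simp: regular_a_def)
  ultimately show ?thesis unfolding coroot_line_def by (simp add: span_span inf.absorb1)
qed

text \<open>The coroot is regular, so the region is the open chamber of the chosen ray on its line.
  Conversely, when s D is in the chamber of the coroot, all roots have equal signs on the two, so
  the condition on inner products is automatic.\<close>

lemma line_in_region_iff_chamber:
  assumes w: "\<omega> \<in> positive_roots" and D: "D \<noteq> 0"
  shows "line_in_region \<omega> (range (\<lambda>s. s *\<^sub>R D)) \<longleftrightarrow> (\<exists>s. s *\<^sub>R D \<in> open_chamber (coroot \<omega>))"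
proof
  assume "line_in_region \<omega> (range (\<lambda>s. s *\<^sub>R D))"
  then obtain tp ap R where *: "ray_in tp (range (\<lambda>s. s *\<^sub>R D))" "ray_in ap (coroot_line \<omega>)"
     "is_region ap R" "tp - {0} \<subseteq> R" unfolding line_in_region_def by blast
  obtain s where s: "s *\<^sub>R D \<noteq> 0" "tp = {t *\<^sub>R s *\<^sub>R D | t. t \<ge> 0}" using *(1) unfolding ray_in_def by blast
  obtain r where r: "r *\<^sub>R coroot \<omega> \<noteq> 0" "ap = {t *\<^sub>R r *\<^sub>R coroot \<omega> | t. t \<ge> 0}"
    using *(2) unfolding ray_in_def coroot_line_eq[OF w] by blast
  have r0: "r \<noteq> 0" using r by auto
  have cr: "coroot \<omega> \<in> regular_a" by (rule coroot_regular[OF w])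
  have "r *\<^sub>R coroot \<omega> \<in> regular_a"
    using cr r0 subspace_scale[OF subspace_lie_a] by (auto simp: regular_a_def root_functional_scaleR)
  then have R: "R = open_chamber (r *\<^sub>R coroot \<omega>)"
    using *(3) is_region_regular unfolding r(2) by blast
  have "s *\<^sub>R D \<in> tp - {0}" using s by (auto intro!: exI[of _ 1])
  then have "s *\<^sub>R D \<in> open_chamber (r *\<^sub>R coroot \<omega>)" using *(4) R by blast
  \<comment> \<open>For negative r this reverses both rays at once.\<close>
  then have "(r * s) *\<^sub>R D \<in> open_chamber (coroot \<omega>)"
    using subspace_scale[OF subspace_lie_a, of "s *\<^sub>R D" r]
    by (auto simp: open_chamber_def root_functional_scaleR mult_ac)
  then show "\<exists>s. s *\<^sub>R D \<in> open_chamber (coroot \<omega>)" by blast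
next
  assume "\<exists>s. s *\<^sub>R D \<in> open_chamber (coroot \<omega>)"
  then obtain s where s: "s *\<^sub>R D \<in> open_chamber (coroot \<omega>)" by blast
  have cr: "coroot \<omega> \<in> regular_a" by (rule coroot_regular[OF w])
  have ne: "s *\<^sub>R D \<noteq> 0" "coroot \<omega> \<noteq> 0"
    using s cr by (auto simp: open_chamber_def regular_a_def all_roots_eq root_functional_def)
  let ?tp = "{t *\<^sub>R s *\<^sub>R D | t. t \<ge> 0}" and ?ap = "{t *\<^sub>R coroot \<omega> | t. t \<ge> 0}"
  have "ray_in ?tp (range (\<lambda>s. s *\<^sub>R D))" unfolding ray_in_def using ne by blast
  moreover have "coroot \<omega> \<in> coroot_line \<omega>" unfolding coroot_line_eq[OF w] by (metis rangeI scaleR_one)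
  then have "ray_in ?ap (coroot_line \<omega>)" unfolding ray_in_def using ne by blast
  moreover have "killing_form t a \<ge> 0" if ta: "t \<in> ?tp" "a \<in> ?ap" for t a
  proof -
    obtain u v where uv: "t = u *\<^sub>R s *\<^sub>R D" "a = v *\<^sub>R coroot \<omega>" "u \<ge> 0" "v \<ge> 0" using ta by blast
    show ?thesis unfolding uv
    proof (rule killing_form_nonneg)
      show "u *\<^sub>R s *\<^sub>R D \<in> lie_a" "v *\<^sub>R coroot \<omega> \<in> lie_a"
        by (rule subspace_scale[OF subspace_lie_a], use s cr in \<open>simp add: open_chamber_def regular_a_def\<close>)+
      fix \<omega>' assume "\<omega>' \<in> all_roots"
      then have "0 < root_functional \<omega>' (coroot \<omega>) * root_functional \<omega>' (s *\<^sub>R D)"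
        using s by (simp add: open_chamber_def)
      then have "0 \<le> (u * v) * (root_functional \<omega>' (coroot \<omega>) * root_functional \<omega>' (s *\<^sub>R D))"
        by (intro mult_nonneg_nonneg[OF mult_nonneg_nonneg[OF uv(3,4)]] less_imp_le)
      then show "0 \<le> root_functional \<omega>' (u *\<^sub>R s *\<^sub>R D) * root_functional \<omega>' (v *\<^sub>R coroot \<omega>)"
        unfolding root_functional_scaleR[of _ u] root_functional_scaleR[of _ v] by (simp only: mult_ac)
    qed
  qed
  moreover have "is_region ?ap (open_chamber (coroot \<omega>))" using is_region_regular[OF cr] by blast
  moreover have "?tp - {0} \<subseteq> open_chamber (coroot \<omega>)"
  proof
    fix y assume "y \<in> ?tp - {0}"
    then obtain t where t: "y = t *\<^sub>R s *\<^sub>R D" "t \<ge> 0" "t *\<^sub>R s *\<^sub>R D \<noteq> 0" by auto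
    then have "t > 0" by (auto simp: less_le)
    then show "y \<in> open_chamber (coroot \<omega>)"
      unfolding t(1) by (intro open_chamber_scaleR s)
  qed
  ultimately show "line_in_region \<omega> (range (\<lambda>s. s *\<^sub>R D))"
    unfolding line_in_region_def by blast
qed

lemma line_in_region_roots:
  fixes a b c :: real
  assumes tr: "a + b + c = 0" and ne: "a \<noteq> 0 \<or> b \<noteq> 0 \<or> c \<noteq> 0"
  defines "L \<equiv> range (\<lambda>s. s *\<^sub>R ut a b c 0 0 0)"
  shows "line_in_region (1,2) L \<longleftrightarrow> (c - a) * (c - b) < 0"
    and "line_in_region (2,3) L \<longleftrightarrow> (a - b) * (a - c) < 0"
    and "line_in_region (1,3) L \<longleftrightarrow> (b - a) * (b - c) < 0"
proof -
  have D: "ut a b c 0 0 0 \<noteq> 0" using ne by (simp add: zero_ut)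
  have la: "ut (s * a) (s * b) (s * c) 0 0 0 \<in> lie_a" for s
    using tr by (auto simp: lie_a_iff simp flip: distrib_left)
  \<comment> \<open>The scalar s may have either sign, so both orders x > z > y and x < z < y are
    covered.\<close>
  have between: "(\<exists>s. 0 < s * x - s * y \<and> 0 < s * z - s * y \<and> 0 < s * x - s * z) \<longleftrightarrow> (z - x) * (z - y) < 0" for x y z :: real
  proof
    assume "\<exists>s. 0 < s * x - s * y \<and> 0 < s * z - s * y \<and> 0 < s * x - s * z"
    then obtain s where s: "0 < s * (z - y)" "0 < s * (x - z)" by (auto simp: algebra_simps)
    then have "0 < (s * (z - y)) * (s * (x - z))" by (rule mult_pos_pos)
    then have "0 < (s * s) * ((z - y) * (x - z))" by (simp only: mult_ac)
    then have "0 < (z - y) * (x - z)" by (simp add: zero_less_mult_iff mult_less_0_iff)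
    then show "(z - x) * (z - y) < 0" by (simp add: algebra_simps)
  next
    assume "(z - x) * (z - y) < 0"
    then have "x < z \<and> z < y \<or> y < z \<and> z < x" by (auto simp: mult_less_0_iff)
    then show "\<exists>s. 0 < s * x - s * y \<and> 0 < s * z - s * y \<and> 0 < s * x - s * z"
      by (elim disjE) (rule exI[of _ "-1"], simp, rule exI[of _ 1], simp)
  qed
  have "(1,2) \<in> positive_roots" "(2,3) \<in> positive_roots" "(1,3) \<in> positive_roots"
    by (simp_all add: positive_roots_eq)
  note iff = this[THEN line_in_region_iff_chamber, OF D]
  have oc: "s *\<^sub>R ut a b c 0 0 0 \<in> open_chamber (coroot (1,2)) \<longleftrightarrow>
      0 < s * a - s * b \<and> 0 < s * c - s * b \<and> 0 < s * a - s * c"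
    "s *\<^sub>R ut a b c 0 0 0 \<in> open_chamber (coroot (2,3)) \<longleftrightarrow>
      0 < s * b - s * c \<and> 0 < s * a - s * c \<and> 0 < s * b - s * a"
    "s *\<^sub>R ut a b c 0 0 0 \<in> open_chamber (coroot (1,3)) \<longleftrightarrow>
      0 < s * a - s * c \<and> 0 < s * b - s * c \<and> 0 < s * a - s * b" for s
    using la by (auto simp: open_chamber_def coroot_eq all_roots_eq root_functional_def)
  show "line_in_region (1,2) L \<longleftrightarrow> (c - a) * (c - b) < 0"
    unfolding L_def iff oc between ..
  show "line_in_region (2,3) L \<longleftrightarrow> (a - b) * (a - c) < 0"
    unfolding L_def iff oc between ..
  show "line_in_region (1,3) L \<longleftrightarrow> (b - a) * (b - c) < 0"
    unfolding L_def iff oc between ..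
qed

lemma lie_algebra_one_parameter:
  assumes "X \<in> lie_a"
  shows "lie_algebra (range (\<lambda>s. mexp (s *\<^sub>R X))) = range (\<lambda>s. s *\<^sub>R X)"
proof (intro subset_antisym subsetI)
  obtain a b c where X: "X = ut a b c 0 0 0" "a + b + c = 0" using assms lie_a_iff by auto
  let ?T = "range (\<lambda>s. mexp (s *\<^sub>R X))"
  fix Y assume Y: "Y \<in> lie_algebra ?T"
  have "?T \<subseteq> A_grp"
    using X(2) by (auto simp: X A_grp_iff simp flip: exp_add distrib_left)
  then have "Y \<in> lie_a" using Y lie_algebra_mono unfolding lie_a_def by blast
  then obtain p q r where Ye: "Y = ut p q r 0 0 0" using lie_a_iff by auto
  have "mexp Y \<in> ?T" using Y by (rule lie_algebraD)
  then show "Y \<in> range (\<lambda>s. s *\<^sub>R X)" by (auto simp: X Ye)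
next
  fix Y assume "Y \<in> range (\<lambda>s. s *\<^sub>R X)"
  then obtain s where "Y = s *\<^sub>R X" by blast
  then have e: "mexp (t *\<^sub>R Y) = mexp ((t * s) *\<^sub>R X)" for t by simp
  show "Y \<in> lie_algebra (range (\<lambda>s. mexp (s *\<^sub>R X)))"
    by (rule lie_algebraI, unfold e) blast
qed

subsection \<open>Semidirect decompositions\<close>

lemma subgroup_A_grp: "subgroup A_grp SL3"
  unfolding subgroup_SL3_iff
proof (intro conjI ballI)
  fix M assume "M \<in> A_grp"
  then obtain a b c where M: "M = ut a b c 0 0 0" "a > 0" "b > 0" "c > 0" "a * b * c = 1"
    unfolding A_grp_iff by blast
  show "det M = 1" using M by simp
  have "(b * c) * (a * c) * (a * b) = (a * b * c) * (a * b * c)" by (simp only: mult_ac)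
  then show "adj M \<in> A_grp" using M unfolding A_grp_iff by auto
next
  fix x y assume "x \<in> A_grp" "y \<in> A_grp"
  then obtain a b c a' b' c' where "x = ut a b c 0 0 0" "a > 0" "b > 0" "c > 0" "a * b * c = 1"
    "y = ut a' b' c' 0 0 0" "a' > 0" "b' > 0" "c' > 0" "a' * b' * c' = 1"
    unfolding A_grp_iff by blast
  moreover have "(a * a') * (b * b') * (c * c') = (a * b * c) * (a' * b' * c')" by (simp only: mult_ac)
  ultimately show "x ** y \<in> A_grp" unfolding A_grp_iff by auto
qed (simp add: A_grp_iff mat_1_ut)

lemma subgroup_Int_SL3: "subgroup H SL3 \<Longrightarrow> subgroup K SL3 \<Longrightarrow> subgroup (H \<inter> K) SL3"
  by (auto simp: subgroup_SL3_iff)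

lemma subgroup_one_parameter:
  assumes "X \<in> lie_a"
  shows "subgroup (range (\<lambda>s. mexp (s *\<^sub>R X))) SL3"
proof -
  obtain a b c where X: "X = ut a b c 0 0 0" "a + b + c = 0" using assms lie_a_iff by auto
  have d: "det (mexp (s *\<^sub>R X)) = 1" for s
    using X(2) by (simp add: X flip: exp_add distrib_left)
  have adj: "adj (mexp (s *\<^sub>R X)) = mexp (- s *\<^sub>R X)" for s
    using adj_mexp[OF d[of s]] by simp
  have one: "mat 1 = mexp (0 *\<^sub>R X)" by simp
  have mult: "mexp (s *\<^sub>R X) ** mexp (t *\<^sub>R X) = mexp ((s + t) *\<^sub>R X)" for s t
    by (rule mexp_add_scaleR[symmetric])
  show ?thesis
    unfolding subgroup_SL3_iff
  proof (intro conjI ballI)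
    show "mat 1 \<in> range (\<lambda>s. mexp (s *\<^sub>R X))" unfolding one by blast
  next
    fix M assume "M \<in> range (\<lambda>s. mexp (s *\<^sub>R X))"
    then obtain s where M: "M = mexp (s *\<^sub>R X)" by blast
    show "det M = 1" unfolding M by (rule d)
    show "adj M \<in> range (\<lambda>s. mexp (s *\<^sub>R X))" unfolding M adj by blast
  next
    fix x y assume "x \<in> range (\<lambda>s. mexp (s *\<^sub>R X))" "y \<in> range (\<lambda>s. mexp (s *\<^sub>R X))"
    then obtain s t where xy: "x = mexp (s *\<^sub>R X)" "y = mexp (t *\<^sub>R X)" by blast
    show "x ** y \<in> range (\<lambda>s. mexp (s *\<^sub>R X))" unfolding xy mult by blast
  qed
qed

context AN_subgroup
begin

lemma subgroup_H: "subgroup H SL3"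
  using closed by (simp add: closed_subgroup_iff)

text \<open>N is normalized by every upper triangular matrix and meets A only in the identity, so
  the whole content is the factorization of each element.\<close>

lemma internal_semidirect_N:
  assumes T: "subgroup T SL3" "T \<subseteq> H" "T \<subseteq> A_grp"
    and dec: "\<And>h. h \<in> H \<Longrightarrow> \<exists>t\<in>T. \<exists>n\<in>H \<inter> N_grp. h = t ** n"
  shows "internal_semidirect H T (H \<inter> N_grp)"
proof -
  interpret G: group SL3 by (rule group_SL3)
  interpret K: group "SL3\<lparr>carrier := H\<rparr>"
    by (rule G.subgroup_imp_group[OF subgroup_H])
  have N: "subgroup N_grp SL3"
    unfolding subgroup_SL3_iff by (intro conjI ballI) (auto simp: mat_1_ut N_grp_iff)
  have U: "subgroup (H \<inter> N_grp) SL3" by (rule subgroup_Int_SL3[OF subgroup_H N])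
  have "H \<inter> N_grp \<lhd> SL3\<lparr>carrier := H\<rparr>"
    unfolding K.normal_inv_iff
  proof (intro conjI ballI)
    show "subgroup (H \<inter> N_grp) (SL3\<lparr>carrier := H\<rparr>)"
      by (rule G.subgroup_incl[OF U subgroup_H]) simp
    fix x h assume x: "x \<in> carrier (SL3\<lparr>carrier := H\<rparr>)" and h: "h \<in> H \<inter> N_grp"
    then have xH: "x \<in> H" by simp
    have "inv\<^bsub>SL3\<lparr>carrier := H\<rparr>\<^esub> x = adj x"
      using G.m_inv_consistent[OF subgroup_H xH] inv_SL3[OF mem(1)[OF xH]] by simp
    moreover have "x ** h ** adj x \<in> H" by (rule mem(3)[OF mem(3)[OF xH IntD1[OF h]] mem(2)[OF xH]])
    moreover have "x ** h ** adj x \<in> N_grp"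
    proof -
      obtain a b c p q r where xe: "x = ut a b c p q r" "a * b * c = 1" using xH AN AN_iff by blast
      obtain u v w where he: "h = ut 1 1 1 u v w" using h N_grp_iff by auto
      have "b * (a * c) = 1" "c * (a * b) = 1" "a * (b * c) = 1" using xe(2) by (simp_all add: mult_ac)
      then show ?thesis unfolding xe he N_grp_iff by simp
    qed
    ultimately show "x \<otimes>\<^bsub>SL3\<lparr>carrier := H\<rparr>\<^esub> h \<otimes>\<^bsub>SL3\<lparr>carrier := H\<rparr>\<^esub> inv\<^bsub>SL3\<lparr>carrier := H\<rparr>\<^esub> x \<in> H \<inter> N_grp"
      by simp
  qed
  moreover have "subgroup T (SL3\<lparr>carrier := H\<rparr>)" by (rule G.subgroup_incl[OF T(1) subgroup_H T(2)])
  moreover have "T \<inter> (H \<inter> N_grp) = {mat 1}"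
  proof
    show "T \<inter> (H \<inter> N_grp) \<subseteq> {mat 1}" using T(3) by (force simp: A_grp_iff N_grp_iff mat_1_ut)
    show "{mat 1} \<subseteq> T \<inter> (H \<inter> N_grp)" using T(1) U by (simp add: subgroup_SL3_iff)
  qed
  moreover have "H = T <#>\<^bsub>SL3\<^esub> (H \<inter> N_grp)"
    using dec T(2) mem(3) unfolding set_mult_SL3 by blast
  ultimately show ?thesis unfolding internal_semidirect_def using subgroup_H by blast
qed

lemma internal_semidirect_A_N:
  assumes "\<And>h. h \<in> H \<Longrightarrow> \<exists>t\<in>H \<inter> A_grp. \<exists>n\<in>H \<inter> N_grp. h = t ** n"
  shows "internal_semidirect H (H \<inter> A_grp) (H \<inter> N_grp)"
  by (rule internal_semidirect_N[OF subgroup_Int_SL3[OF subgroup_H subgroup_A_grp] _ _ assms]) auto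

lemma semidirect_nil:
  assumes "\<hh> \<subseteq> nil3"
  shows "internal_semidirect H (H \<inter> A_grp) (H \<inter> N_grp)"
proof (rule internal_semidirect_A_N)
  fix h assume h: "h \<in> H"
  then have "h \<in> N_grp" using unipotent_eq[OF assms] assms N_grp_mexp by blast
  moreover have "mat 1 \<in> H \<inter> A_grp" using mem(4) subgroup_A_grp by (simp add: subgroup_SL3_iff)
  moreover have "h = mat 1 ** h" by simp
  ultimately show "\<exists>t\<in>H \<inter> A_grp. \<exists>n\<in>H \<inter> N_grp. h = t ** n" using h by blast
qed

lemma full_A:
  assumes full: "\<And>a b c. a + b + c = 0 \<Longrightarrow> ut a b c 0 0 0 \<in> \<hh>" and pos: "a > 0" "b > 0" "c > 0" "a * b * c = 1"
  shows "ut a b c 0 0 0 \<in> H"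
proof -
  have "ln a + ln b + ln c = 0" using pos by (simp flip: ln_mult_pos)
  then have "mexp (ut (ln a) (ln b) (ln c) 0 0 0) \<in> H" by (intro lie_algebraD full)
  then show ?thesis using pos by simp
qed

lemma semidirect_full:
  assumes full: "\<And>a b c. a + b + c = 0 \<Longrightarrow> ut a b c 0 0 0 \<in> \<hh>"
  shows "internal_semidirect H (H \<inter> A_grp) (H \<inter> N_grp)"
proof (rule internal_semidirect_A_N)
  fix h assume h: "h \<in> H"
  then obtain a b c x y z where he: "h = ut a b c x y z" "a > 0" "b > 0" "c > 0" "a * b * c = 1"
    using AN AN_iff by blast
  let ?t = "ut a b c 0 0 0"
  have t: "?t \<in> H \<inter> A_grp" using full_A[OF full he(2-5)] he by (auto simp: A_grp_iff)
  have "adj ?t ** h \<in> H" by (rule mem(3)[OF mem(2)[OF IntD1[OF t]] h])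
  moreover have "b * c * a = 1" "a * c * b = 1" using he(5) by (simp_all add: mult_ac)
  then have "adj ?t ** h \<in> N_grp" using he(5) unfolding he(1) N_grp_iff by simp
  moreover have "h = ?t ** (adj ?t ** h)"
    using he(5) by (simp add: matrix_mul_assoc mult_adj del: ut_mult adj_ut)
  ultimately show "\<exists>t\<in>H \<inter> A_grp. \<exists>n\<in>H \<inter> N_grp. h = t ** n" using t by blast
qed

end

subsection \<open>The structure of the Lie algebra\<close>

lemma dim_le_1_range:
  assumes "subspace S" "dim S \<le> 1"
  obtains W where "S = range (\<lambda>s::real. s *\<^sub>R (W::'a::euclidean_space))" "dim S = 1 \<Longrightarrow> W \<noteq> 0"
proof -
  obtain B where B: "B \<subseteq> S" "independent B" "S \<subseteq> span B" "card B = dim S"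
    using basis_exists[of S] by metis
  have sp: "span B = S" using B assms(1) span_subspace by blast
  have fin: "finite B" using B(2) by (rule finiteI_independent)
  show ?thesis
  proof (cases "dim S = 1")
    case True
    then obtain W where W: "B = {W}" using B(4) card_1_singletonE by metis
    then have "W \<noteq> 0" using B(2) dependent_zero by blast
    then show ?thesis using that[of W] sp W by (simp add: span_singleton)
  next
    case False
    then have "card B = 0" using assms(2) B(4) by linarith
    then have "B = {}" using fin by simp
    then show ?thesis using that[of 0] sp False by auto
  qed
qed

lemma dim_range_scaleR: "W \<noteq> 0 \<Longrightarrow> dim (range (\<lambda>s::real. s *\<^sub>R (W::'a::euclidean_space))) = 1"
  using dim_singleton[of W] by (simp flip: span_singleton)

text \<open>V is independent of E, and X lies outside a subspace containing both. With
  \<open>nil3\<close> as that subspace this shows that in dimension 2 the nilpotent part is at most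
  a line.\<close>

lemma dim_ge_3:
  assumes S: "X \<in> S" "V \<in> S" "E \<in> S" and n: "subspace K" "V \<in> K" "E \<in> K" "X \<notin> K"
    and V: "V \<notin> range (\<lambda>s::real. s *\<^sub>R E)" and E: "E \<noteq> (0::'a::euclidean_space)"
  shows "3 \<le> dim S"
proof -
  have "independent {E}" using E by simp
  then have 1: "independent {V, E}" using V by (simp add: independent_insert span_singleton)
  have "span {V, E} \<subseteq> K" using n by (intro span_minimal) auto
  then have 2: "independent {X, V, E}" using 1 n(4) by (auto simp: independent_insert)
  have "V \<noteq> E" using V by (metis rangeI scaleR_one)
  moreover have "X \<noteq> V" "X \<noteq> E" using n by auto
  ultimately have "card {X, V, E} = 3" by simp
  then show ?thesis using independent_card_le_dim[of "{X, V, E}" S] 2 S by simp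
qed

context AN_subgroup
begin

text \<open>The diagonal parts of \<hh> form a subspace of the two-dimensional \<aa>, and the cases
  are its dimensions 0, 2 and 1. In dimension 2 there are members with any prescribed diagonal, and
  regular ones lose their nilpotent part by \<open>regular_mem\<close>; in dimension 1
  \<open>compat_normal\<close> applies.\<close>

lemma h_cases:
  obtains (nil) "\<hh> \<subseteq> nil3"
  | (full) "\<And>a b c. a + b + c = 0 \<Longrightarrow> ut a b c 0 0 0 \<in> \<hh>"
  | (line) a b c p q r where "ut a b c p q r \<in> \<hh>" "ut a b c p q r \<notin> nil3" "a + b + c = 0"
     "p = 0 \<or> a = b" "q = 0 \<or> b = c" "r = 0 \<or> a = c"
     "\<And>Y. Y \<in> \<hh> \<Longrightarrow> \<exists>s. \<exists>U\<in>\<uu>. Y = s *\<^sub>R ut a b c p q r + U"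
proof (cases "\<hh> \<subseteq> nil3")
  case True
  then show ?thesis using nil by blast
next
  case False
  then obtain X where X': "X \<in> \<hh>" "X \<notin> nil3" by blast
  obtain a b c x y z where "X = ut a b c x y z" "a + b + c = 0" by (rule h_ut[OF X'(1)])
  then have X: "ut a b c x y z \<in> \<hh>" "ut a b c x y z \<notin> nil3" "a + b + c = 0" using X' by auto
  show ?thesis
  proof (cases "\<forall>a' b' c' x' y' z'. ut a' b' c' x' y' z' \<in> \<hh> \<longrightarrow> a * b' = a' * b")
    case True
    have dec: "\<exists>s. \<exists>U\<in>\<uu>. Y = s *\<^sub>R ut a b c p q r + U" if pqr: "ut a b c p q r \<in> \<hh>" and Y: "Y \<in> \<hh>" for p q r Y
    proof -
      obtain a' b' c' x' y' z' where Ye: "Y = ut a' b' c' x' y' z'" "a' + b' + c' = 0" by (rule h_ut[OF Y])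
      define s where "s = (if a = 0 then b' / b else a' / a)"
      have ab: "a \<noteq> 0 \<or> b \<noteq> 0" using X(2,3) by auto
      have e: "a * b' = a' * b" using True Y Ye by blast
      have s: "a' = s * a" "b' = s * b" using e ab by (auto simp: s_def field_simps)
      have "c' = - (s * a) - s * b" using Ye(2) s by linarith
      moreover have "s * a + s * b + s * c = 0" using X(3) by (simp flip: distrib_left)
      ultimately have s3: "c' = s * c" by linarith
      have "Y - s *\<^sub>R ut a b c p q r \<in> \<hh>" using Y pqr subspace_h by (intro subspace_diff subspace_scale)
      moreover have "Y - s *\<^sub>R ut a b c p q r \<in> nil3" using s s3 by (simp add: Ye)
      moreover have "Y = s *\<^sub>R ut a b c p q r + (Y - s *\<^sub>R ut a b c p q r)" by simp
      ultimately show ?thesis by blast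
    qed
    obtain p q r where pqr: "ut a b c p q r \<in> \<hh>" "p = 0 \<or> a = b" "q = 0 \<or> b = c" "r = 0 \<or> a = c"
      using compat_normal[OF X(1,2) dec[OF X(1)]] by blast
    show ?thesis by (rule line[OF pqr(1) _ X(3) pqr(2-4) dec[OF pqr(1)]]) (use X(2) in auto)
  next
    case False
    then obtain a' b' c' x' y' z' where Y: "ut a' b' c' x' y' z' \<in> \<hh>" "a * b' - a' * b \<noteq> 0" by auto
    have trY: "a' + b' + c' = 0" by (rule h_ut[OF Y(1)]) simp
    let ?d = "a * b' - a' * b"
    have ex: "\<exists>x y z. ut A B C x y z \<in> \<hh>" if "A + B + C = 0" for A B C
    proof -
      let ?s = "(A * b' - B * a') / ?d" and ?t = "(a * B - b * A) / ?d"
      have "?s *\<^sub>R ut a b c x y z + ?t *\<^sub>R ut a' b' c' x' y' z' \<in> \<hh>"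
        by (intro subspace_add[OF subspace_h] subspace_scale[OF subspace_h] X Y)
      moreover have 1: "?s * a + ?t * a' = A" "?s * b + ?t * b' = B"
        using Y(2) by (simp_all add: divide_simps) (simp_all add: algebra_simps)
      moreover have "?s * c + ?t * c' = C"
      proof -
        have c: "c = - a - b" "c' = - a' - b'" "C = - A - B" using that X(3) trY by simp_all
        have "?s * c + ?t * c' = - (?s * a + ?t * a') - (?s * b + ?t * b')"
          unfolding c by (simp only: algebra_simps)
        then show ?thesis unfolding 1 c(3) .
      qed
      ultimately show ?thesis by auto
    qed
    \<comment> \<open>The diagonals (1, 0, -1) and (3, -1, -2) are both regular and together span
      the trace-zero diagonal matrices.\<close>
    obtain x1 y1 z1 where "ut 1 0 (-1) x1 y1 z1 \<in> \<hh>" using ex[of 1 0 "-1"] by auto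
    then have D1: "ut 1 0 (-1) 0 0 0 \<in> \<hh>" by (rule regular_mem) auto
    obtain x1 y1 z1 where "ut 3 (-1) (-2) x1 y1 z1 \<in> \<hh>" using ex[of 3 "-1" "-2"] by auto
    then have D2: "ut 3 (-1) (-2) 0 0 0 \<in> \<hh>" by (rule regular_mem) auto
    have "ut A B C 0 0 0 \<in> \<hh>" if "A + B + C = 0" for A B C
    proof -
      have "(A + 3 * B) *\<^sub>R ut 1 0 (-1) 0 0 0 + (- B) *\<^sub>R ut 3 (-1) (-2) 0 0 0 \<in> \<hh>"
        by (intro subspace_add[OF subspace_h] subspace_scale[OF subspace_h] D1 D2)
      moreover have "C = - B - A" using that by simp
      ultimately show ?thesis by simp
    qed
    then show ?thesis by (rule full)
  qed
qed

end

subsection \<open>Cartan-decomposition subgroups\<close>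

text \<open>The diagonal part commutes with the root vector between its equal entries, so the
  exponential splits; this produces the polynomial factor s.\<close>

lemma mexp_12: "mexp (s *\<^sub>R ut d d c p 0 0) = ut (exp (s * d)) (exp (s * d)) (exp (s * c)) (s * p * exp (s * d)) 0 0"
proof -
  have "mexp (s *\<^sub>R ut d d c p 0 0) = mexp (ut (s * d) (s * d) (s * c) 0 0 0 + ut 0 0 0 (s * p) 0 0)" by simp
  also have "\<dots> = ut (exp (s * d)) (exp (s * d)) (exp (s * c)) (s * p * exp (s * d)) 0 0"
    by (subst mexp_add_commute) (simp_all del: ut_add)
  finally show ?thesis .
qed

lemma mexp_23: "mexp (s *\<^sub>R ut c d d 0 q 0) = ut (exp (s * c)) (exp (s * d)) (exp (s * d)) 0 (s * q * exp (s * d)) 0"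
proof -
  have "mexp (s *\<^sub>R ut c d d 0 q 0) = mexp (ut (s * c) (s * d) (s * d) 0 0 0 + ut 0 0 0 0 (s * q) 0)" by simp
  also have "\<dots> = ut (exp (s * c)) (exp (s * d)) (exp (s * d)) 0 (s * q * exp (s * d)) 0"
    by (subst mexp_add_commute) (simp_all del: ut_add)
  finally show ?thesis .
qed

lemma mexp_13: "mexp (s *\<^sub>R ut d c d 0 0 r) = ut (exp (s * d)) (exp (s * c)) (exp (s * d)) 0 0 (s * r * exp (s * d))"
proof -
  have "mexp (s *\<^sub>R ut d c d 0 0 r) = mexp (ut (s * d) (s * c) (s * d) 0 0 0 + ut 0 0 0 0 0 (s * r))" by simp
  also have "\<dots> = ut (exp (s * d)) (exp (s * c)) (exp (s * d)) 0 0 (s * r * exp (s * d))"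
    by (subst mexp_add_commute) (simp_all del: ut_add)
  finally show ?thesis .
qed

lemma exp_jordan:
  "exp (2 * t) * exp (- t) = exp (t::real)" "exp (- t) * exp (2 * t) = exp t" "exp t * exp t = exp (2 * t)"
  "exp t * exp (- 2 * t) = exp (- t)" "exp (- 2 * t) * exp t = exp (- t)"
  by (simp_all flip: exp_add)

lemma exp_trace_0:
  assumes "a + b + c = (0::real)"
  shows "exp (s * b) * exp (s * c) = exp (- s * a)" "exp (s * a) * exp (s * c) = exp (- s * b)"
    "exp (s * a) * exp (s * b) = exp (- s * c)"
proof -
  have "s * a + s * b + s * c = 0" using assms by (simp flip: distrib_left)
  then have "s * b + s * c = - s * a" "s * a + s * c = - s * b" "s * a + s * b = - s * c" by linarith+
  then show "exp (s * b) * exp (s * c) = exp (- s * a)" "exp (s * a) * exp (s * c) = exp (- s * b)"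
    "exp (s * a) * exp (s * b) = exp (- s * c)" by (simp_all flip: exp_add)
qed

text \<open>A common normal form for the three positions of a double diagonal entry d: t is s d, k
  the ratio of the nilpotent entry to d, and z the scaled coordinate of an additional unipotent
  factor.\<close>

definition jordan_sizes :: "real \<Rightarrow> real \<Rightarrow> real \<Rightarrow> mat3 \<Rightarrow> bool" where
  "jordan_sizes k t z h \<longleftrightarrow> l1 h = 2 * exp t + exp (- 2 * t) + \<bar>k * t\<bar> * exp t + \<bar>z\<bar> \<and>
      l1 (adj h) = 2 * exp (- t) + exp (2 * t) + \<bar>k * t\<bar> * exp (- t) + \<bar>z\<bar> * exp t"

lemma jordan_sizes_12:
  assumes "d \<noteq> 0"
  shows "jordan_sizes (p / d) (s * d) (exp (s * d) * r) (mexp (s *\<^sub>R ut d d (- 2 * d) p 0 0) ** ut 1 1 1 0 0 r)"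
proof -
  define t where "t = s * d"
  have s: "s = t / d" using assms by (simp add: t_def)
  have e: "mexp (s *\<^sub>R ut d d (- 2 * d) p 0 0) ** ut 1 1 1 0 0 r = ut (exp t) (exp t) (exp (- 2 * t)) (p / d * t * exp t) 0 (exp t * r)"
    unfolding mexp_12 using assms by (simp add: s)
  show ?thesis
    unfolding e jordan_sizes_def t_def[symmetric] using exp_jordan[of t]
    by (simp add: abs_mult mult.assoc)
qed

lemma jordan_sizes_23:
  assumes "d \<noteq> 0"
  shows "jordan_sizes (q / d) (s * d) (exp (- 2 * (s * d)) * r) (mexp (s *\<^sub>R ut (- 2 * d) d d 0 q 0) ** ut 1 1 1 0 0 r)"
proof -
  define t where "t = s * d"
  have s: "s = t / d" using assms by (simp add: t_def)
  have e: "mexp (s *\<^sub>R ut (- 2 * d) d d 0 q 0) ** ut 1 1 1 0 0 r = ut (exp (- 2 * t)) (exp t) (exp t) 0 (q / d * t * exp t) (exp (- 2 * t) * r)"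
    unfolding mexp_23 using assms by (simp add: s)
  show ?thesis
    unfolding e jordan_sizes_def t_def[symmetric] using exp_jordan[of t]
    by (simp add: abs_mult mult.left_commute[of "exp (- (2 * t))"])
qed

text \<open>Since x or y vanishes, the sum of the two scaled entries is a single term and can serve
  as z. The clause on z = 0 is for the group without an additional unipotent factor.\<close>

lemma jordan_sizes_13:
  assumes "d \<noteq> 0" "x = 0 \<or> y = 0"
  shows "\<exists>z. (x = 0 \<and> y = 0 \<longrightarrow> z = 0) \<and> jordan_sizes (r / d) (s * d) z (mexp (s *\<^sub>R ut d (- 2 * d) d 0 0 r) ** ut 1 1 1 x y 0)"
proof -
  define t where "t = s * d"
  have s: "s = t / d" using assms by (simp add: t_def)
  have e: "mexp (s *\<^sub>R ut d (- 2 * d) d 0 0 r) ** ut 1 1 1 x y 0 = ut (exp t) (exp (- 2 * t)) (exp t) (exp t * x) (exp (- 2 * t) * y) (r / d * t * exp t)"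
    unfolding mexp_13 using assms by (simp add: s)
  have "jordan_sizes (r / d) t (exp t * x + exp (- 2 * t) * y) (mexp (s *\<^sub>R ut d (- 2 * d) d 0 0 r) ** ut 1 1 1 x y 0)"
    unfolding e jordan_sizes_def using exp_jordan[of t] assms(2)
    by (auto simp: abs_mult mult.assoc)
  then show ?thesis unfolding t_def by (intro exI conjI; auto)
qed

context AN_subgroup
begin

lemma sizes_mem: "h \<in> H \<Longrightarrow> (l1 h, l1 (adj h)) \<in> sizes H"
  by (auto simp: sizes_def)

lemma coarse_full:
  assumes "\<And>a b c. a + b + c = 0 \<Longrightarrow> ut a b c 0 0 0 \<in> \<hh>"
  shows "coarse (sizes H)"
proof (rule coarse_diagonal)
  fix a b c :: real
  assume pos: "a > 0" "b > 0" "c > 0" "a * b * c = 1"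
  have "ut a b c 0 0 0 \<in> H" by (rule full_A[OF assms pos])
  from sizes_mem[OF this] show "(a + b + c, b * c + a * c + a * b) \<in> sizes H"
    using pos by (simp add: abs_mult)
qed

lemma coarse_mixed:
  assumes V: "ut 0 0 0 x y z \<in> \<hh>" "x \<noteq> 0" "y \<noteq> 0" and E: "ut 0 0 0 0 0 1 \<in> \<hh>"
  shows "coarse (sizes H)"
proof (rule coarse_unipotent[where m = "x * y" and k = "\<bar>x\<bar> + \<bar>y\<bar>"])
  fix s w :: real assume s: "s \<ge> 0"
  \<comment> \<open>The central coefficient makes the (1,3) entry of the exponential exactly w: it
    removes \<open>s * z\<close> and the quadratic term.\<close>
  have "s *\<^sub>R ut 0 0 0 x y z + (w - s * z - s * x * (s * y) / 2) *\<^sub>R ut 0 0 0 0 0 1 \<in> \<hh>"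
    by (intro subspace_add[OF subspace_h] subspace_scale[OF subspace_h] V E)
  then have "mexp (s *\<^sub>R ut 0 0 0 x y z + (w - s * z - s * x * (s * y) / 2) *\<^sub>R ut 0 0 0 0 0 1) \<in> H"
    by (rule lie_algebraD)
  then have "ut 1 1 1 (s * x) (s * y) w \<in> H" by simp
  from sizes_mem[OF this] show "(3 + s * (\<bar>x\<bar> + \<bar>y\<bar>) + \<bar>w\<bar>, 3 + s * (\<bar>x\<bar> + \<bar>y\<bar>) + \<bar>s\<^sup>2 * (x * y) - w\<bar>) \<in> sizes H"
    using s by (simp add: abs_mult power2_eq_square algebra_simps)
qed (use V in auto)

lemma diag_mem:
  assumes "ut a b c 0 0 0 \<in> \<hh>" "U \<in> \<hh>"
  shows "ut (exp (s * a)) (exp (s * b)) (exp (s * c)) 0 0 0 ** mexp (r *\<^sub>R U) \<in> H"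
  using mem(3)[OF mexp_mem[OF assms(1), of s] mexp_mem[OF assms(2), of r]] by simp

lemma coarse_12:
  assumes D: "ut a b c 0 0 0 \<in> \<hh>" "a + b + c = 0" "a \<noteq> 0 \<or> b \<noteq> 0 \<or> c \<noteq> 0"
    and W: "ut 0 0 0 x 0 z \<in> \<hh>" "x \<noteq> 0 \<or> z \<noteq> 0" "z = 0 \<or> b = c" and le: "0 \<le> (c - a) * (c - b)"
  shows "coarse (sizes H)"
proof (rule coarse_diag_root[OF D(2,3) le])
  fix s t :: real
  define k where "k = \<bar>x\<bar> + \<bar>z\<bar>"
  have k: "k > 0" using W(2) by (auto simp: k_def)
  define r where "r = \<bar>t\<bar> / exp (s * a) / k"
  have r: "0 \<le> r" "exp (s * a) * (r * k) = \<bar>t\<bar>" using k by (simp_all add: r_def)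
  have m: "ut (exp (s * a)) (exp (s * b)) (exp (s * c)) (exp (s * a) * (r * x)) 0 (exp (s * a) * (r * z)) \<in> H"
    using diag_mem[OF D(1) W(1), of s r] by simp
  have e: "exp (s * b) * exp (s * c) = exp (- s * a)" "exp (s * a) * exp (s * c) = exp (- s * b)"
    "exp (s * a) * exp (s * b) = exp (- s * c)"
    using D(2) by (simp_all add: eq_neg_iff_add_eq_0 flip: exp_add distrib_left)
  have bz: "exp (s * b) * \<bar>z\<bar> = exp (s * c) * \<bar>z\<bar>" using W(3) by auto
  have "exp (s * a) * (r * \<bar>x\<bar>) + exp (s * a) * (r * \<bar>z\<bar>) = \<bar>t\<bar>"
    using r(2) by (simp add: k_def algebra_simps)
  moreover have "exp (s * a) * (r * \<bar>x\<bar>) * exp (s * c) + exp (s * a) * (r * \<bar>z\<bar>) * exp (s * b) = \<bar>t\<bar> * exp (s * c)"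
  proof -
    have "exp (s * a) * (r * \<bar>x\<bar>) * exp (s * c) + exp (s * a) * (r * \<bar>z\<bar>) * exp (s * b)
       = exp (s * a) * r * (exp (s * c) * \<bar>x\<bar> + exp (s * b) * \<bar>z\<bar>)" by (simp add: algebra_simps)
    also have "\<dots> = exp (s * a) * (r * k) * exp (s * c)" unfolding bz k_def by (simp add: algebra_simps)
    finally show ?thesis unfolding r(2) .
  qed
  ultimately show "(exp (s * a) + exp (s * b) + exp (s * c) + \<bar>t\<bar>,
      exp (- s * a) + exp (- s * b) + exp (- s * c) + \<bar>t\<bar> * exp (s * c)) \<in> sizes H"
    using sizes_mem[OF m] r(1) e by (simp add: abs_mult add.assoc)
qed

text \<open>Index 1 lies outside the root, so its entry \<open>a\<close> takes the part of c in
  \<open>coarse_diag_root\<close>.\<close>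

lemma coarse_23:
  assumes D: "ut a b c 0 0 0 \<in> \<hh>" "a + b + c = 0" "a \<noteq> 0 \<or> b \<noteq> 0 \<or> c \<noteq> 0"
    and W: "ut 0 0 0 0 y z \<in> \<hh>" "y \<noteq> 0 \<or> z \<noteq> 0" "z = 0 \<or> a = b" and le: "0 \<le> (a - b) * (a - c)"
  shows "coarse (sizes H)"
proof (rule coarse_diag_root[of b c a])
  show "b + c + a = 0" "b \<noteq> 0 \<or> c \<noteq> 0 \<or> a \<noteq> 0" using D(2,3) by auto
  show "0 \<le> (a - b) * (a - c)" by (rule le)
  fix s t :: real
  define k where "k = \<bar>y\<bar> + \<bar>z\<bar>"
  have k: "k > 0" using W(2) by (auto simp: k_def)
  define r where "r = \<bar>t\<bar> / exp (s * b) / k"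
  have r: "0 \<le> r" "exp (s * b) * (r * k) = \<bar>t\<bar>" using k by (simp_all add: r_def)
  have m: "ut (exp (s * a)) (exp (s * b)) (exp (s * c)) 0 (exp (s * b) * (r * y)) (exp (s * a) * (r * z)) \<in> H"
    using diag_mem[OF D(1) W(1), of s r] by simp
  have e: "exp (s * b) * exp (s * c) = exp (- s * a)" "exp (s * a) * exp (s * c) = exp (- s * b)"
    "exp (s * a) * exp (s * b) = exp (- s * c)"
    using D(2) by (simp_all add: eq_neg_iff_add_eq_0 flip: exp_add distrib_left)
  have bz: "exp (s * a) * \<bar>z\<bar> = exp (s * b) * \<bar>z\<bar>" using W(3) by auto
  have "exp (s * b) * (r * \<bar>y\<bar>) + exp (s * a) * (r * \<bar>z\<bar>) = exp (s * b) * (r * \<bar>y\<bar>) + r * (exp (s * a) * \<bar>z\<bar>)"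
    by (simp add: algebra_simps)
  also have "\<dots> = \<bar>t\<bar>"
    unfolding bz r(2)[symmetric] by (simp add: k_def algebra_simps)
  finally have 1: "exp (s * b) * (r * \<bar>y\<bar>) + exp (s * a) * (r * \<bar>z\<bar>) = \<bar>t\<bar>" .
  have 2: "exp (s * a) * (exp (s * b) * (r * \<bar>y\<bar>)) + exp (s * a) * (r * \<bar>z\<bar>) * exp (s * b) = \<bar>t\<bar> * exp (s * a)"
    unfolding r(2)[symmetric] by (simp add: k_def algebra_simps)
  show "(exp (s * b) + exp (s * c) + exp (s * a) + \<bar>t\<bar>,
      exp (- s * b) + exp (- s * c) + exp (- s * a) + \<bar>t\<bar> * exp (s * a)) \<in> sizes H"
    using sizes_mem[OF m] r(1) e 1 2 by (simp add: abs_mult add_ac)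
qed

lemma coarse_13:
  assumes D: "ut a b c 0 0 0 \<in> \<hh>" "a + b + c = 0" "a \<noteq> 0 \<or> b \<noteq> 0 \<or> c \<noteq> 0"
    and W: "ut 0 0 0 0 0 1 \<in> \<hh>" and le: "0 \<le> (b - a) * (b - c)"
  shows "coarse (sizes H)"
proof (rule coarse_diag_root[of a c b])
  show "a + c + b = 0" "a \<noteq> 0 \<or> c \<noteq> 0 \<or> b \<noteq> 0" using D(2,3) by auto
  show "0 \<le> (b - a) * (b - c)" by (rule le)
  fix s t :: real
  have m: "ut (exp (s * a)) (exp (s * b)) (exp (s * c)) 0 0 \<bar>t\<bar> \<in> H"
    using diag_mem[OF D(1) W, of s "\<bar>t\<bar> / exp (s * a)"] by simp
  have e: "exp (s * b) * exp (s * c) = exp (- s * a)" "exp (s * a) * exp (s * c) = exp (- s * b)"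
    "exp (s * a) * exp (s * b) = exp (- s * c)"
    using D(2) by (simp_all add: eq_neg_iff_add_eq_0 flip: exp_add distrib_left)
  show "(exp (s * a) + exp (s * c) + exp (s * b) + \<bar>t\<bar>,
      exp (- s * a) + exp (- s * c) + exp (- s * b) + \<bar>t\<bar> * exp (s * b)) \<in> sizes H"
    using sizes_mem[OF m] e by (simp add: abs_mult add_ac)
qed

lemma coarse_jordan_12:
  assumes X: "ut d d (- 2 * d) p 0 0 \<in> \<hh>" "d \<noteq> 0" and E: "\<And>y z. ut 0 0 0 0 y z \<in> \<hh>"
  shows "coarse (sizes H)"
proof (rule coarse_jordan)
  fix t a b :: real
  \<comment> \<open>The coefficients undo the diagonal and the Jordan entry, so that the product has
    entries b and a above the diagonal in its last column.\<close>
  have E': "mexp (ut 0 0 0 0 (a / exp t) ((b - p / d * t * a) / exp t)) \<in> H"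
    using E by (rule lie_algebraD)
  have "mexp ((t / d) *\<^sub>R ut d d (- 2 * d) p 0 0) ** mexp (ut 0 0 0 0 (a / exp t) ((b - p / d * t * a) / exp t)) \<in> H"
    by (rule mem(3)[OF mexp_mem[OF X(1)] E'])
  then have m: "ut (exp t) (exp t) (exp (- 2 * t)) (p / d * t * exp t) a b \<in> H"
    unfolding mexp_12 using X(2) by (simp add: field_simps)
  have n: "l1 (ut (exp t) (exp t) (exp (- 2 * t)) (p / d * t * exp t) a b)
     = 2 * exp t + exp (- 2 * t) + \<bar>p / d * t\<bar> * exp t + \<bar>a\<bar> + \<bar>b\<bar>"
    by (simp add: abs_mult)
  have "\<bar>p / d * t * exp t * a - b * exp t\<bar> = \<bar>(a * (p / d * t) - b) * exp t\<bar>" by (simp add: algebra_simps)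
  then have n': "l1 (adj (ut (exp t) (exp t) (exp (- 2 * t)) (p / d * t * exp t) a b)) =
     2 * exp (- t) + exp (2 * t) + \<bar>p / d * t\<bar> * exp (- t) + \<bar>a\<bar> * exp t + \<bar>a * (p / d * t) - b\<bar> * exp t"
    using exp_jordan[of t] by (simp add: abs_mult mult.assoc)
  show "(2 * exp t + exp (- 2 * t) + \<bar>p / d * t\<bar> * exp t + \<bar>a\<bar> + \<bar>b\<bar>,
     2 * exp (- t) + exp (2 * t) + \<bar>p / d * t\<bar> * exp (- t) + \<bar>a\<bar> * exp t + \<bar>a * (p / d * t) - b\<bar> * exp t) \<in> sizes H"
    using sizes_mem[OF m] unfolding n n' .
qed

lemma coarse_jordan_23:
  assumes X: "ut (- 2 * d) d d 0 q 0 \<in> \<hh>" "d \<noteq> 0" and E: "\<And>x z. ut 0 0 0 x 0 z \<in> \<hh>"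
  shows "coarse (sizes H)"
proof (rule coarse_jordan)
  fix t a b :: real
  have E': "mexp (ut 0 0 0 (a / exp (- 2 * t)) 0 (b / exp (- 2 * t))) \<in> H"
    using E by (rule lie_algebraD)
  have "mexp ((t / d) *\<^sub>R ut (- 2 * d) d d 0 q 0) ** mexp (ut 0 0 0 (a / exp (- 2 * t)) 0 (b / exp (- 2 * t))) \<in> H"
    by (rule mem(3)[OF mexp_mem[OF X(1)] E'])
  then have m: "ut (exp (- 2 * t)) (exp t) (exp t) a (q / d * t * exp t) b \<in> H"
    unfolding mexp_23 using X(2) by (simp add: field_simps)
  have n: "l1 (ut (exp (- 2 * t)) (exp t) (exp t) a (q / d * t * exp t) b)
     = 2 * exp t + exp (- 2 * t) + \<bar>q / d * t\<bar> * exp t + \<bar>a\<bar> + \<bar>b\<bar>"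
    by (simp add: abs_mult)
  have "\<bar>a * (q / d * t * exp t) - b * exp t\<bar> = \<bar>(a * (q / d * t) - b) * exp t\<bar>" by (simp add: algebra_simps)
  then have n': "l1 (adj (ut (exp (- 2 * t)) (exp t) (exp t) a (q / d * t * exp t) b)) =
     2 * exp (- t) + exp (2 * t) + \<bar>q / d * t\<bar> * exp (- t) + \<bar>a\<bar> * exp t + \<bar>a * (q / d * t) - b\<bar> * exp t"
    using exp_jordan[of t] by (simp add: abs_mult mult.left_commute[of "exp (- (2 * t))"])
  show "(2 * exp t + exp (- 2 * t) + \<bar>q / d * t\<bar> * exp t + \<bar>a\<bar> + \<bar>b\<bar>,
     2 * exp (- t) + exp (2 * t) + \<bar>q / d * t\<bar> * exp (- t) + \<bar>a\<bar> * exp t + \<bar>a * (q / d * t) - b\<bar> * exp t) \<in> sizes H"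
    using sizes_mem[OF m] unfolding n n' .
qed

subsection \<open>Subgroups that are not Cartan-decomposition subgroups\<close>

lemma sizesE:
  assumes "(P, Q) \<in> sizes H" obtains h where "h \<in> H" "P = l1 h" "Q = l1 (adj h)"
  using assms by (auto simp: sizes_def)

lemma not_coarse_linear:
  assumes "\<And>h. h \<in> H \<Longrightarrow> l1 (adj h) \<le> C * l1 h"
  shows "\<not> coarse (sizes H)"
proof (rule not_coarse_power[where k = 1 and C = C])
  fix P Q assume "(P, Q) \<in> sizes H"
  then obtain h where "h \<in> H" "P = l1 h" "Q = l1 (adj h)" by (rule sizesE)
  then show "0 \<le> P \<and> Q \<le> C * P powr 1" using assms by simp
qed auto

text \<open>If x and y vanish, the two sizes coincide. Otherwise they differ by at most 2 |s z|,
  which the linear term |s| (|x| + |y|) dominates.\<close>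

lemma not_coarse_nil_line:
  assumes h: "\<hh> = range (\<lambda>s. s *\<^sub>R W)" and W: "W \<in> nil3"
  shows "\<not> coarse (sizes H)"
proof -
  obtain x y z where We: "W = ut 0 0 0 x y z" using W nil3E by blast
  have "\<hh> \<subseteq> nil3" using W subspace_scale[OF subspace_nil3] unfolding h by blast
  from unipotent_eq[OF this] have H: "H = mexp ` range (\<lambda>s. s *\<^sub>R W)" unfolding h .
  show ?thesis
  proof (cases "x = 0 \<and> y = 0")
    case True
    show ?thesis
    proof (rule not_coarse_linear[of 1])
      fix g assume "g \<in> H"
      then obtain s where "g = mexp (s *\<^sub>R W)" using H by blast
      then show "l1 (adj g) \<le> 1 * l1 g" using True by (simp add: We)
    qed
  next
    case False
    define k where "k = \<bar>x\<bar> + \<bar>y\<bar>"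
    have k: "k > 0" using False by (auto simp: k_def)
    show ?thesis
    proof (rule not_coarse_linear[of "1 + 2 * \<bar>z\<bar> / k"])
      fix g assume "g \<in> H"
      then obtain s where "g = mexp (s *\<^sub>R W)" using H by blast
      then have g: "g = ut 1 1 1 (s * x) (s * y) (s * z + s * x * (s * y) / 2)" by (simp add: We)
      let ?m = "s * x * (s * y) / 2"
      have sk: "\<bar>s * x\<bar> + \<bar>s * y\<bar> = \<bar>s\<bar> * k" by (simp add: k_def abs_mult algebra_simps)
      have g1: "l1 g = 3 + \<bar>s\<bar> * k + \<bar>s * z + ?m\<bar>" using sk unfolding g l1_ut by simp
      have "l1 (adj g) = 3 + \<bar>s\<bar> * k + \<bar>?m - s * z\<bar>"
        using sk unfolding g adj_ut l1_ut by (simp add: field_simps)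
      also have "\<dots> \<le> 3 + \<bar>s\<bar> * k + \<bar>s * z + ?m\<bar> + 2 * \<bar>s * z\<bar>" by linarith
      also have "\<dots> = l1 g + 2 * \<bar>z\<bar> / k * (\<bar>s\<bar> * k)" using k by (simp add: g1 abs_mult)
      also have "\<dots> \<le> l1 g + 2 * \<bar>z\<bar> / k * l1 g" using k g1 by (intro add_left_mono mult_left_mono) auto
      finally show "l1 (adj g) \<le> (1 + 2 * \<bar>z\<bar> / k) * l1 g" by (simp add: distrib_right)
    qed
  qed
qed

lemma not_coarse_abelian:
  assumes h: "\<hh> = {ut 0 0 0 x 0 z | x z. True} \<or> \<hh> = {ut 0 0 0 0 y z | y z. True}"
  shows "\<not> coarse (sizes H)"
proof (rule not_coarse_linear[of 1])
  fix g assume g: "g \<in> H"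
  have "\<hh> \<subseteq> nil3" using h by auto
  from unipotent_eq[OF this] obtain U where "U \<in> \<hh>" "g = mexp U" using g by (metis imageE)
  then show "l1 (adj g) \<le> 1 * l1 g" using h by auto
qed

text \<open>The two sizes differ only in whether e^s multiplies r x or r y. Both |r| and e^s |r| are
  dominated by the common part \<open>?P0\<close>: from 2 |r| \<le> e^s r^2 + e^(-s), a square
  completed, and from |r| \<le> r^2 + 1. The quadratic corner entry is nonzero since x and y
  are.\<close>

lemma not_coarse_mixed:
  assumes H: "\<And>h. h \<in> H \<Longrightarrow> \<exists>s r. h = ut (exp s) 1 (exp (- s)) 0 0 0 ** mexp (r *\<^sub>R ut 0 0 0 x y 0)"
    and xy: "x \<noteq> 0" "y \<noteq> 0"
  shows "\<not> coarse (sizes H)"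
proof (rule not_coarse_linear)
  define m where "m = \<bar>x * y\<bar> / 2"
  have m: "m > 0" using xy by (simp add: m_def)
  let ?C = "1 + (\<bar>x\<bar> + \<bar>y\<bar>) * (1 + 1 / m)"
  fix g assume "g \<in> H"
  then obtain s r where "g = ut (exp s) 1 (exp (- s)) 0 0 0 ** mexp (r *\<^sub>R ut 0 0 0 x y 0)" using H by blast
  then have g: "g = ut (exp s) 1 (exp (- s)) (exp s * (r * x)) (r * y) (exp s * (r * x * (r * y) / 2))" by simp
  let ?P0 = "exp s + 1 + exp (- s) + exp s * (r\<^sup>2 * m)"
  have e: "exp s * exp (- s) = 1" "exp s * (r * x) * exp (- s) = r * x"
    by (simp_all add: exp_minus field_simps)
  have z: "\<bar>exp s * (r * x * (r * y) / 2)\<bar> = exp s * (r\<^sup>2 * m)"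
    by (simp add: m_def abs_mult power2_eq_square)
  have P: "l1 g = exp s + 1 + exp (- s) + exp s * \<bar>r * x\<bar> + \<bar>r * y\<bar> + exp s * (r\<^sup>2 * m)"
    unfolding g l1_ut z by (simp add: abs_mult)
  have "exp s * (r * x) * (r * y) - exp s * (r * x * (r * y) / 2) * 1 = exp s * (r * x * (r * y) / 2)"
    by (simp add: field_simps)
  moreover have "- (exp s * (r * x)) * exp (- s) = - (r * x)" using e(2) by simp
  ultimately have Q: "l1 (adj g) = exp s + 1 + exp (- s) + \<bar>r * x\<bar> + exp s * \<bar>r * y\<bar> + exp s * (r\<^sup>2 * m)"
    unfolding g adj_ut l1_ut using e(1) by (simp only: z) (simp add: abs_mult)
  have P0: "0 < ?P0" using m by (simp add: add_pos_nonneg)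
  have r1: "\<bar>r\<bar> \<le> (1 + 1 / m) * ?P0"
  proof -
    have "0 \<le> (exp s * \<bar>r\<bar> - 1)\<^sup>2" by simp
    then have "2 * (exp s * \<bar>r\<bar>) \<le> (exp s * \<bar>r\<bar>)\<^sup>2 + 1" by (simp add: power2_diff)
    then have "exp s * (2 * \<bar>r\<bar>) \<le> exp s * (exp s * r\<^sup>2 + exp (- s))"
      using e(1) by (simp add: power_mult_distrib power2_eq_square algebra_simps)
    then have "2 * \<bar>r\<bar> \<le> exp s * r\<^sup>2 + exp (- s)" by simp
    also have "\<dots> \<le> (1 / m) * ?P0 + 1 * ?P0"
    proof (rule add_mono)
      have "exp s * r\<^sup>2 = (1 / m) * (exp s * (r\<^sup>2 * m))" using m by simp
      also have "\<dots> \<le> (1 / m) * ?P0" using m by (intro mult_left_mono) auto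
      finally show "exp s * r\<^sup>2 \<le> (1 / m) * ?P0" .
      show "exp (- s) \<le> 1 * ?P0" using m by (simp add: add_nonneg_nonneg)
    qed
    also have "\<dots> = (1 + 1 / m) * ?P0" by (simp only: distrib_right add.commute)
    finally show ?thesis by simp
  qed
  have r2: "exp s * \<bar>r\<bar> \<le> (1 + 1 / m) * ?P0"
  proof -
    have "0 \<le> (\<bar>r\<bar> - 1)\<^sup>2" by simp
    then have "\<bar>r\<bar> \<le> r\<^sup>2 + 1" by (simp add: power2_diff)
    then have "exp s * \<bar>r\<bar> \<le> exp s * (r\<^sup>2 + 1)" by (intro mult_left_mono) auto
    also have "\<dots> = (1 / m) * (exp s * (r\<^sup>2 * m)) + 1 * exp s" using m by (simp add: algebra_simps)
    also have "\<dots> \<le> (1 / m) * ?P0 + 1 * ?P0"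
      using m by (intro add_mono mult_left_mono) (auto simp: add_nonneg_nonneg)
    also have "\<dots> = (1 + 1 / m) * ?P0" by (simp only: distrib_right add.commute)
    finally show ?thesis .
  qed
  have "l1 (adj g) = ?P0 + \<bar>x\<bar> * \<bar>r\<bar> + \<bar>y\<bar> * (exp s * \<bar>r\<bar>)" unfolding Q by (simp add: abs_mult)
  also have "\<dots> \<le> ?P0 + \<bar>x\<bar> * ((1 + 1 / m) * ?P0) + \<bar>y\<bar> * ((1 + 1 / m) * ?P0)"
    using r1 r2 by (intro add_mono mult_left_mono) auto
  also have "\<dots> = ?C * ?P0" by (simp only: distrib_right distrib_left mult_1 mult.assoc)
  also have "\<dots> \<le> ?C * l1 g"
  proof (rule mult_left_mono)
    show "?P0 \<le> l1 g" unfolding P by (simp add: add_nonneg_nonneg)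
    show "0 \<le> ?C" using m by (simp add: add_nonneg_nonneg)
  qed
  finally show "l1 (adj g) \<le> ?C * l1 g" .
qed

end

lemma root_space_ut:
  "root_space (1,2) = range (\<lambda>s. ut 0 0 0 s 0 0)" "root_space (2,3) = range (\<lambda>s. ut 0 0 0 0 s 0)"
  "root_space (1,3) = range (\<lambda>s. ut 0 0 0 0 0 s)"
proof -
  have "s *\<^sub>R unit_mat 1 2 = ut 0 0 0 s 0 0" "s *\<^sub>R unit_mat 2 3 = ut 0 0 0 0 s 0" "s *\<^sub>R unit_mat 1 3 = ut 0 0 0 0 0 s" for s
    by (simp_all add: mat3_eq_iff)
  then show "root_space (1,2) = range (\<lambda>s. ut 0 0 0 s 0 0)" "root_space (2,3) = range (\<lambda>s. ut 0 0 0 0 s 0)"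
    "root_space (1,3) = range (\<lambda>s. ut 0 0 0 0 0 s)"
    by (simp_all add: root_space_eq)
qed

lemma range_scaleR_unit:
  assumes "k \<noteq> 0"
  shows "range (\<lambda>s. s *\<^sub>R ut 0 0 0 k 0 0) = range (\<lambda>s. ut 0 0 0 s 0 0)"
    "range (\<lambda>s. s *\<^sub>R ut 0 0 0 0 k 0) = range (\<lambda>s. ut 0 0 0 0 s 0)"
    "range (\<lambda>s. s *\<^sub>R ut 0 0 0 0 0 k) = range (\<lambda>s. ut 0 0 0 0 0 s)"
proof -
  have r: "range (\<lambda>s. f (s * k)) = range f" for f :: "real \<Rightarrow> mat3"
  proof (rule subset_antisym)
    show "range f \<subseteq> range (\<lambda>s. f (s * k))"
    proof
      fix y assume "y \<in> range f"
      then obtain t where "y = f (t / k * k)" using assms by auto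
      then show "y \<in> range (\<lambda>s. f (s * k))" by blast
    qed
  qed auto
  show "range (\<lambda>s. s *\<^sub>R ut 0 0 0 k 0 0) = range (\<lambda>s. ut 0 0 0 s 0 0)"
    "range (\<lambda>s. s *\<^sub>R ut 0 0 0 0 k 0) = range (\<lambda>s. ut 0 0 0 0 s 0)"
    "range (\<lambda>s. s *\<^sub>R ut 0 0 0 0 0 k) = range (\<lambda>s. ut 0 0 0 0 0 s)"
    using r[of "\<lambda>s. ut 0 0 0 s 0 0"] r[of "\<lambda>s. ut 0 0 0 0 s 0"] r[of "\<lambda>s. ut 0 0 0 0 0 s"] by simp_all
qed

context AN_subgroup
begin

lemma not_coarse_12:
  assumes tr: "a + b + c = 0" and lt: "(c - a) * (c - b) < 0"
    and H: "\<And>h. h \<in> H \<Longrightarrow> \<exists>s r. h = ut (exp (s * a)) (exp (s * b)) (exp (s * c)) 0 0 0 ** ut 1 1 1 r 0 0"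
  shows "\<not> coarse (sizes H)"
proof (rule not_coarse_diag_root[OF tr lt])
  fix P Q assume "(P, Q) \<in> sizes H"
  then obtain h where h: "h \<in> H" "P = l1 h" "Q = l1 (adj h)" by (rule sizesE)
  then obtain s r where "h = ut (exp (s * a)) (exp (s * b)) (exp (s * c)) 0 0 0 ** ut 1 1 1 r 0 0" using H by blast
  then show "\<exists>s x. P = exp (s * a) + exp (s * b) + exp (s * c) + \<bar>x\<bar> \<and>
      Q = exp (- s * a) + exp (- s * b) + exp (- s * c) + \<bar>x\<bar> * exp (s * c)"
    using exp_trace_0[OF tr, of s] h(2,3) by - (rule exI[of _ s], rule exI[of _ "exp (s * a) * r"], simp add: abs_mult)
qed

lemma not_coarse_23:
  assumes tr: "a + b + c = 0" and lt: "(a - b) * (a - c) < 0"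
    and H: "\<And>h. h \<in> H \<Longrightarrow> \<exists>s r. h = ut (exp (s * a)) (exp (s * b)) (exp (s * c)) 0 0 0 ** ut 1 1 1 0 r 0"
  shows "\<not> coarse (sizes H)"
proof (rule not_coarse_diag_root[of b c a])
  show "b + c + a = 0" using tr by simp
  show "(a - b) * (a - c) < 0" by (rule lt)
  fix P Q assume "(P, Q) \<in> sizes H"
  then obtain h where h: "h \<in> H" "P = l1 h" "Q = l1 (adj h)" by (rule sizesE)
  then obtain s r where "h = ut (exp (s * a)) (exp (s * b)) (exp (s * c)) 0 0 0 ** ut 1 1 1 0 r 0" using H by blast
  then show "\<exists>s x. P = exp (s * b) + exp (s * c) + exp (s * a) + \<bar>x\<bar> \<and>
      Q = exp (- s * b) + exp (- s * c) + exp (- s * a) + \<bar>x\<bar> * exp (s * a)"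
    using exp_trace_0[OF tr, of s] h(2,3) by - (rule exI[of _ s], rule exI[of _ "exp (s * b) * r"], simp add: abs_mult)
qed

lemma not_coarse_13:
  assumes tr: "a + b + c = 0" and lt: "(b - a) * (b - c) < 0"
    and H: "\<And>h. h \<in> H \<Longrightarrow> \<exists>s r. h = ut (exp (s * a)) (exp (s * b)) (exp (s * c)) 0 0 0 ** ut 1 1 1 0 0 r"
  shows "\<not> coarse (sizes H)"
proof (rule not_coarse_diag_root[of a c b])
  show "a + c + b = 0" using tr by simp
  show "(b - a) * (b - c) < 0" by (rule lt)
  fix P Q assume "(P, Q) \<in> sizes H"
  then obtain h where h: "h \<in> H" "P = l1 h" "Q = l1 (adj h)" by (rule sizesE)
  then obtain s r where "h = ut (exp (s * a)) (exp (s * b)) (exp (s * c)) 0 0 0 ** ut 1 1 1 0 0 r" using H by blast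
  then show "\<exists>s x. P = exp (s * a) + exp (s * c) + exp (s * b) + \<bar>x\<bar> \<and>
      Q = exp (- s * a) + exp (- s * c) + exp (- s * b) + \<bar>x\<bar> * exp (s * b)"
    using exp_trace_0[OF tr, of s] h(2,3) by - (rule exI[of _ s], rule exI[of _ "exp (s * a) * r"], simp add: abs_mult)
qed

lemma not_coarse_jordan_sizes:
  assumes "k \<noteq> 0" "\<And>h. h \<in> H \<Longrightarrow> \<exists>t z. jordan_sizes k t z h"
  shows "\<not> coarse (sizes H)"
proof (rule not_coarse_jordan[OF assms(1)])
  fix P Q assume "(P, Q) \<in> sizes H"
  then obtain h where h: "h \<in> H" "P = l1 h" "Q = l1 (adj h)" by (rule sizesE)
  then show "\<exists>t z. P = 2 * exp t + exp (- 2 * t) + \<bar>k * t\<bar> * exp t + \<bar>z\<bar> \<and>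
      Q = 2 * exp (- t) + exp (2 * t) + \<bar>k * t\<bar> * exp (- t) + \<bar>z\<bar> * exp t"
    using assms(2)[OF h(1)] unfolding jordan_sizes_def by blast
qed

lemma not_coarse_jordan_line_sizes:
  assumes "\<And>h. h \<in> H \<Longrightarrow> \<exists>t. jordan_sizes k t 0 h"
  shows "\<not> coarse (sizes H)"
proof (rule not_coarse_jordan_line)
  fix P Q assume "(P, Q) \<in> sizes H"
  then obtain h where h: "h \<in> H" "P = l1 h" "Q = l1 (adj h)" by (rule sizesE)
  then obtain t where "jordan_sizes k t 0 h" using assms by blast
  then show "\<exists>t. P = 2 * exp t + exp (- 2 * t) + \<bar>k * t\<bar> * exp t \<and>
      Q = 2 * exp (- t) + exp (2 * t) + \<bar>k * t\<bar> * exp (- t)"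
    unfolding h jordan_sizes_def by (intro exI[of _ t]) simp
qed

end

section \<open>One-dimensional diagonal part\<close>

text \<open>The case \<open>line\<close> of \<open>h_cases\<close>. The conditions on p, q, r say
  that the nilpotent part of the generator commutes with the diagonal part.\<close>

locale AN_line = AN_subgroup +
  fixes a b c p q r :: real
  assumes X: "ut a b c p q r \<in> lie_algebra H" and not_nil: "ut a b c p q r \<notin> nil3"
    and tr: "a + b + c = 0" and p: "p = 0 \<or> a = b" and q: "q = 0 \<or> b = c" and r: "r = 0 \<or> a = c"
    and dec: "\<And>Y. Y \<in> lie_algebra H \<Longrightarrow> \<exists>s. \<exists>U\<in>lie_algebra H \<inter> nil3. Y = s *\<^sub>R ut a b c p q r + U"
begin

lemma ne: "a \<noteq> 0 \<or> b \<noteq> 0 \<or> c \<noteq> 0"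
  using not_nil by simp

lemma H_elem:
  assumes "h \<in> H"
  obtains s U where "U \<in> \<uu>" "h = mexp (s *\<^sub>R ut a b c p q r) ** mexp U"
  using twisted_eq(1)[OF X not_nil dec] assms by blast

lemma HN: "H \<inter> N_grp = mexp ` \<uu>"
  by (rule twisted_eq(2)[OF X not_nil dec])

lemma two_equal:
  "a = b \<Longrightarrow> c = - 2 * a \<and> a \<noteq> 0 \<and> a \<noteq> c \<and> b \<noteq> c"
  "b = c \<Longrightarrow> a = - 2 * b \<and> b \<noteq> 0 \<and> a \<noteq> c \<and> a \<noteq> b"
  "a = c \<Longrightarrow> b = - 2 * a \<and> a \<noteq> 0 \<and> a \<noteq> b \<and> b \<noteq> c"
  using tr ne by linarith+

lemma dec_diag:
  assumes D: "ut a b c 0 0 0 \<in> \<hh>" and Y: "Y \<in> \<hh>"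
  shows "\<exists>s. \<exists>U\<in>\<uu>. Y = s *\<^sub>R ut a b c 0 0 0 + U"
proof -
  obtain s U where sU: "U \<in> \<uu>" "Y = s *\<^sub>R ut a b c p q r + U" using dec[OF Y] by blast
  have "ut a b c p q r - ut a b c 0 0 0 \<in> \<hh>" using X D subspace_diff[OF subspace_h] by blast
  then have "ut 0 0 0 p q r \<in> \<uu>" by simp
  then have "s *\<^sub>R ut 0 0 0 p q r + 1 *\<^sub>R U \<in> \<uu>" using sU(1) by (intro u_lin)
  moreover have "Y = s *\<^sub>R ut a b c 0 0 0 + (s *\<^sub>R ut 0 0 0 p q r + 1 *\<^sub>R U)"
    unfolding sU(2) by (simp flip: add.assoc)
  ultimately show ?thesis by blast
qed

lemma H_elem_diag:
  assumes D: "ut a b c 0 0 0 \<in> \<hh>" and h: "h \<in> H"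
  obtains s U where "U \<in> \<uu>" "h = ut (exp (s * a)) (exp (s * b)) (exp (s * c)) 0 0 0 ** mexp U"
proof -
  have n: "ut a b c 0 0 0 \<notin> nil3" using not_nil by simp
  obtain s U where "U \<in> \<uu>" "h = mexp (s *\<^sub>R ut a b c 0 0 0) ** mexp U"
    using twisted_eq(1)[OF D n dec_diag[OF D]] h by blast
  then show ?thesis using that by simp
qed

lemma diag_lie_a: "ut a b c 0 0 0 \<in> lie_a"
  using tr by (auto simp: lie_a_iff)

lemma semidirect_one_parameter:
  assumes D: "ut a b c 0 0 0 \<in> \<hh>"
  shows "internal_semidirect H (range (\<lambda>s. mexp (s *\<^sub>R ut a b c 0 0 0))) (H \<inter> N_grp)"
proof (rule internal_semidirect_N)
  show "subgroup (range (\<lambda>s. mexp (s *\<^sub>R ut a b c 0 0 0))) SL3"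
    by (rule subgroup_one_parameter[OF diag_lie_a])
  show "range (\<lambda>s. mexp (s *\<^sub>R ut a b c 0 0 0)) \<subseteq> H" using mexp_mem[OF D] by blast
  show "range (\<lambda>s. mexp (s *\<^sub>R ut a b c 0 0 0)) \<subseteq> A_grp"
    using diag_lie_a by (auto simp: lie_a_def lie_algebra_def)
  fix h assume h: "h \<in> H"
  obtain s U where sU: "U \<in> \<uu>" "h = ut (exp (s * a)) (exp (s * b)) (exp (s * c)) 0 0 0 ** mexp U"
    by (rule H_elem_diag[OF D h])
  then have "h = mexp (s *\<^sub>R ut a b c 0 0 0) ** mexp U" by simp
  then show "\<exists>t\<in>range (\<lambda>s. mexp (s *\<^sub>R ut a b c 0 0 0)). \<exists>n\<in>H \<inter> N_grp. h = t ** n"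
    using sU(1) HN by blast
qed

lemma semidirect_diag:
  assumes D: "ut a b c 0 0 0 \<in> \<hh>"
  shows "internal_semidirect H (H \<inter> A_grp) (H \<inter> N_grp)"
proof (rule internal_semidirect_A_N)
  fix h assume h: "h \<in> H"
  obtain s U where sU: "U \<in> \<uu>" "h = ut (exp (s * a)) (exp (s * b)) (exp (s * c)) 0 0 0 ** mexp U"
    by (rule H_elem_diag[OF D h])
  have "mexp (s *\<^sub>R ut a b c 0 0 0) \<in> H \<inter> A_grp"
    using diag_lie_a mexp_mem[OF D] by (auto simp: lie_a_def lie_algebra_def)
  then have "ut (exp (s * a)) (exp (s * b)) (exp (s * c)) 0 0 0 \<in> H \<inter> A_grp" by simp
  then show "\<exists>t\<in>H \<inter> A_grp. \<exists>n\<in>H \<inter> N_grp. h = t ** n" using sU HN by blast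
qed

text \<open>In a factorization t n the diagonal factor is determined by the diagonal of the product,
  so testing the exponential of the generator is conclusive.\<close>

lemma not_semidirect:
  assumes "\<And>U. U \<in> \<uu> \<Longrightarrow> mexp (ut a b c p q r) \<noteq> ut (exp a) (exp b) (exp c) 0 0 0 ** mexp U"
  shows "\<not> internal_semidirect H (H \<inter> A_grp) (H \<inter> N_grp)"
proof
  assume "internal_semidirect H (H \<inter> A_grp) (H \<inter> N_grp)"
  then have "H = (H \<inter> A_grp) <#>\<^bsub>SL3\<^esub> (H \<inter> N_grp)" by (simp add: internal_semidirect_def)
  moreover have "mexp (ut a b c p q r) \<in> H" by (rule lie_algebraD[OF X])
  ultimately obtain t n where tn: "mexp (ut a b c p q r) = t ** n" "t \<in> A_grp" "n \<in> H \<inter> N_grp"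
    unfolding set_mult_SL3 by blast
  obtain a' b' c' where t: "t = ut a' b' c' 0 0 0" using tn(2) by (auto simp: A_grp_iff)
  obtain x y z where n: "n = ut 1 1 1 x y z" using tn(3) by (auto simp: N_grp_iff)
  obtain x' y' z' where e: "mexp (ut a b c p q r) = ut (exp a) (exp b) (exp c) x' y' z'" using mexp_ut by blast
  have "t = ut (exp a) (exp b) (exp c) 0 0 0" using tn(1) unfolding t n e by simp
  moreover obtain U where "U \<in> \<uu>" "n = mexp U" using tn(3) HN by blast
  ultimately show False using assms tn(1) by blast
qed

text \<open>H is a one-parameter group. If D is regular, it is treated as part of a group with one
  root direction; if two entries agree, it is a Jordan line.\<close>

lemma not_coarse_if_u_trivial:
  assumes u: "\<uu> = {0}"
  shows "\<not> coarse (sizes H)"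
proof -
  have H: "\<exists>s. h = mexp (s *\<^sub>R ut a b c p q r) ** ut 1 1 1 0 0 0" if "h \<in> H" for h
    by (rule H_elem[OF that]) (use u in \<open>auto simp: mat_1_ut\<close>)
  consider "a \<noteq> b" "b \<noteq> c" "a \<noteq> c" | "a = b" | "b = c" | "a = c" by blast
  then show ?thesis
  proof cases
    case 1
    then have "p = 0" "q = 0" "r = 0" using p q r by auto
    then have H': "\<exists>s. h = ut (exp (s * a)) (exp (s * b)) (exp (s * c)) 0 0 0 ** ut 1 1 1 0 0 0" if "h \<in> H" for h
      using H[OF that] by simp
    \<comment> \<open>Of three distinct numbers one lies strictly between the others; the root
      joining the indices of the other two is the one to use.\<close>
    have "(c - a) * (c - b) < 0 \<or> (a - b) * (a - c) < 0 \<or> (b - a) * (b - c) < 0"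
      using 1 by (auto simp: mult_less_0_iff)
    then show ?thesis
    proof (elim disjE)
      assume "(c - a) * (c - b) < 0"
      then show ?thesis by (rule not_coarse_12[OF tr]) (use H' in blast)
    next
      assume "(a - b) * (a - c) < 0"
      then show ?thesis by (rule not_coarse_23[OF tr]) (use H' in blast)
    next
      assume "(b - a) * (b - c) < 0"
      then show ?thesis by (rule not_coarse_13[OF tr]) (use H' in blast)
    qed
  next
    case 2
    note e = two_equal(1)[OF 2]
    have qr: "q = 0" "r = 0" using q r e by auto
    show ?thesis
    proof (rule not_coarse_jordan_line_sizes[of "p / a"])
      fix h assume "h \<in> H"
      then obtain s where "h = mexp (s *\<^sub>R ut a a (- 2 * a) p 0 0) ** ut 1 1 1 0 0 0" using H 2 e qr by metis
      then show "\<exists>t. jordan_sizes (p / a) t 0 h" using jordan_sizes_12[of a p s 0] e by auto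
    qed
  next
    case 3
    note e = two_equal(2)[OF 3]
    have pr: "p = 0" "r = 0" using p r e by auto
    show ?thesis
    proof (rule not_coarse_jordan_line_sizes[of "q / b"])
      fix h assume "h \<in> H"
      then obtain s where "h = mexp (s *\<^sub>R ut (- 2 * b) b b 0 q 0) ** ut 1 1 1 0 0 0" using H 3 e pr by metis
      then show "\<exists>t. jordan_sizes (q / b) t 0 h" using jordan_sizes_23[of b q s 0] e by auto
    qed
  next
    case 4
    note e = two_equal(3)[OF 4]
    have pq: "p = 0" "q = 0" using p q e by auto
    show ?thesis
    proof (rule not_coarse_jordan_line_sizes[of "r / a"])
      fix h assume "h \<in> H"
      then obtain s where "h = mexp (s *\<^sub>R ut a (- 2 * a) a 0 0 r) ** ut 1 1 1 0 0 0" using H 4 e pq by metis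
      then show "\<exists>t. jordan_sizes (r / a) t 0 h" using jordan_sizes_13[of a 0 0 r s] e by auto
    qed
  qed
qed

lemma diag_memI:
  assumes "ut 0 0 0 p q r \<in> \<hh>" shows "ut a b c 0 0 0 \<in> \<hh>"
  using subspace_diff[OF subspace_h X assms] by simp

text \<open>W is an eigenvector of the bracket with the generator. If x and y are both nonzero, the
  eigenvalue is a - b = b - c; with trace 0 this gives diagonal (a, 0, -a), and the third equation
  kills z. If exactly one of them is nonzero, a nonzero z forces two equal diagonal entries. Outside
  the last three cases the vector (p, q, r) is 0 or belongs to \<uu>, so the diagonal part lies in
  \<hh>.\<close>

lemma u_line_cases:
  assumes u: "\<uu> = range (\<lambda>s. s *\<^sub>R W)" "W \<noteq> 0"
  obtains (r12) "ut a b c 0 0 0 \<in> \<hh>" "\<uu> = range (\<lambda>s. ut 0 0 0 s 0 0)"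
  | (r23) "ut a b c 0 0 0 \<in> \<hh>" "\<uu> = range (\<lambda>s. ut 0 0 0 0 s 0)"
  | (r13) "ut a b c 0 0 0 \<in> \<hh>" "\<uu> = range (\<lambda>s. ut 0 0 0 0 0 s)"
  | (mixed) x y where "ut a b c 0 0 0 \<in> \<hh>" "b = 0" "c = - a" "\<uu> = range (\<lambda>s. s *\<^sub>R ut 0 0 0 x y 0)" "x \<noteq> 0" "y \<noteq> 0"
  | (two23) y z where "ut a b c 0 0 0 \<in> \<hh>" "a = b" "ut 0 0 0 0 y z \<in> \<hh>" "y \<noteq> 0"
  | (two12) x z where "ut a b c 0 0 0 \<in> \<hh>" "b = c" "ut 0 0 0 x 0 z \<in> \<hh>" "x \<noteq> 0"
  | (j12) "a = b" "q = 0" "r = 0" "p \<noteq> 0" "\<uu> = range (\<lambda>s. ut 0 0 0 0 0 s)"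
  | (j23) "b = c" "p = 0" "r = 0" "q \<noteq> 0" "\<uu> = range (\<lambda>s. ut 0 0 0 0 0 s)"
  | (j13) "a = c" "p = 0" "q = 0" "r \<noteq> 0" "\<uu> \<in> {range (\<lambda>s. ut 0 0 0 s 0 0), range (\<lambda>s. ut 0 0 0 0 s 0)}"
proof -
  have "1 *\<^sub>R W \<in> \<uu>" unfolding u(1) by blast
  then have Wu: "W \<in> \<uu>" by simp
  then obtain x y z where We: "W = ut 0 0 0 x y z" using nil3E by blast
  have Wh: "ut 0 0 0 x y z \<in> \<hh>" using Wu We by blast
  have "bracket (ut a b c p q r) W \<in> \<uu>" using h_bracket_u X Wu by blast
  then obtain l where "bracket (ut a b c p q r) W = l *\<^sub>R W" unfolding u(1) by blast
  then have eq: "(a - b) * x = l * x" "(b - c) * y = l * y" "(a - c) * z + p * y - x * q = l * z"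
    by (simp_all add: We)
  have xyz: "x \<noteq> 0 \<or> y \<noteq> 0 \<or> z \<noteq> 0" using u(2) by (auto simp: We zero_ut)
  consider (xy) "x \<noteq> 0" "y \<noteq> 0" | (x) "x \<noteq> 0" "y = 0" | (y) "x = 0" "y \<noteq> 0" | (z) "x = 0" "y = 0" "z \<noteq> 0"
    using xyz by blast
  then show ?thesis
  proof cases
    case xy
    then have l: "a - b = l" "b - c = l" using eq by simp_all
    have l0: "l \<noteq> 0" using l tr ne by auto
    then have pqr: "p = 0" "q = 0" "r = 0" using p q r l by auto
    then have "l * z = 0" using eq(3) l by (simp add: algebra_simps)
    then have "z = 0" using l0 by simp
    moreover have "b = 0" "c = - a" using l tr by linarith+
    moreover have "ut a b c 0 0 0 \<in> \<hh>" using X pqr by simp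
    ultimately show ?thesis using mixed[of x y] u(1) We xy by simp
  next
    case x
    then have l: "a - b = l" using eq by simp
    have zq: "(b - c) * z = x * q" using eq(3) x l by (simp add: algebra_simps)
    have q0: "q = 0" using q zq x by auto
    show ?thesis
    proof (cases "z = 0")
      case True
      have uu: "\<uu> = range (\<lambda>s. ut 0 0 0 s 0 0)" unfolding u(1) We using True x range_scaleR_unit(1) by simp
      show ?thesis
      proof (cases "r = 0")
        case True
        have "ut 0 0 0 p 0 0 \<in> \<uu>" unfolding uu by blast
        then have "ut a b c 0 0 0 \<in> \<hh>" using q0 True by (intro diag_memI) simp
        then show ?thesis using r12 uu by blast
      next
        case False
        then have "a = c" using r by blast
        then have "p = 0" using p two_equal(3) by blast
        then show ?thesis using j13 \<open>a = c\<close> q0 False uu by blast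
      qed
    next
      case False
      then have bc: "b = c" using zq q0 by simp
      then have "p = 0" "r = 0" using p r two_equal(2) by blast+
      then have "ut a b c 0 0 0 \<in> \<hh>" using X q0 by simp
      then show ?thesis using two12[of x z] bc Wh x by simp
    qed
  next
    case y
    then have l: "b - c = l" using eq by simp
    have zp: "(a - b) * z = - (p * y)" using eq(3) y l by (simp add: algebra_simps)
    have p0: "p = 0" using p zp y by auto
    show ?thesis
    proof (cases "z = 0")
      case True
      have uu: "\<uu> = range (\<lambda>s. ut 0 0 0 0 s 0)" unfolding u(1) We using True y range_scaleR_unit(2) by simp
      show ?thesis
      proof (cases "r = 0")
        case True
        have "ut 0 0 0 0 q 0 \<in> \<uu>" unfolding uu by blast
        then have "ut a b c 0 0 0 \<in> \<hh>" using p0 True by (intro diag_memI) simp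
        then show ?thesis using r23 uu by blast
      next
        case False
        then have "a = c" using r by blast
        then have "q = 0" using q two_equal(3) by blast
        then show ?thesis using j13 \<open>a = c\<close> p0 False uu by blast
      qed
    next
      case False
      then have ab: "a = b" using zp p0 by simp
      then have "q = 0" "r = 0" using q r two_equal(1) by blast+
      then have "ut a b c 0 0 0 \<in> \<hh>" using X p0 by simp
      then show ?thesis using two23[of y z] ab Wh y by simp
    qed
  next
    case z
    have uu: "\<uu> = range (\<lambda>s. ut 0 0 0 0 0 s)" unfolding u(1) We using z range_scaleR_unit(3) by simp
    consider "p \<noteq> 0" | "q \<noteq> 0" | "p = 0" "q = 0" by blast
    then show ?thesis
    proof cases
      case 1
      then have "a = b" using p by blast
      then have "q = 0" "r = 0" using q r two_equal(1) by blast+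
      then show ?thesis using j12 \<open>a = b\<close> 1 uu by blast
    next
      case 2
      then have "b = c" using q by blast
      then have "p = 0" "r = 0" using p r two_equal(2) by blast+
      then show ?thesis using j23 \<open>b = c\<close> 2 uu by blast
    next
      case 3
      have "ut 0 0 0 0 0 r \<in> \<uu>" unfolding uu by blast
      then have "ut a b c 0 0 0 \<in> \<hh>" using 3 by (intro diag_memI) simp
      then show ?thesis using r13 uu by blast
    qed
  qed
qed

lemma jordan_not_coarse_not_semidirect:
  assumes "a = b \<and> q = 0 \<and> r = 0 \<and> p \<noteq> 0 \<and> \<uu> = range (\<lambda>s. ut 0 0 0 0 0 s) \<or>
    b = c \<and> p = 0 \<and> r = 0 \<and> q \<noteq> 0 \<and> \<uu> = range (\<lambda>s. ut 0 0 0 0 0 s) \<or>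
    a = c \<and> p = 0 \<and> q = 0 \<and> r \<noteq> 0 \<and> \<uu> \<in> {range (\<lambda>s. ut 0 0 0 s 0 0), range (\<lambda>s. ut 0 0 0 0 s 0)}"
  shows "\<not> coarse (sizes H)" "\<not> internal_semidirect H (H \<inter> A_grp) (H \<inter> N_grp)"
proof -
  have "\<not> coarse (sizes H) \<and> \<not> internal_semidirect H (H \<inter> A_grp) (H \<inter> N_grp)"
    using assms
  proof (elim disjE conjE)
    assume *: "a = b" "q = 0" "r = 0" "p \<noteq> 0" "\<uu> = range (\<lambda>s. ut 0 0 0 0 0 s)"
    note e = two_equal(1)[OF *(1)]
    have Xe: "ut a b c p q r = ut a a (- 2 * a) p 0 0" using * e by simp
    have "\<not> coarse (sizes H)"
    proof (rule not_coarse_jordan_sizes[of "p / a"])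
      fix h assume "h \<in> H"
      then obtain s U where sU: "U \<in> \<uu>" "h = mexp (s *\<^sub>R ut a b c p q r) ** mexp U" by (rule H_elem)
      then obtain w where "U = ut 0 0 0 0 0 w" using *(5) by blast
      then have "h = mexp (s *\<^sub>R ut a a (- 2 * a) p 0 0) ** ut 1 1 1 0 0 w" using sU(2) Xe by simp
      then show "\<exists>t z. jordan_sizes (p / a) t z h" using jordan_sizes_12[of a p s w] e by metis
    qed (use * e in auto)
    moreover have "\<not> internal_semidirect H (H \<inter> A_grp) (H \<inter> N_grp)"
    proof (rule not_semidirect)
      fix U assume "U \<in> \<uu>"
      then obtain w where "U = ut 0 0 0 0 0 w" using *(5) by blast
      then show "mexp (ut a b c p q r) \<noteq> ut (exp a) (exp b) (exp c) 0 0 0 ** mexp U"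
        using mexp_12[of 1 a c p] * by simp
    qed
    ultimately show ?thesis by blast
  next
    assume *: "b = c" "p = 0" "r = 0" "q \<noteq> 0" "\<uu> = range (\<lambda>s. ut 0 0 0 0 0 s)"
    note e = two_equal(2)[OF *(1)]
    have Xe: "ut a b c p q r = ut (- 2 * b) b b 0 q 0" using * e by simp
    have "\<not> coarse (sizes H)"
    proof (rule not_coarse_jordan_sizes[of "q / b"])
      fix h assume "h \<in> H"
      then obtain s U where sU: "U \<in> \<uu>" "h = mexp (s *\<^sub>R ut a b c p q r) ** mexp U" by (rule H_elem)
      then obtain w where "U = ut 0 0 0 0 0 w" using *(5) by blast
      then have "h = mexp (s *\<^sub>R ut (- 2 * b) b b 0 q 0) ** ut 1 1 1 0 0 w" using sU(2) Xe by simp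
      then show "\<exists>t z. jordan_sizes (q / b) t z h" using jordan_sizes_23[of b q s w] e by metis
    qed (use * e in auto)
    moreover have "\<not> internal_semidirect H (H \<inter> A_grp) (H \<inter> N_grp)"
    proof (rule not_semidirect)
      fix U assume "U \<in> \<uu>"
      then obtain w where "U = ut 0 0 0 0 0 w" using *(5) by blast
      then show "mexp (ut a b c p q r) \<noteq> ut (exp a) (exp b) (exp c) 0 0 0 ** mexp U"
        using mexp_23[of 1 a b q] * by simp
    qed
    ultimately show ?thesis by blast
  next
    assume *: "a = c" "p = 0" "q = 0" "r \<noteq> 0" and
      u: "\<uu> \<in> {range (\<lambda>s. ut 0 0 0 s 0 0), range (\<lambda>s. ut 0 0 0 0 s 0)}"
    note e = two_equal(3)[OF *(1)]
    have Xe: "ut a b c p q r = ut a (- 2 * a) a 0 0 r" using * e by simp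
    have U: "\<exists>x y. (x = 0 \<or> y = 0) \<and> U = ut 0 0 0 x y 0" if "U \<in> \<uu>" for U
    proof -
      have "U \<in> range (\<lambda>s. ut 0 0 0 s 0 0) \<or> U \<in> range (\<lambda>s. ut 0 0 0 0 s 0)" using u that by blast
      then show ?thesis by blast
    qed
    have "\<not> coarse (sizes H)"
    proof (rule not_coarse_jordan_sizes[of "r / a"])
      fix h assume "h \<in> H"
      then obtain s V where sU: "V \<in> \<uu>" "h = mexp (s *\<^sub>R ut a b c p q r) ** mexp V" by (rule H_elem)
      then obtain x y where xy: "x = 0 \<or> y = 0" "V = ut 0 0 0 x y 0" using U by blast
      then have "h = mexp (s *\<^sub>R ut a (- 2 * a) a 0 0 r) ** ut 1 1 1 x y 0" using sU(2) Xe by auto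
      then show "\<exists>t z. jordan_sizes (r / a) t z h" using jordan_sizes_13[of a x y r s] e xy(1) by metis
    qed (use * e in auto)
    moreover have "\<not> internal_semidirect H (H \<inter> A_grp) (H \<inter> N_grp)"
    proof (rule not_semidirect)
      fix V assume "V \<in> \<uu>"
      then obtain x y where "x = 0 \<or> y = 0" "V = ut 0 0 0 x y 0" using U by blast
      then show "mexp (ut a b c p q r) \<noteq> ut (exp a) (exp b) (exp c) 0 0 0 ** mexp V"
        using mexp_13[of 1 a b r] * by auto
    qed
    ultimately show ?thesis by blast
  qed
  then show "\<not> coarse (sizes H)" "\<not> internal_semidirect H (H \<inter> A_grp) (H \<inter> N_grp)" by blast+
qed

text \<open>\<uu> contains the root vectors (1,2) and (1,3), whose outside indices are 3 and 2. The
  entries c and b cannot both lie strictly between the remaining two, so one of the root criteria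
  applies. For \<open>b = c\<close> a Jordan entry q can persist, and the explicit
  \<open>coarse_jordan\<close> handles it.\<close>

lemma coarse_alpha:
  assumes u: "\<uu> = {ut 0 0 0 x 0 z | x z. True}"
  shows "coarse (sizes H)"
proof -
  have E: "ut 0 0 0 x 0 z \<in> \<hh>" for x z using u by blast
  show ?thesis
  proof (cases "b = c")
    case True
    note e = two_equal(2)[OF True]
    have "p = 0" "r = 0" using p r e by auto
    then have "ut (- 2 * b) b b 0 q 0 \<in> \<hh>" using X True e by simp
    then show ?thesis using coarse_jordan_23[OF _ _ E] e by blast
  next
    case False
    then have D: "ut a b c 0 0 0 \<in> \<hh>" using q E by (intro diag_memI) auto
    have "0 \<le> (c - a) * (c - b) \<or> 0 \<le> (b - a) * (b - c)"
      by (auto simp: zero_le_mult_iff)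
    then show ?thesis using coarse_12[OF D tr ne E[of 1 0]] coarse_13[OF D tr ne E[of 0 1]] by auto
  qed
qed

lemma coarse_beta:
  assumes u: "\<uu> = {ut 0 0 0 0 y z | y z. True}"
  shows "coarse (sizes H)"
proof -
  have E: "ut 0 0 0 0 y z \<in> \<hh>" for y z using u by blast
  show ?thesis
  proof (cases "a = b")
    case True
    note e = two_equal(1)[OF True]
    have "q = 0" "r = 0" using q r e by auto
    then have "ut a a (- 2 * a) p 0 0 \<in> \<hh>" using X True e by simp
    then show ?thesis using coarse_jordan_12[OF _ _ E] e by blast
  next
    case False
    then have D: "ut a b c 0 0 0 \<in> \<hh>" using p E by (intro diag_memI) auto
    have "0 \<le> (a - b) * (a - c) \<or> 0 \<le> (b - a) * (b - c)"
      by (auto simp: zero_le_mult_iff)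
    then show ?thesis using coarse_23[OF D tr ne E[of 1 0]] coarse_13[OF D tr ne E[of 0 1]] by auto
  qed
qed

end

section \<open>The listed Lie algebras and the assembly of the equivalence\<close>

lemma root_space_sums:
  "root_space root_alpha + root_space root_alpha_beta = {ut 0 0 0 x 0 z | x z. True}"
  "root_space root_beta + root_space root_alpha_beta = {ut 0 0 0 0 y z | y z. True}"
  "root_space root_alpha + root_space root_beta = {ut 0 0 0 x y 0 | x y. True}"
  by (fastforce simp: root_alpha_def root_beta_def root_alpha_beta_def root_space_ut set_plus_def)+

lemma ker_alpha_minus_beta:
  "{X \<in> lie_a. root_functional root_alpha X - root_functional root_beta X = 0} = range (\<lambda>s. ut s 0 (- s) 0 0 0)"
proof (intro subset_antisym subsetI)
  fix X assume "X \<in> {X \<in> lie_a. root_functional root_alpha X - root_functional root_beta X = 0}"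
  then obtain a b c where X: "X = ut a b c 0 0 0" "a + b + c = 0" "a - b - (b - c) = 0"
    by (auto simp: lie_a_iff root_functional_def root_alpha_def root_beta_def)
  then have "b = 0" "c = - a" by linarith+
  then show "X \<in> range (\<lambda>s. ut s 0 (- s) 0 0 0)" using X(1) by blast
qed (auto simp: lie_a_iff root_functional_def root_alpha_def root_beta_def)

context AN_subgroup
begin

lemma not_coarse_dim_le_1:
  assumes "lie_dim H \<le> 1"
  shows "\<not> coarse (sizes H)"
proof -
  obtain W where W: "\<hh> = range (\<lambda>s. s *\<^sub>R W)"
    using dim_le_1_range[OF subspace_h] assms unfolding lie_dim_def by metis
  show ?thesis
  proof (cases rule: h_cases)
    case nil
    have "1 *\<^sub>R W \<in> \<hh>" unfolding W by blast
    then show ?thesis using not_coarse_nil_line[OF W] nil by auto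
  next
    case full
    obtain s where s: "ut 1 0 (-1) 0 0 0 = s *\<^sub>R W" using full[of 1 0 "-1"] unfolding W by auto
    obtain t where t: "ut 0 1 (-1) 0 0 0 = t *\<^sub>R W" using full[of 0 1 "-1"] unfolding W by auto
    have "s * W$2$2 = 0" "s * W$1$1 = 1" using arg_cong[OF s, of "\<lambda>M. M$2$2"] arg_cong[OF s, of "\<lambda>M. M$1$1"] by simp_all
    then have "W$2$2 = 0" by auto
    then show ?thesis using arg_cong[OF t, of "\<lambda>M. M$2$2"] by simp
  next
    case (line a b c p q r)
    interpret AN_line H a b c p q r
      by unfold_locales (use line in auto)
    obtain s where s: "ut a b c p q r = s *\<^sub>R W" using X unfolding W by blast
    have s0: "s \<noteq> 0" using not_nil s subspace_0[OF subspace_nil3] by auto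
    have "U = 0" if U: "U \<in> \<uu>" for U
    proof -
      obtain t where t: "U = t *\<^sub>R W" using U W by blast
      then have "U = (t / s) *\<^sub>R ut a b c p q r" using s0 by (simp add: s)
      moreover from this have "t / s = 0" using U ne by auto
      ultimately show ?thesis by (simp add: zero_ut)
    qed
    then have "\<uu> = {0}" using subspace_0[OF subspace_u] by blast
    then show ?thesis by (rule not_coarse_if_u_trivial)
  qed
qed

lemma not_coarse_mixed_algebra:
  assumes u: "subspace u" "dim u = 1" "u \<subseteq> root_space root_alpha + root_space root_beta"
      "u \<notin> {root_space root_alpha, root_space root_beta}"
    and h: "\<hh> = {X \<in> lie_a. root_functional root_alpha X - root_functional root_beta X = 0} + u"
  shows "\<not> coarse (sizes H)"
proof -
  obtain W where W: "u = range (\<lambda>s. s *\<^sub>R W)" "W \<noteq> 0" using dim_le_1_range[OF u(1)] u(2) by (metis order_refl)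
  have "1 *\<^sub>R W \<in> u" unfolding W(1) by blast
  then obtain x y where We: "W = ut 0 0 0 x y 0" using u(3) root_space_sums(3) by auto
  have xy: "x \<noteq> 0" "y \<noteq> 0"
    using u(4) W(2) range_scaleR_unit(1)[of x] range_scaleR_unit(2)[of y]
    by (auto simp: W(1) We root_alpha_def root_beta_def root_space_ut zero_ut)
  have h': "\<hh> = {ut s 0 (- s) 0 0 0 + t *\<^sub>R W | s t. True}"
    unfolding h ker_alpha_minus_beta W(1) set_plus_def by blast
  have "ut 1 0 (-1) 0 0 0 + 0 *\<^sub>R W \<in> \<hh>" unfolding h' by blast
  then have D: "ut 1 0 (-1) 0 0 0 \<in> \<hh>" by simp
  have "ut 0 0 (- 0) 0 0 0 + t *\<^sub>R W \<in> \<hh>" for t unfolding h' by blast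
  then have Wu: "t *\<^sub>R W \<in> \<uu>" for t by (simp add: We flip: zero_ut)
  have uW: "\<exists>t. U = t *\<^sub>R W" if U: "U \<in> \<uu>" for U
  proof -
    obtain s t where st: "U = ut s 0 (- s) 0 0 0 + t *\<^sub>R W" using U unfolding h' by blast
    then have "s = 0" using U by (simp add: We)
    then show ?thesis using st by (auto simp flip: zero_ut)
  qed
  have dec: "\<exists>s. \<exists>U\<in>\<uu>. Y = s *\<^sub>R ut 1 0 (-1) 0 0 0 + U" if Y: "Y \<in> \<hh>" for Y
  proof -
    obtain s t where "Y = ut s 0 (- s) 0 0 0 + t *\<^sub>R W" using Y unfolding h' by blast
    then have "Y = s *\<^sub>R ut 1 0 (-1) 0 0 0 + t *\<^sub>R W" by simp
    then show ?thesis using Wu by blast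
  qed
  have "ut 1 0 (-1) 0 0 0 \<notin> nil3" by simp
  note H = twisted_eq(1)[OF D this dec]
  show ?thesis
  proof (rule not_coarse_mixed[OF _ xy])
    fix g assume "g \<in> H"
    then obtain s U where sU: "U \<in> \<uu>" "g = mexp (s *\<^sub>R ut 1 0 (-1) 0 0 0) ** mexp U" using H by blast
    obtain t where "U = t *\<^sub>R W" using uW[OF sU(1)] by blast
    then have "g = ut (exp s) 1 (exp (- s)) 0 0 0 ** mexp (t *\<^sub>R ut 0 0 0 x y 0)" using sU(2) by (simp add: We)
    then show "\<exists>s r. g = ut (exp s) 1 (exp (- s)) 0 0 0 ** mexp (r *\<^sub>R ut 0 0 0 x y 0)" by blast
  qed
qed

lemma not_coarse_region:
  assumes w: "\<omega> \<in> positive_roots" and T: "one_parameter_subgroup_of_A T"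
    and sd: "internal_semidirect H T (root_subgroup \<omega>)" and reg: "line_in_region \<omega> (lie_algebra T)"
  shows "\<not> coarse (sizes H)"
proof -
  obtain X where X: "X \<in> lie_a" "X \<noteq> 0" "T = range (\<lambda>s. mexp (s *\<^sub>R X))"
    using T by (auto simp: one_parameter_subgroup_of_A_def)
  obtain a b c where abc: "X = ut a b c 0 0 0" "a + b + c = 0" using X(1) lie_a_iff by auto
  have ne: "a \<noteq> 0 \<or> b \<noteq> 0 \<or> c \<noteq> 0" using X(2) abc by (auto simp: zero_ut)
  have reg': "line_in_region \<omega> (range (\<lambda>s. s *\<^sub>R ut a b c 0 0 0))"
    using reg lie_algebra_one_parameter[OF X(1)] X(3) abc by simp
  have "H = T <#>\<^bsub>SL3\<^esub> root_subgroup \<omega>" using sd by (simp add: internal_semidirect_def)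
  then have H: "\<exists>s. \<exists>U\<in>root_space \<omega>. h = ut (exp (s * a)) (exp (s * b)) (exp (s * c)) 0 0 0 ** mexp U" if "h \<in> H" for h
    using that unfolding set_mult_SL3 root_subgroup_def X(3) abc(1) by auto
  consider "\<omega> = (1,2)" | "\<omega> = (2,3)" | "\<omega> = (1,3)" using w by (auto simp: positive_roots_eq)
  then show ?thesis
  proof cases
    case 1
    show ?thesis
    proof (rule not_coarse_12[OF abc(2)])
      show "(c - a) * (c - b) < 0" using reg' line_in_region_roots(1)[OF abc(2) ne] 1 by simp
      fix h assume "h \<in> H"
      then obtain s U where "U \<in> root_space (1,2)" "h = ut (exp (s * a)) (exp (s * b)) (exp (s * c)) 0 0 0 ** mexp U"
        using H 1 by blast
      moreover from this obtain w where "U = ut 0 0 0 w 0 0" unfolding root_space_ut by blast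
      then have "mexp U = ut 1 1 1 w 0 0" by simp
      ultimately show "\<exists>s r. h = ut (exp (s * a)) (exp (s * b)) (exp (s * c)) 0 0 0 ** ut 1 1 1 r 0 0"
        by metis
    qed
  next
    case 2
    show ?thesis
    proof (rule not_coarse_23[OF abc(2)])
      show "(a - b) * (a - c) < 0" using reg' line_in_region_roots(2)[OF abc(2) ne] 2 by simp
      fix h assume "h \<in> H"
      then obtain s U where "U \<in> root_space (2,3)" "h = ut (exp (s * a)) (exp (s * b)) (exp (s * c)) 0 0 0 ** mexp U"
        using H 2 by blast
      moreover from this obtain w where "U = ut 0 0 0 0 w 0" unfolding root_space_ut by blast
      then have "mexp U = ut 1 1 1 0 w 0" by simp
      ultimately show "\<exists>s r. h = ut (exp (s * a)) (exp (s * b)) (exp (s * c)) 0 0 0 ** ut 1 1 1 0 r 0"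
        by metis
    qed
  next
    case 3
    show ?thesis
    proof (rule not_coarse_13[OF abc(2)])
      show "(b - a) * (b - c) < 0" using reg' line_in_region_roots(3)[OF abc(2) ne] 3 by simp
      fix h assume "h \<in> H"
      then obtain s U where "U \<in> root_space (1,3)" "h = ut (exp (s * a)) (exp (s * b)) (exp (s * c)) 0 0 0 ** mexp U"
        using H 3 by blast
      moreover from this obtain w where "U = ut 0 0 0 0 0 w" unfolding root_space_ut by blast
      then have "mexp U = ut 1 1 1 0 0 w" by simp
      ultimately show "\<exists>s r. h = ut (exp (s * a)) (exp (s * b)) (exp (s * c)) 0 0 0 ** ut 1 1 1 0 0 r"
        by metis
    qed
  qed
qed

lemma u_cases:
  obtains (line) W where "W \<in> \<uu>" "\<uu> = range (\<lambda>s. s *\<^sub>R W)"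
  | (mixed) x y z where "ut 0 0 0 x y z \<in> \<uu>" "x \<noteq> 0" "y \<noteq> 0" "ut 0 0 0 0 0 1 \<in> \<uu>"
  | (alpha) "\<uu> = {ut 0 0 0 x 0 z | x z. True}"
  | (beta) "\<uu> = {ut 0 0 0 0 y z | y z. True}"
  by (rule nil_subspace_cases[OF subspace_u Int_lower2 u_bracket_closed])

text \<open>Algebras inside \<open>nil3\<close> or containing all of \<aa> give semidirect products,
  and dimension 2 leaves at most a line for \<uu>. If \<uu> is nonzero and the diagonal part of the
  generator is in \<hh>, the group is again semidirect, so only the Jordan cases remain.\<close>

lemma not_coarse_not_semidirect:
  assumes dim: "lie_dim H = 2" and sd: "\<not> internal_semidirect H (H \<inter> A_grp) (H \<inter> N_grp)"
  shows "\<not> coarse (sizes H)"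
proof (cases rule: h_cases)
  case nil
  then show ?thesis using semidirect_nil sd by blast
next
  case full
  then show ?thesis using semidirect_full sd by blast
next
  case (line a b c p q r)
  interpret AN_line H a b c p q r
    by unfold_locales (use line in auto)
  have d3: False if "V \<in> \<uu>" "E \<in> \<uu>" "V \<notin> range (\<lambda>s. s *\<^sub>R E)" "E \<noteq> 0" for V E
    using dim_ge_3[of "ut a b c p q r" \<hh> V E nil3] X not_nil that subspace_nil3 dim
    by (simp add: lie_dim_def)
  show ?thesis
  proof (cases rule: u_cases)
    case (line W)
    show ?thesis
    proof (cases "W = 0")
      case True
      then show ?thesis using not_coarse_if_u_trivial line by auto
    next
      case False
      show ?thesis
        by (cases rule: u_line_cases[OF line(2) False])
           (use semidirect_diag sd in blast, use semidirect_diag sd in blast, use semidirect_diag sd in blast,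
            use semidirect_diag sd in blast, use semidirect_diag sd in blast, use semidirect_diag sd in blast,
            rule jordan_not_coarse_not_semidirect(1), blast,
            rule jordan_not_coarse_not_semidirect(1), blast,
            rule jordan_not_coarse_not_semidirect(1), blast)
    qed
  next
    case (mixed x y z)
    then have "ut 0 0 0 x y z \<notin> range (\<lambda>s. s *\<^sub>R ut 0 0 0 0 0 1)" by auto
    then show ?thesis using d3[OF mixed(1,4)] by (simp add: zero_ut)
  next
    case alpha
    have "ut 0 0 0 1 0 0 \<in> \<uu>" "ut 0 0 0 0 0 1 \<in> \<uu>" unfolding alpha by blast+
    moreover have "ut 0 0 0 1 0 0 \<notin> range (\<lambda>s. s *\<^sub>R ut 0 0 0 0 0 1)" by auto
    ultimately show ?thesis using d3[of "ut 0 0 0 1 0 0" "ut 0 0 0 0 0 1"] by (simp add: zero_ut)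
  next
    case beta
    have "ut 0 0 0 0 1 0 \<in> \<uu>" "ut 0 0 0 0 0 1 \<in> \<uu>" unfolding beta by blast+
    moreover have "ut 0 0 0 0 1 0 \<notin> range (\<lambda>s. s *\<^sub>R ut 0 0 0 0 0 1)" by auto
    ultimately show ?thesis using d3[of "ut 0 0 0 0 1 0" "ut 0 0 0 0 0 1"] by (simp add: zero_ut)
  qed
qed

end

context AN_line
begin

lemma region_semidirect:
  assumes D: "ut a b c 0 0 0 \<in> \<hh>" and u: "\<uu> = root_space \<omega>" and w: "\<omega> \<in> positive_roots"
    and reg: "line_in_region \<omega> (range (\<lambda>s. s *\<^sub>R ut a b c 0 0 0))"
  shows "\<exists>T. \<exists>\<omega>\<in>positive_roots. one_parameter_subgroup_of_A T
        \<and> internal_semidirect H T (root_subgroup \<omega>) \<and> line_in_region \<omega> (lie_algebra T)"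
proof (intro exI[of _ "range (\<lambda>s. mexp (s *\<^sub>R ut a b c 0 0 0))"] bexI[of _ \<omega>] conjI w)
  show "one_parameter_subgroup_of_A (range (\<lambda>s. mexp (s *\<^sub>R ut a b c 0 0 0)))"
    unfolding one_parameter_subgroup_of_A_def using diag_lie_a ne zero_ut by (metis ut_eq_iff)
  show "internal_semidirect H (range (\<lambda>s. mexp (s *\<^sub>R ut a b c 0 0 0))) (root_subgroup \<omega>)"
    using semidirect_one_parameter[OF D] unfolding HN u root_subgroup_def .
  show "line_in_region \<omega> (lie_algebra (range (\<lambda>s. mexp (s *\<^sub>R ut a b c 0 0 0))))"
    unfolding lie_algebra_one_parameter[OF diag_lie_a] by (rule reg)
qed

lemma mixed_algebra:
  assumes D: "ut a b c 0 0 0 \<in> \<hh>" and bc: "b = 0" "c = - a"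
    and u: "\<uu> = range (\<lambda>s. s *\<^sub>R ut 0 0 0 x y 0)" and xy: "x \<noteq> 0" "y \<noteq> 0"
  shows "\<exists>u. subspace u \<and> dim u = 1 \<and> u \<subseteq> root_space root_alpha + root_space root_beta
        \<and> u \<notin> {root_space root_alpha, root_space root_beta}
        \<and> \<hh> = {X \<in> lie_a. root_functional root_alpha X - root_functional root_beta X = 0} + u"
proof (intro exI[of _ "\<uu>"] conjI)
  have a0: "a \<noteq> 0" using ne bc by auto
  show "subspace \<uu>" by (rule subspace_u)
  show "dim \<uu> = 1" unfolding u by (rule dim_range_scaleR) (use xy in \<open>simp add: zero_ut\<close>)
  show "\<uu> \<subseteq> root_space root_alpha + root_space root_beta" unfolding u root_space_sums by auto
  have "1 *\<^sub>R ut 0 0 0 x y 0 \<in> \<uu>" unfolding u by blast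
  moreover have "1 *\<^sub>R ut 0 0 0 x y 0 \<notin> root_space root_alpha" "1 *\<^sub>R ut 0 0 0 x y 0 \<notin> root_space root_beta"
    using xy by (auto simp: root_alpha_def root_beta_def root_space_ut)
  ultimately show "\<uu> \<notin> {root_space root_alpha, root_space root_beta}" by (metis insert_iff singleton_iff)
  show "\<hh> = {X \<in> lie_a. root_functional root_alpha X - root_functional root_beta X = 0} + \<uu>"
    unfolding ker_alpha_minus_beta set_plus_def
  proof (intro subset_antisym subsetI)
    fix Y assume "Y \<in> \<hh>"
    then obtain s U where U: "U \<in> \<uu>" "Y = s *\<^sub>R ut a b c 0 0 0 + U" using dec_diag[OF D] by blast
    have "s *\<^sub>R ut a b c 0 0 0 = ut (s * a) 0 (- (s * a)) 0 0 0" using bc by simp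
    then show "Y \<in> {y. \<exists>x\<in>range (\<lambda>s. ut s 0 (- s) 0 0 0). \<exists>z\<in>\<uu>. y = x + z}"
      unfolding U(2) using U(1) by blast
  next
    fix Y assume "Y \<in> {y. \<exists>x\<in>range (\<lambda>s. ut s 0 (- s) 0 0 0). \<exists>z\<in>\<uu>. y = x + z}"
    then obtain s U where sU: "U \<in> \<uu>" "Y = ut s 0 (- s) 0 0 0 + U" by blast
    have e: "ut s 0 (- s) 0 0 0 = (s / a) *\<^sub>R ut a b c 0 0 0" using bc a0 by simp
    show "Y \<in> \<hh>"
      unfolding sU(2) e by (rule subspace_add[OF subspace_h subspace_scale[OF subspace_h D] IntD1[OF sU(1)]])
  qed
qed

lemma lie_dim_le_2:
  assumes "\<uu> = range (\<lambda>s. s *\<^sub>R W)"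
  shows "lie_dim H \<le> 2"
proof -
  have "\<hh> \<subseteq> span {ut a b c p q r, W}"
  proof
    fix Y assume "Y \<in> \<hh>"
    then obtain s U where "U \<in> \<uu>" "Y = s *\<^sub>R ut a b c p q r + U" using dec by blast
    moreover from this obtain t where "U = t *\<^sub>R W" unfolding assms by blast
    ultimately have Y: "Y = s *\<^sub>R ut a b c p q r + t *\<^sub>R W" by simp
    show "Y \<in> span {ut a b c p q r, W}"
      unfolding Y by (intro span_add span_scale span_base) auto
  qed
  then have "dim \<hh> \<le> card {ut a b c p q r, W}" by (rule dim_le_card) simp
  also have "\<dots> \<le> 2" by (simp add: card_insert_if)
  finally show ?thesis by (simp add: lie_dim_def)
qed

lemma lie_dim_le_1:
  assumes "\<uu> = {0}"
  shows "lie_dim H \<le> 1"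
proof -
  have "\<hh> \<subseteq> span {ut a b c p q r}"
  proof
    fix Y assume "Y \<in> \<hh>"
    then obtain s U where Y: "U \<in> \<uu>" "Y = s *\<^sub>R ut a b c p q r + U" using dec by blast
    have U: "U = 0" using Y(1) unfolding assms by simp
    show "Y \<in> span {ut a b c p q r}"
      unfolding Y(2) U by (intro span_add span_scale span_base span_zero) auto
  qed
  then have "dim \<hh> \<le> card {ut a b c p q r}" by (rule dim_le_card) simp
  then show ?thesis by (simp add: lie_dim_def)
qed

end

theorem corollary4p7:
  fixes H :: "mat3 set"
  assumes "closed_subgroup H"
    and "connected H"
    and "H \<subseteq> A_grp <#>\<^bsub>SL3\<^esub> N_grp"
    and "compatible_with_A H"
  shows "\<not> cartan_decomposition_subgroup H \<longleftrightarrow>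
     lie_dim H \<le> 1
   \<or> (lie_algebra H = root_space root_alpha + root_space root_alpha_beta
      \<or> lie_algebra H = root_space root_beta + root_space root_alpha_beta)
   \<or> (\<exists>u. subspace u \<and> dim u = 1 \<and> u \<subseteq> root_space root_alpha + root_space root_beta
        \<and> u \<notin> {root_space root_alpha, root_space root_beta}
        \<and> lie_algebra H =
            {X \<in> lie_a. root_functional root_alpha X - root_functional root_beta X = 0} + u)
   \<or> (lie_dim H = 2 \<and> \<not> internal_semidirect H (H \<inter> A_grp) (H \<inter> N_grp))
   \<or> (\<exists>T. \<exists>\<omega>\<in>positive_roots. one_parameter_subgroup_of_A T
        \<and> internal_semidirect H T (root_subgroup \<omega>)
        \<and> line_in_region \<omega> (lie_algebra T))"
    (is "_ \<longleftrightarrow> ?c1 \<or> ?c2 \<or> ?c3 \<or> ?c4 \<or> ?c5")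
proof -
  interpret AN_subgroup H by unfold_locales (use assms in auto)
  have "\<not> coarse (sizes H) \<longleftrightarrow> ?c1 \<or> ?c2 \<or> ?c3 \<or> ?c4 \<or> ?c5"
  proof
    assume "?c1 \<or> ?c2 \<or> ?c3 \<or> ?c4 \<or> ?c5"
    then show "\<not> coarse (sizes H)"
    proof (elim disjE)
      assume ?c1 then show ?thesis by (rule not_coarse_dim_le_1)
    next
      assume "lie_algebra H = root_space root_alpha + root_space root_alpha_beta"
      then show ?thesis unfolding root_space_sums by (intro not_coarse_abelian disjI1)
    next
      assume "lie_algebra H = root_space root_beta + root_space root_alpha_beta"
      then show ?thesis unfolding root_space_sums by (intro not_coarse_abelian disjI2)
    next
      assume ?c3 then show ?thesis using not_coarse_mixed_algebra by blast
    next
      assume ?c4 then show ?thesis using not_coarse_not_semidirect by blast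
    next
      assume ?c5 then show ?thesis using not_coarse_region by blast
    qed
  next
    assume nc: "\<not> coarse (sizes H)"
    show "?c1 \<or> ?c2 \<or> ?c3 \<or> ?c4 \<or> ?c5"
    proof (cases rule: h_cases)
      case nil
      then have u: "lie_algebra H \<inter> nil3 = lie_algebra H" by blast
      show ?thesis
      proof (cases rule: u_cases)
        case (line W)
        then have "lie_algebra H \<subseteq> span {W}" using u by (auto simp: span_singleton)
        then have "dim (lie_algebra H) \<le> card {W}" by (rule dim_le_card) simp
        then show ?thesis by (simp add: lie_dim_def)
      next
        case (mixed x y z)
        then show ?thesis using coarse_mixed nc by blast
      next
        case alpha
        then show ?thesis unfolding u root_space_sums by blast
      next
        case beta
        then show ?thesis unfolding u root_space_sums by blast
      qed
    next
      case full
      then show ?thesis using coarse_full nc by blast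
    next
      case (line a b c p q r)
      interpret AN_line H a b c p q r by unfold_locales (use line in auto)
      show ?thesis
      proof (cases rule: u_cases)
        case (line W)
        show ?thesis
        proof (cases "W = 0")
          case True
          then show ?thesis using lie_dim_le_1 line by auto
        next
          case False
          show ?thesis
          proof (cases rule: u_line_cases[OF line(2) False,
                case_names r12 r23 r13 mixed two23 two12 j12 j23 j13])
            case r12
            have "ut 0 0 0 1 0 0 \<in> lie_algebra H \<inter> nil3" unfolding r12(2) by blast
            \<comment> \<open>Otherwise the entry outside the root would not be strictly in the
              middle, and the root criterion would give coarseness.\<close>
            then have "(c - a) * (c - b) < 0"
              using coarse_12[OF r12(1) tr ne, of 1 0] nc by (auto simp: not_le[symmetric])
            then have ?c5
              using region_semidirect[OF r12(1), of "(1,2)"] line_in_region_roots(1)[OF tr ne] r12(2)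
              by (simp add: root_space_ut positive_roots_eq)
            then show ?thesis by blast
          next
            case r23
            have "ut 0 0 0 0 1 0 \<in> lie_algebra H \<inter> nil3" unfolding r23(2) by blast
            then have "(a - b) * (a - c) < 0"
              using coarse_23[OF r23(1) tr ne, of 1 0] nc by (auto simp: not_le[symmetric])
            then have ?c5
              using region_semidirect[OF r23(1), of "(2,3)"] line_in_region_roots(2)[OF tr ne] r23(2)
              by (simp add: root_space_ut positive_roots_eq)
            then show ?thesis by blast
          next
            case r13
            have "ut 0 0 0 0 0 1 \<in> lie_algebra H \<inter> nil3" unfolding r13(2) by blast
            then have "(b - a) * (b - c) < 0"
              using coarse_13[OF r13(1) tr ne] nc by (auto simp: not_le[symmetric])
            then have ?c5
              using region_semidirect[OF r13(1), of "(1,3)"] line_in_region_roots(3)[OF tr ne] r13(2)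
              by (simp add: root_space_ut positive_roots_eq)
            then show ?thesis by blast
          next
            case (mixed x y)
            have ?c3 by (rule mixed_algebra[OF mixed])
            then show ?thesis by blast
          next
            \<comment> \<open>With \<open>a = b\<close> the product \<open>(a - b) * (a - c)\<close>
              vanishes, so the root criterion applies and contradicts the assumption.\<close>
            case (two23 y z)
            then show ?thesis using coarse_23[OF two23(1) tr ne two23(3)] nc by simp
          next
            case (two12 x z)
            then show ?thesis using coarse_12[OF two12(1) tr ne two12(3)] nc by simp
          next
            case j12
            then have "\<not> internal_semidirect H (H \<inter> A_grp) (H \<inter> N_grp)"
              by (intro jordan_not_coarse_not_semidirect(2)) blast
            \<comment> \<open>The dimension is at most 1, which is the first clause, or exactly 2,
              which is the fourth.\<close>
            then show ?thesis using lie_dim_le_2[OF line(2)] by linarith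
          next
            case j23
            then have "\<not> internal_semidirect H (H \<inter> A_grp) (H \<inter> N_grp)"
              by (intro jordan_not_coarse_not_semidirect(2)) blast
            then show ?thesis using lie_dim_le_2[OF line(2)] by linarith
          next
            case j13
            then have "\<not> internal_semidirect H (H \<inter> A_grp) (H \<inter> N_grp)"
              by (intro jordan_not_coarse_not_semidirect(2)) blast
            then show ?thesis using lie_dim_le_2[OF line(2)] by linarith
          qed
        qed
      next
        case (mixed x y z)
        then show ?thesis using coarse_mixed nc by blast
      next
        case alpha
        then show ?thesis using coarse_alpha nc by blast
      next
        case beta
        then show ?thesis using coarse_beta nc by blast
      qed
    qed
  qed
  then show ?thesis using cartan_iff_coarse[OF assms(1,2)] by simp
qed

end
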